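(* Let $p\ge1$ be an integer, $Q>0$, $\alpha>1/2$ and $\sigma^2>0$. For each $n\ge1$ let $\pi_n$ be the Gaussian prior restricted to $E_p(Q)$ defined in the context (independent coordinates, $\theta_0\equiv 0$, $\theta_j\sim N(0,\sigma^2v_j^{-(2p+1)})$ for $1\le j\le N_n$ and $\theta_j\sim N(0,\sigma^2v_j^{-2(2p+\alpha)})$ for $j\ge N_n+1$, conditioned on $E_p(Q)$), and let $\hat f_n$ be the Bayes' estimator (posterior expected density) arising from $\pi_n$. Then for any $0<Q'<Q$, $$\sup_{\boldsymbol\theta_0\in E_p(Q')}\mathbb E^n_{\boldsymbol\theta_0}\big[d_{\mathrm H}^2(f_{\boldsymbol\theta_0},\hat f_n)\big]\asymp n^{-2p/(2p+1)}.$$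
   Context: Trigonometric system on $[0,1]$: $\phi_0\equiv1$ and, for $k\ge1$, $\phi_{2k-1}(x)=\sqrt2\sin(2\pi kx)$, $\phi_{2k}(x)=\sqrt2\cos(2\pi kx)$. Put $v_0=0$ and, for $j\ge1$, $v_j=j+1$ if $j$ is odd, $v_j=j$ if $j$ is even. For $R>0$ the Sobolev ellipsoid is $E_p(R)=\{\boldsymbol\theta\in\ell_2:\sum_{j=0}^\infty v_j^{2p}\theta_j^2<R\}$. For $\boldsymbol\theta\in E_p(Q)$, $P_{\boldsymbol\theta}$ is the probability measure on $[0,1]$ with Lebesgue density $$f_{\boldsymbol\theta}(x)=\frac{\exp\{\sum_{j=1}^\infty\theta_j\phi_j(x)\}}{\int_0^1\exp\{\sum_{j=1}^\infty\theta_j\phi_j(t)\}\,dt},\qquad x\in[0,1].$$ The Hellinger distance between densities is $d_{\mathrm H}(f,g)=\{\int_0^1(\sqrt f-\sqrt g)^2\,dx\}^{1/2}$. The prior: let $A=\sum_{j=1}^\infty v_j^{-2p}$, $B=\sqrt{2QA}$, $B_1^2=e^{-8B}$, $\varepsilon_n=n^{-p/(2p+1)}$ and $N_n=\lceil(8Q/(B_1^2\varepsilon_n^2))^{1/(2p)}\rceil$. Let $\mu_n$ be the product probability measure on $\mathbb R^\infty$ (sequences $(\theta_0,\theta_1,\dots)$) under which the coordinates are independent, $\theta_0$ is a point mass at $0$, $\theta_j\sim N(0,\sigma^2v_j^{-(2p+1)})$ for $j=1,\dots,N_n$, and $\theta_j\sim N(0,\sigma^2v_j^{-2(2p+\alpha)})$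 for $j\ge N_n+1$. Then $\pi_n(\cdot)=\mu_n(\cdot\cap E_p(Q))/\mu_n(E_p(Q))$. The Bayes' estimator based on observations $X_1,\dots,X_n$ is $$\hat f_n(x)=\frac{\int f_{\boldsymbol\theta}(x)\prod_{i=1}^nf_{\boldsymbol\theta}(X_i)\,\pi_n(d\boldsymbol\theta)}{\int\prod_{i=1}^nf_{\boldsymbol\theta}(X_i)\,\pi_n(d\boldsymbol\theta)},\qquad x\in[0,1].$$ $\mathbb E^n_{\boldsymbol\theta_0}$ denotes expectation when $X_1,\dots,X_n$ are i.i.d. from $P_{\boldsymbol\theta_0}$. $a_n\asymp b_n$ means that there are constants $0<c\le C<\infty$ with $c\,b_n\le a_n\le C\,b_n$ for all large $n$. *)

theory Defs
  imports "HOL-Probability.Probability"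
begin

definition trig :: "nat \<Rightarrow> real \<Rightarrow> real" where
  "trig j x =
    (if j = 0 then 1
     else if odd j then sqrt 2 * sin (2 * pi * real ((j + 1) div 2) * x)
     else sqrt 2 * cos (2 * pi * real (j div 2) * x))"

lemma trig_0: "trig 0 x = 1"
  by (simp add: trig_def)

lemma trig_odd: "k \<ge> 1 \<Longrightarrow> trig (2 * k - 1) x = sqrt 2 * sin (2 * pi * real k * x)"
  by (simp add: trig_def)

lemma trig_even: "k \<ge> 1 \<Longrightarrow> trig (2 * k) x = sqrt 2 * cos (2 * pi * real k * x)"
  by (simp add: trig_def)

definition freq :: "nat \<Rightarrow> nat" where
  "freq j = (if odd j then j + 1 else j)"

lemma freq_0: "freq 0 = 0"
  by (simp add: freq_def)

text \<open>Convergence of the weighted series is stated explicitly because \<open>suminf\<close> is total.\<close>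

definition sobolev_ellipsoid :: "nat \<Rightarrow> real \<Rightarrow> (nat \<Rightarrow> real) set" where
  "sobolev_ellipsoid p R =
    {\<theta>. summable (\<lambda>j. (\<theta> j)\<^sup>2) \<and>
         summable (\<lambda>j. real (freq j) ^ (2 * p) * (\<theta> j)\<^sup>2) \<and>
         (\<Sum>j. real (freq j) ^ (2 * p) * (\<theta> j)\<^sup>2) < R}"

text \<open>In the exponent the coordinate with index 0 is omitted.\<close>

definition exp_series :: "(nat \<Rightarrow> real) \<Rightarrow> real \<Rightarrow> real" where
  "exp_series \<theta> x = exp (\<Sum>j. \<theta> (Suc j) * trig (Suc j) x)"

definition dens :: "(nat \<Rightarrow> real) \<Rightarrow> real \<Rightarrow> real" where
  "dens \<theta> x = exp_series \<theta> x / (LBINT t:{0..1}. exp_series \<theta> t)"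

definition model :: "(nat \<Rightarrow> real) \<Rightarrow> real measure" where
  "model \<theta> = density (restrict_space lborel {0..1}) (\<lambda>x. ennreal (dens \<theta> x))"

definition hellinger :: "(real \<Rightarrow> real) \<Rightarrow> (real \<Rightarrow> real) \<Rightarrow> real" where
  "hellinger f g = sqrt (LBINT x:{0..1}. (sqrt (f x) - sqrt (g x))\<^sup>2)"

text \<open>The second argument is the variance, whereas \<open>normal_density\<close> takes the standard deviation.\<close>

definition gaussian :: "real \<Rightarrow> real \<Rightarrow> real measure" where
  "gaussian m var = density lborel (\<lambda>x. ennreal (normal_density m (sqrt var) x))"

definition A_const :: "nat \<Rightarrow> real" where
  "A_const p = (\<Sum>j. 1 / real (freq (Suc j)) ^ (2 * p))"

definition B_const :: "nat \<Rightarrow> real \<Rightarrow> real" where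
  "B_const p Q = sqrt (2 * Q * A_const p)"

definition B1_sq :: "nat \<Rightarrow> real \<Rightarrow> real" where
  "B1_sq p Q = exp (- 8 * B_const p Q)"

definition eps :: "nat \<Rightarrow> nat \<Rightarrow> real" where
  "eps p n = real n powr (- (real p / (2 * real p + 1)))"

definition cutoff :: "nat \<Rightarrow> real \<Rightarrow> nat \<Rightarrow> nat" where
  "cutoff p Q n = nat \<lceil>(8 * Q / (B1_sq p Q * (eps p n)\<^sup>2)) powr (1 / (2 * real p))\<rceil>"

text \<open>In the prior, \<open>s\<close> is the variance factor (\<open>\<sigma>\<^sup>2\<close>, not \<open>\<sigma>\<close>).\<close>

definition coord_prior :: "nat \<Rightarrow> real \<Rightarrow> real \<Rightarrow> real \<Rightarrow> nat \<Rightarrow> nat \<Rightarrow> real measure" where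
  "coord_prior p Q \<alpha> s n j =
    (if j = 0 then return borel 0
     else if j \<le> cutoff p Q n
     then gaussian 0 (s * real (freq j) powr (- (2 * real p + 1)))
     else gaussian 0 (s * real (freq j) powr (- 2 * (2 * real p + \<alpha>))))"

definition unrestricted_prior ::
    "nat \<Rightarrow> real \<Rightarrow> real \<Rightarrow> real \<Rightarrow> nat \<Rightarrow> (nat \<Rightarrow> real) measure" where
  "unrestricted_prior p Q \<alpha> s n = (\<Pi>\<^sub>M j\<in>UNIV. coord_prior p Q \<alpha> s n j)"

definition prior ::
    "nat \<Rightarrow> real \<Rightarrow> real \<Rightarrow> real \<Rightarrow> nat \<Rightarrow> (nat \<Rightarrow> real) measure" where
  "prior p Q \<alpha> s n = uniform_measure (unrestricted_prior p Q \<alpha> s n) (sobolev_ellipsoid p Q)"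

definition bayes_estimator ::
    "(nat \<Rightarrow> real) measure \<Rightarrow> nat \<Rightarrow> (nat \<Rightarrow> real) \<Rightarrow> real \<Rightarrow> real" where
  "bayes_estimator \<rho> n X x =
    (\<integral>\<theta>. dens \<theta> x * (\<Prod>i=1..n. dens \<theta> (X i)) \<partial>\<rho>) /
    (\<integral>\<theta>. (\<Prod>i=1..n. dens \<theta> (X i)) \<partial>\<rho>)"

definition sample :: "(nat \<Rightarrow> real) \<Rightarrow> nat \<Rightarrow> (nat \<Rightarrow> real) measure" where
  "sample \<theta> n = (\<Pi>\<^sub>M i\<in>{1..n}. model \<theta>)"

end

theory Submission
  imports Defs
begin

text \<open>
Let \<open>N\<close> be the cutoff frequency of the prior. It is of the order \<open>n powr (1 / (2 * p + 1))\<close>, so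
\<open>N ^ (2 * p + 1)\<close> is of the order \<open>n\<close> and the claimed rate is \<open>1 / N ^ (2 * p)\<close>. On an ellipsoid
with \<open>p \<ge> 1\<close> the exponents of the densities are bounded by a common constant. Hence all densities
lie between two positive constants there, and squared Hellinger distances, chi-square divergences and
squared \<open>L\<^sup>2\<close> distances are all at most a constant times the squared \<open>\<ell>\<^sub>2\<close> distance of the parameters.

For the upper bound, concavity of the square root shows that the loss of the posterior mean is at most the
posterior mean of the loss (\<open>hell2_post_mean_le\<close>). Cut the ellipsoid into cells of \<open>\<ell>\<^sub>2\<close> diameter of the order \<open>1 / N ^ p\<close>;
\<open>exp (K1 * N)\<close> cells suffice (\<open>cell_count\<close>). The cells whose distance from the truth is at most a
constant times \<open>1 / N ^ p\<close> contribute the rate itself. Every other cell is separated from the truth by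
a likelihood ratio test with errors \<open>exp (- K4 * N)\<close>, where \<open>K4\<close> is as large as desired
(\<open>likelihood_ratio_test_bounds\<close>). The evidence in the denominator of the posterior is bounded
below in the strong sense that its inverse, normalised by the true likelihood, has mean at most
\<open>exp (K2 * N)\<close>: an \<open>\<ell>\<^sub>2\<close> ball of radius of the order \<open>1 / N ^ p\<close> around the truth has
prior mass at least \<open>exp (- K * N)\<close> (\<open>prior_mass\<close>), and likelihood ratios are bounded
(\<open>inverse_evidence_bound\<close>). A bound on the mean of the inverse, rather than a Chebyshev bound, makes all
exceptional probabilities exponentially small in \<open>N\<close>; an error of the order \<open>1 / N\<close> would exceed
the rate. The lemma \<open>post_mean_risk\<close> combines these facts for an arbitrary prior on bounded densities.

The lower bound holds for every bounded estimator. The \<open>2 ^ N\<close> parameters with entries \<open>\<plusminus> \<gamma>\<close> in the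
first \<open>N\<close> coordinates, where \<open>\<gamma>\<close> is a small multiple of \<open>1 / N powr (p + 1 / 2)\<close>, lie in the smaller
ellipsoid. As \<open>\<gamma>\<^sup>2\<close> is at most a small multiple of \<open>1 / n\<close>, parameters that differ in one sign
cannot be distinguished by \<open>n\<close> observations. The square root of the density is \<open>1 + u / 2\<close> up to an error of
smaller order, with \<open>u\<close> the exponent, so by Bessel's inequality the Hellinger loss dominates the sum over the
coordinates of the squared errors in estimating the sign patterns, which is on average of the order
\<open>N * \<gamma>\<^sup>2\<close> (\<open>hypercube_lower_bound\<close>, an instance of Assouad's method).
\<close>

section \<open>Elementary inequalities and integrals\<close>

lemma square_add_le: "(a + b)\<^sup>2 \<le> 2 * a\<^sup>2 + 2 * (b::real)\<^sup>2"
proof -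
  have "0 \<le> (a - b)\<^sup>2" by simp
  then show ?thesis unfolding power2_sum power2_diff by simp
qed

lemma mult_le_square_add: "a * b \<le> a\<^sup>2 + (b::real)\<^sup>2 / 4"
proof -
  have "0 \<le> (2 * a - b)\<^sup>2" by simp
  then show ?thesis unfolding power2_diff by (simp add: power_mult_distrib)
qed

lemma (in prob_space) integrable_bounded:
  fixes h :: "'a \<Rightarrow> real"
  assumes "h \<in> borel_measurable M" and "\<And>x. x \<in> space M \<Longrightarrow> \<bar>h x\<bar> \<le> c"
  shows "integrable M h"
  using assms by (intro integrable_const_bound[where B = c]) auto

lemma (in prob_space) integral_le_bound:
  fixes h :: "'a \<Rightarrow> real"
  assumes "h \<in> borel_measurable M" and "\<And>x. x \<in> space M \<Longrightarrow> \<bar>h x\<bar> \<le> c"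
  shows "\<bar>\<integral>x. h x \<partial>M\<bar> \<le> c"
proof -
  have "\<bar>\<integral>x. h x \<partial>M\<bar> \<le> (\<integral>x. \<bar>h x\<bar> \<partial>M)"
    using integral_norm_bound[of M h] by simp
  also have "\<dots> \<le> (\<integral>x. c \<partial>M)"
    using assms by (intro integral_mono integrable_bounded[where c = c]) (auto intro: order_trans[OF abs_ge_zero])
  finally show ?thesis by (simp add: prob_space)
qed

lemma (in prob_space) square_integral_le:
  fixes h :: "'a \<Rightarrow> real"
  assumes "integrable M h" "integrable M (\<lambda>x. (h x)\<^sup>2)"
  shows "(\<integral>x. h x \<partial>M)\<^sup>2 \<le> (\<integral>x. (h x)\<^sup>2 \<partial>M)"
proof -
  have "0 \<le> variance h" by (intro Bochner_Integration.integral_nonneg) auto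
  then show ?thesis using variance_eq[OF assms] by simp
qed

lemma fubini_bounded:
  fixes k :: "'a \<Rightarrow> 'b \<Rightarrow> real"
  assumes "prob_space M1" "prob_space M2"
    and [measurable]: "case_prod k \<in> borel_measurable (M1 \<Otimes>\<^sub>M M2)"
    and bd: "\<And>x y. x \<in> space M1 \<Longrightarrow> y \<in> space M2 \<Longrightarrow> \<bar>k x y\<bar> \<le> c"
  shows "(\<integral>x. \<integral>y. k x y \<partial>M2 \<partial>M1) = (\<integral>y. \<integral>x. k x y \<partial>M1 \<partial>M2)"
    and "integrable M1 (\<lambda>x. \<integral>y. k x y \<partial>M2)"
    and "integrable M2 (\<lambda>y. \<integral>x. k x y \<partial>M1)"
proof -
  interpret M1: prob_space M1 by fact
  interpret M2: prob_space M2 by fact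
  interpret pair_prob_space M1 M2 ..
  have int: "integrable (M1 \<Otimes>\<^sub>M M2) (case_prod k)"
    using bd by (intro integrable_bounded[where c = c]) (auto simp: space_pair_measure)
  show "(\<integral>x. \<integral>y. k x y \<partial>M2 \<partial>M1) = (\<integral>y. \<integral>x. k x y \<partial>M1 \<partial>M2)"
    using Fubini_integral[OF int] by simp
  show "integrable M1 (\<lambda>x. \<integral>y. k x y \<partial>M2)" by (rule integrable_fst[OF int])
  show "integrable M2 (\<lambda>y. \<integral>x. k x y \<partial>M1)" by (rule integrable_snd[OF int])
qed

lemma PiM_density_real:
  fixes f :: "'a \<Rightarrow> real"
  assumes "finite I" and U: "prob_space U" and [measurable]: "f \<in> borel_measurable U"
    and f0: "\<And>x. 0 \<le> f x" and dU: "prob_space (density U (\<lambda>x. ennreal (f x)))"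
  shows "PiM I (\<lambda>_. density U (\<lambda>x. ennreal (f x))) =
    density (PiM I (\<lambda>_. U)) (\<lambda>X. ennreal (\<Prod>i\<in>I. f (X i)))"
proof -
  interpret U: prob_space U by fact
  interpret dU: prob_space "density U (\<lambda>x. ennreal (f x))" by fact
  interpret PU: product_sigma_finite "\<lambda>_::'b. U" ..
  interpret PD: product_sigma_finite "\<lambda>_::'b. density U (\<lambda>x. ennreal (f x))" ..
  have meas[measurable]: "(\<lambda>X. ennreal (\<Prod>i\<in>I. f (X i))) \<in> borel_measurable (PiM I (\<lambda>_. U))"
    by measurable
  show ?thesis
  proof (rule PD.PiM_eqI[symmetric])
    show "sets (density (PiM I (\<lambda>_. U)) (\<lambda>X. ennreal (\<Prod>i\<in>I. f (X i)))) =
      sets (PiM I (\<lambda>_. density U (\<lambda>x. ennreal (f x))))"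
      by (simp cong: sets_PiM_cong)
    fix A :: "'b \<Rightarrow> 'a set"
    assume A: "\<And>i. i \<in> I \<Longrightarrow> A i \<in> sets (density U (\<lambda>x. ennreal (f x)))"
    then have A'[measurable]: "\<And>i. i \<in> I \<Longrightarrow> A i \<in> sets U" by simp
    have "emeasure (density (PiM I (\<lambda>_. U)) (\<lambda>X. ennreal (\<Prod>i\<in>I. f (X i)))) (Pi\<^sub>E I A)
      = (\<integral>\<^sup>+X. ennreal (\<Prod>i\<in>I. f (X i)) * indicator (Pi\<^sub>E I A) X \<partial>PiM I (\<lambda>_. U))"
      using \<open>finite I\<close> by (subst emeasure_density) (auto intro!: sets_PiM_I_finite)
    also have "\<dots> = (\<integral>\<^sup>+X. (\<Prod>i\<in>I. ennreal (f (X i)) * indicator (A i) (X i)) \<partial>PiM I (\<lambda>_. U))"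
    proof (rule nn_integral_cong)
      fix X assume X: "X \<in> space (PiM I (\<lambda>_. U))"
      have "indicator (Pi\<^sub>E I A) X = (\<Prod>i\<in>I. indicator (A i) (X i) :: ennreal)"
      proof (cases "X \<in> Pi\<^sub>E I A")
        case True
        then show ?thesis by (auto simp: PiE_def Pi_def intro!: prod.neutral)
      next
        case False
        then obtain i where "i \<in> I" "X i \<notin> A i"
          using X by (auto simp: space_PiM PiE_def)
        then show ?thesis using False \<open>finite I\<close>
          by (auto simp: prod_zero_iff indicator_def intro!: bexI[of _ i])
      qed
      then show "ennreal (\<Prod>i\<in>I. f (X i)) * indicator (Pi\<^sub>E I A) X =
          (\<Prod>i\<in>I. ennreal (f (X i)) * indicator (A i) (X i))"
        using f0 by (simp add: prod.distrib prod_ennreal)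
    qed
    also have "\<dots> = (\<Prod>i\<in>I. \<integral>\<^sup>+x. ennreal (f x) * indicator (A i) x \<partial>U)"
      using \<open>finite I\<close> A' by (intro PU.product_nn_integral_prod) auto
    also have "\<dots> = (\<Prod>i\<in>I. emeasure (density U (\<lambda>x. ennreal (f x))) (A i))"
      using A' by (intro prod.cong) (auto simp: emeasure_density)
    finally show "emeasure (density (PiM I (\<lambda>_. U)) (\<lambda>X. ennreal (\<Prod>i\<in>I. f (X i)))) (Pi\<^sub>E I A) =
      (\<Prod>i\<in>I. emeasure (density U (\<lambda>x. ennreal (f x))) (A i))" .
  qed fact
qed

section \<open>Densities bounded away from zero and infinity\<close>

locale bounded_densities = prob_space U for U :: "'b measure" +
  fixes lo hi :: real
  assumes lo_pos: "0 < lo"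
begin

definition bdens :: "('b \<Rightarrow> real) \<Rightarrow> bool" where
  "bdens f \<longleftrightarrow> f \<in> borel_measurable U \<and> (\<forall>x. lo \<le> f x \<and> f x \<le> hi) \<and> (\<integral>x. f x \<partial>U) = 1"

definition hell2 :: "('b \<Rightarrow> real) \<Rightarrow> ('b \<Rightarrow> real) \<Rightarrow> real" where
  "hell2 f g = (\<integral>x. (sqrt (f x) - sqrt (g x))\<^sup>2 \<partial>U)"

definition dist2 :: "('b \<Rightarrow> real) \<Rightarrow> ('b \<Rightarrow> real) \<Rightarrow> real" where
  "dist2 f g = (\<integral>x. (f x - g x)\<^sup>2 \<partial>U)"

lemma bdens_meas[measurable_dest]: "bdens f \<Longrightarrow> f \<in> borel_measurable U"
  and bdens_lo: "bdens f \<Longrightarrow> lo \<le> f x"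
  and bdens_hi: "bdens f \<Longrightarrow> f x \<le> hi"
  and bdens_int: "bdens f \<Longrightarrow> (\<integral>x. f x \<partial>U) = 1"
  by (auto simp: bdens_def)

lemma bdens_pos: "bdens f \<Longrightarrow> 0 < f x"
  using bdens_lo[of f x] lo_pos by linarith

lemma hi_pos: "bdens f \<Longrightarrow> 0 < hi"
  using bdens_pos[of f] bdens_hi[of f] less_le_trans by blast

lemma bdens_integrable: "bdens f \<Longrightarrow> integrable U f"
  by (rule integrable_bounded[where c = hi])
    (use bdens_meas bdens_hi bdens_pos in \<open>auto simp: less_imp_le abs_of_pos\<close>)

lemma sqrt_prod_le:
  assumes "bdens f" "bdens g"
  shows "sqrt (f x) * sqrt (g x) \<le> hi"
proof -
  have "sqrt (f x) * sqrt (g x) \<le> sqrt hi * sqrt hi"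
    using bdens_hi[OF assms(1)] bdens_hi[OF assms(2)] bdens_pos[OF assms(2)] hi_pos[OF assms(1)]
    by (intro mult_mono) (auto simp: less_imp_le)
  then show ?thesis using hi_pos[OF assms(1)] by simp
qed

lemma integrable_sqrt_prod:
  assumes "bdens f" "bdens g"
  shows "integrable U (\<lambda>x. sqrt (f x) * sqrt (g x))"
  using assms[THEN bdens_meas] sqrt_prod_le[OF assms] bdens_pos[OF assms(1)] bdens_pos[OF assms(2)]
  by (intro integrable_bounded[where c = hi]) (auto simp: less_imp_le)

lemma sq_sqrt_diff:
  assumes "bdens f" "bdens g"
  shows "(sqrt (f x) - sqrt (g x))\<^sup>2 = f x + g x - 2 * (sqrt (f x) * sqrt (g x))"
  using bdens_pos[OF assms(1), of x] bdens_pos[OF assms(2), of x]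
  by (simp add: power2_diff less_imp_le)

lemma integrable_hell:
  assumes "bdens f" "bdens g"
  shows "integrable U (\<lambda>x. (sqrt (f x) - sqrt (g x))\<^sup>2)"
  unfolding sq_sqrt_diff[OF assms]
  using bdens_integrable[OF assms(1)] bdens_integrable[OF assms(2)] integrable_sqrt_prod[OF assms]
  by auto

lemma affinity_eq:
  assumes "bdens f" "bdens g"
  shows "(\<integral>x. sqrt (f x) * sqrt (g x) \<partial>U) = 1 - hell2 f g / 2"
proof -
  have "hell2 f g = (\<integral>x. f x + g x - 2 * (sqrt (f x) * sqrt (g x)) \<partial>U)"
    unfolding hell2_def sq_sqrt_diff[OF assms] ..
  also have "\<dots> = 2 - 2 * (\<integral>x. sqrt (f x) * sqrt (g x) \<partial>U)"
    using bdens_integrable[OF assms(1)] bdens_integrable[OF assms(2)] integrable_sqrt_prod[OF assms]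
      bdens_int[OF assms(1)] bdens_int[OF assms(2)]
    by simp
  finally have eq: "hell2 f g = 2 - 2 * (\<integral>x. sqrt (f x) * sqrt (g x) \<partial>U)" .
  have "h = 2 - 2 * i \<Longrightarrow> i = 1 - h / 2" for h i :: real by (simp add: field_simps)
  from this[OF eq] show ?thesis .
qed

lemma hell2_nonneg: "0 \<le> hell2 f g"
  unfolding hell2_def by (intro Bochner_Integration.integral_nonneg) auto

lemma hell2_commute: "hell2 f g = hell2 g f"
  unfolding hell2_def by (simp add: power2_commute)

lemma affinity_nonneg:
  assumes "bdens f" "bdens g"
  shows "0 \<le> (\<integral>x. sqrt (f x) * sqrt (g x) \<partial>U)"
  using bdens_pos[OF assms(1)] bdens_pos[OF assms(2)] by (intro Bochner_Integration.integral_nonneg) (simp add: less_imp_le)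

lemma hell2_le_2:
  assumes "bdens f" "bdens g"
  shows "hell2 f g \<le> 2"
  using affinity_nonneg[OF assms] affinity_eq[OF assms] by simp

lemma integrable_dist2:
  assumes "bdens f" "bdens g"
  shows "integrable U (\<lambda>x. (f x - g x)\<^sup>2)"
proof (rule integrable_bounded[where c = "hi\<^sup>2"])
  show "(\<lambda>x. (f x - g x)\<^sup>2) \<in> borel_measurable U"
    using assms[THEN bdens_meas] by simp
  fix x
  have "\<bar>f x - g x\<bar> \<le> \<bar>hi\<bar>"
    using bdens_pos[OF assms(1), of x] bdens_pos[OF assms(2), of x]
      bdens_hi[OF assms(1), of x] bdens_hi[OF assms(2), of x] by linarith
  then show "\<bar>(f x - g x)\<^sup>2\<bar> \<le> hi\<^sup>2" by (simp add: abs_le_square_iff)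
qed

lemma dist2_nonneg: "0 \<le> dist2 f g"
  unfolding dist2_def by (intro Bochner_Integration.integral_nonneg) auto

lemma hell2_le_dist2:
  assumes "bdens f" "bdens g"
  shows "hell2 f g \<le> dist2 f g / (4 * lo)"
proof -
  have "(sqrt (f x) - sqrt (g x))\<^sup>2 \<le> (f x - g x)\<^sup>2 / (4 * lo)" for x
  proof -
    have "sqrt lo \<le> sqrt (f x)" "sqrt lo \<le> sqrt (g x)"
      using bdens_lo[OF assms(1)] bdens_lo[OF assms(2)] by auto
    then have "2 * sqrt lo \<le> sqrt (f x) + sqrt (g x)" by linarith
    then have "(2 * sqrt lo)\<^sup>2 \<le> (sqrt (f x) + sqrt (g x))\<^sup>2"
      using lo_pos by (intro power_mono) auto
    then have "4 * lo \<le> (sqrt (f x) + sqrt (g x))\<^sup>2"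
      using lo_pos by (simp add: power_mult_distrib)
    then have "(sqrt (f x) - sqrt (g x))\<^sup>2 * (4 * lo) \<le>
        (sqrt (f x) - sqrt (g x))\<^sup>2 * (sqrt (f x) + sqrt (g x))\<^sup>2"
      by (intro mult_left_mono) auto
    also have "\<dots> = ((sqrt (f x))\<^sup>2 - (sqrt (g x))\<^sup>2)\<^sup>2"
      unfolding power_mult_distrib[symmetric] by (simp add: power2_eq_square algebra_simps)
    also have "\<dots> = (f x - g x)\<^sup>2"
      using bdens_pos[OF assms(1), of x] bdens_pos[OF assms(2), of x] by simp
    finally show ?thesis using lo_pos by (simp add: field_simps)
  qed
  then have "hell2 f g \<le> (\<integral>x. (f x - g x)\<^sup>2 / (4 * lo) \<partial>U)"
    unfolding hell2_def using integrable_hell[OF assms] integrable_dist2[OF assms]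
    by (intro integral_mono) auto
  then show ?thesis by (simp add: dist2_def)
qed

lemma hell2_triangle:
  assumes "bdens f" "bdens g" "bdens h"
  shows "hell2 f h \<le> 2 * hell2 f g + 2 * hell2 g h"
proof -
  have "hell2 f h \<le> (\<integral>x. 2 * (sqrt (f x) - sqrt (g x))\<^sup>2 + 2 * (sqrt (g x) - sqrt (h x))\<^sup>2 \<partial>U)"
    unfolding hell2_def
  proof (intro integral_mono)
    fix x
    show "(sqrt (f x) - sqrt (h x))\<^sup>2 \<le> 2 * (sqrt (f x) - sqrt (g x))\<^sup>2 + 2 * (sqrt (g x) - sqrt (h x))\<^sup>2"
      using square_add_le[of "sqrt (f x) - sqrt (g x)" "sqrt (g x) - sqrt (h x)"] by simp
  qed (use integrable_hell[OF assms(1,3)] integrable_hell[OF assms(1,2)] integrable_hell[OF assms(2,3)] in auto)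
  also have "\<dots> = 2 * hell2 f g + 2 * hell2 g h"
    unfolding hell2_def using integrable_hell[OF assms(1,2)] integrable_hell[OF assms(2,3)] by simp
  finally show ?thesis .
qed

text \<open>The \<open>n\<close>-th power of the left-hand side is the mean under \<open>f\<close> of the inverse of the likelihood ratio of \<open>g\<close> to \<open>f\<close>;
  it controls how small the evidence can be.\<close>

lemma chi_square_le:
  assumes "bdens f" "bdens g"
  shows "(\<integral>x. (f x)\<^sup>2 / g x \<partial>U) \<le> 1 + dist2 f g / lo"
proof -
  have pw: "(f x)\<^sup>2 / g x \<le> (f x - g x)\<^sup>2 / lo + 2 * f x - g x" for x
  proof -
    have "(f x)\<^sup>2 / g x = (f x - g x)\<^sup>2 / g x + 2 * f x - g x"
      using bdens_pos[OF assms(2), of x] by (simp add: field_simps power2_eq_square)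
    also have "(f x - g x)\<^sup>2 / g x \<le> (f x - g x)\<^sup>2 / lo"
      using bdens_lo[OF assms(2), of x] lo_pos by (intro divide_left_mono) auto
    finally show ?thesis by simp
  qed
  have "(\<integral>x. (f x)\<^sup>2 / g x \<partial>U) \<le> (\<integral>x. (f x - g x)\<^sup>2 / lo + 2 * f x - g x \<partial>U)"
  proof (intro integral_mono')
    show "integrable U (\<lambda>x. (f x - g x)\<^sup>2 / lo + 2 * f x - g x)"
      using integrable_dist2[OF assms] bdens_integrable[OF assms(1)] bdens_integrable[OF assms(2)] by auto
    fix x
    show "(f x)\<^sup>2 / g x \<le> (f x - g x)\<^sup>2 / lo + 2 * f x - g x" by (rule pw)
    have "0 \<le> (f x)\<^sup>2 / g x"
      using bdens_pos[OF assms(2), of x] by simp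
    then show "0 \<le> (f x - g x)\<^sup>2 / lo + 2 * f x - g x" using pw[of x] by linarith
  qed
  also have "\<dots> = 1 + dist2 f g / lo"
    using integrable_dist2[OF assms] bdens_integrable[OF assms(1)] bdens_integrable[OF assms(2)]
      bdens_int[OF assms(1)] bdens_int[OF assms(2)]
    by (simp add: dist2_def)
  finally show ?thesis .
qed

text \<open>The left-hand side is the mean under \<open>f\<close> of the square root of the likelihood ratio of \<open>f0\<close> to \<open>g\<close>;
  its \<open>n\<close>-th power bounds the probability that the likelihood ratio test takes data from
  \<open>f\<close> for data from \<open>f0\<close>. In \<open>f = g + (f - g)\<close> the first term contributes the affinity of \<open>f0\<close> and \<open>g\<close>. As
  \<open>f - g\<close> has integral zero, the second one contributes the integral of
  \<open>(f - g) * (sqrt (f0 / g) - 1)\<close>, which the inequality between arithmetic and geometric mean splits into half of what the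
  Hellinger distance gains and a squared \<open>L\<^sup>2\<close> distance. So one test serves a whole \<open>L\<^sup>2\<close> ball around \<open>g\<close>.\<close>

lemma tilted_mean_le:
  assumes "bdens f" "bdens f0" "bdens g"
  shows "(\<integral>x. f x * (sqrt (f0 x) / sqrt (g x)) \<partial>U) \<le> 1 - hell2 f0 g / 4 + dist2 f g / lo"
proof -
  have pw: "f x * (sqrt (f0 x) / sqrt (g x)) \<le>
      (f x - g x)\<^sup>2 / lo + (sqrt (f0 x) - sqrt (g x))\<^sup>2 / 4 + sqrt (f0 x) * sqrt (g x) + f x - g x" for x
  proof -
    define a b where "a = sqrt (f0 x)" and "b = sqrt (g x)"
    have b: "0 < b" "b\<^sup>2 = g x" using bdens_pos[OF assms(3), of x] by (auto simp: b_def less_imp_le)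
    have "f x * (a / b) = (f x - g x) / b * (a - b) + a * b + f x - g x"
      using b by (simp add: field_simps power2_eq_square)
    also have "(f x - g x) / b * (a - b) \<le> ((f x - g x) / b)\<^sup>2 + (a - b)\<^sup>2 / 4"
      by (rule mult_le_square_add)
    also have "((f x - g x) / b)\<^sup>2 = (f x - g x)\<^sup>2 / g x"
      using b by (simp add: power_divide)
    also have "(f x - g x)\<^sup>2 / g x \<le> (f x - g x)\<^sup>2 / lo"
      using bdens_lo[OF assms(3), of x] lo_pos by (intro divide_left_mono) auto
    finally show ?thesis unfolding a_def b_def by simp
  qed
  have ints: "integrable U (\<lambda>x. (f x - g x)\<^sup>2)" "integrable U (\<lambda>x. (sqrt (f0 x) - sqrt (g x))\<^sup>2)"
    "integrable U (\<lambda>x. sqrt (f0 x) * sqrt (g x))" "integrable U f" "integrable U g"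
    using assms by (auto intro: integrable_dist2 integrable_hell integrable_sqrt_prod bdens_integrable)
  have "(\<integral>x. f x * (sqrt (f0 x) / sqrt (g x)) \<partial>U) \<le>
     (\<integral>x. (f x - g x)\<^sup>2 / lo + (sqrt (f0 x) - sqrt (g x))\<^sup>2 / 4 + sqrt (f0 x) * sqrt (g x) + f x - g x \<partial>U)"
  proof (intro integral_mono' pw)
    fix x
    have "0 \<le> f x * (sqrt (f0 x) / sqrt (g x))"
      using assms[THEN bdens_pos, of x] by (simp add: less_imp_le)
    then show "0 \<le> (f x - g x)\<^sup>2 / lo + (sqrt (f0 x) - sqrt (g x))\<^sup>2 / 4 + sqrt (f0 x) * sqrt (g x) + f x - g x"
      using pw[of x] by linarith
  qed (use ints in auto)
  also have "\<dots> = dist2 f g / lo + hell2 f0 g / 4 + (\<integral>x. sqrt (f0 x) * sqrt (g x) \<partial>U)"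
    using ints bdens_int[OF assms(1)] bdens_int[OF assms(3)]
    by (simp add: dist2_def hell2_def)
  also have "\<dots> = 1 - hell2 f0 g / 4 + dist2 f g / lo"
    unfolding affinity_eq[OF assms(2,3)] by simp
  finally show ?thesis .
qed

end

section \<open>The risk of the posterior mean\<close>

text \<open>Here \<open>N / D\<close> is the posterior probability of a set, and \<open>u\<close> is a statistic that is large when the
  truth is favoured over this set. Either the evidence \<open>D\<close> is below the threshold \<open>\<mu>\<close>, or \<open>N / D \<le> sqrt (N / D)\<close> is at most
  \<open>sqrt (N / \<mu>)\<close>, and \<open>sqrt N\<close> is the geometric mean of \<open>N * u\<close> and \<open>1 / u\<close>, the two errors of
  the test. The bound is linear in quantities with computable means.\<close>

lemma posterior_mass_bound:
  fixes N D u \<mu> :: real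
  assumes "0 \<le> N" "N \<le> D" "0 < D" "0 < u" "0 < \<mu>"
  shows "N / D \<le> (N * u + 1 / u) / (2 * sqrt \<mu>) + \<mu> / D"
proof (cases "D \<le> \<mu>")
  case True
  have "N / D \<le> 1" using assms by simp
  also have "1 \<le> \<mu> / D" using True assms by simp
  finally have "N / D \<le> \<mu> / D" .
  moreover have "0 \<le> (N * u + 1 / u) / (2 * sqrt \<mu>)" using assms by simp
  ultimately show ?thesis by linarith
next
  case False
  define q where "q = N / D"
  have q: "0 \<le> q" "q \<le> 1" using assms by (auto simp: q_def)
  have "q\<^sup>2 \<le> q" using q by (simp add: power2_eq_square mult_left_le)
  then have "q \<le> sqrt q" using q by (intro real_le_rsqrt) 
  also have "sqrt q \<le> sqrt (N / \<mu>)"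
    unfolding q_def using False assms by (intro real_sqrt_le_mono divide_left_mono) auto
  also have "\<dots> = sqrt N / sqrt \<mu>" by (simp add: real_sqrt_divide)
  also have "sqrt N = sqrt (N * u) * sqrt (1 / u)"
    using assms by (simp add: real_sqrt_mult[symmetric])
  also have "\<dots> \<le> (N * u + 1 / u) / 2"
    using assms sum_squares_bound[of "sqrt (N * u)" "sqrt (1 / u)"] by simp
  finally have "q \<le> (N * u + 1 / u) / 2 / sqrt \<mu>"
    using assms by (simp add: divide_right_mono)
  then have "N / D \<le> (N * u + 1 / u) / (2 * sqrt \<mu>)" by (simp add: q_def)
  moreover have "0 \<le> \<mu> / D" using assms by simp
  ultimately show ?thesis by linarith
qed

text \<open>Cauchy--Schwarz for \<open>sqrt L\<close> and \<open>1 / sqrt L\<close>, in the form of the tangent inequality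
  \<open>1 / y \<ge> 2 * t - t\<^sup>2 * y\<close> with the best \<open>t\<close>.\<close>

lemma (in prob_space) square_prob_div_integral_le:
  fixes L :: "'a \<Rightarrow> real"
  assumes [measurable]: "L \<in> borel_measurable M" "B \<in> sets M"
    and L: "\<And>x. x \<in> space M \<Longrightarrow> l \<le> L x" "\<And>x. x \<in> space M \<Longrightarrow> L x \<le> h" and "0 < l"
  shows "(prob B)\<^sup>2 / (\<integral>x. L x \<partial>M) \<le> (\<integral>x. indicator B x * (1 / L x) \<partial>M)"
proof -
  define D where "D = (\<integral>x. L x \<partial>M)"
  have int: "integrable M L"
    using L \<open>0 < l\<close> by (intro integrable_bounded[where c = h]) (fastforce simp: abs_of_pos intro: order_trans)+
  have "l \<le> D" unfolding D_def using int L by (intro integral_ge_const) auto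
  then have "0 < D" using \<open>0 < l\<close> by linarith
  define t where "t = prob B / D"
  have intB: "integrable M (\<lambda>x. indicator B x * (1 / L x))"
  proof (rule integrable_bounded[where c = "1 / l"])
    fix x assume x: "x \<in> space M"
    have "0 < L x" "1 / L x \<le> 1 / l"
      using L(1)[OF x] \<open>0 < l\<close> by (auto intro: divide_left_mono)
    then show "\<bar>indicator B x * (1 / L x)\<bar> \<le> 1 / l" using \<open>0 < l\<close> by (auto simp: indicator_def)
  qed measurable
  have iB: "integrable M (indicator B :: 'a \<Rightarrow> real)"
    by (rule integrable_bounded[where c = 1]) (auto simp: indicator_def)
  have "(prob B)\<^sup>2 / D = 2 * t * prob B - t\<^sup>2 * D"
    using \<open>0 < D\<close> by (simp add: t_def power2_eq_square field_simps)
  also have "\<dots> = (\<integral>x. 2 * t * indicator B x - t\<^sup>2 * L x \<partial>M)"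
    using int iB by (simp add: D_def)
  also have "\<dots> \<le> (\<integral>x. indicator B x * (1 / L x) \<partial>M)"
  proof (rule integral_mono)
    show "integrable M (\<lambda>x. 2 * t * indicator B x - t\<^sup>2 * L x)" using int iB by auto
    fix x assume x: "x \<in> space M"
    have Lx: "0 < L x" using L(1)[OF x] \<open>0 < l\<close> by linarith
    have "0 \<le> (1 - t * L x)\<^sup>2 / L x" using Lx by simp
    also have "\<dots> = 1 / L x - (2 * t - t\<^sup>2 * L x)"
      using Lx by (simp add: power2_eq_square field_simps)
    finally show "2 * t * indicator B x - t\<^sup>2 * L x \<le> indicator B x * (1 / L x)"
      using Lx by (auto simp: indicator_def)
  qed fact
  finally show ?thesis by (simp add: D_def)
qed

locale density_family = bounded_densities U lo hi + prior: prob_space \<nu>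
  for U :: "'b measure" and lo hi :: real and \<nu> :: "'a measure" +
  fixes f :: "'a \<Rightarrow> 'b \<Rightarrow> real"
  assumes f_meas[measurable]: "case_prod f \<in> borel_measurable (\<nu> \<Otimes>\<^sub>M U)"
    and f_bdens: "\<And>\<theta>. bdens (f \<theta>)"
begin

lemma hell2_meas: "bdens f0 \<Longrightarrow> (\<lambda>\<theta>. hell2 f0 (f \<theta>)) \<in> borel_measurable \<nu>"
proof -
  assume "bdens f0"
  then have [measurable]: "f0 \<in> borel_measurable U" by (rule bdens_meas)
  show ?thesis unfolding hell2_def by measurable
qed

lemma f_pos: "0 < f \<theta> x"
  using bdens_pos[OF f_bdens] .

text \<open>The squared Hellinger distance is \<open>2 - 2 * \<integral> sqrt (f0 * g)\<close>, and the square root is concave.\<close>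

lemma hell2_mixture_le:
  assumes f0: "bdens f0"
  shows "hell2 f0 (\<lambda>x. \<integral>\<theta>. f \<theta> x \<partial>\<nu>) \<le> (\<integral>\<theta>. hell2 f0 (f \<theta>) \<partial>\<nu>)"
proof -
  note [measurable] = bdens_meas[OF f0]
  define m where "m = (\<lambda>x. \<integral>\<theta>. f \<theta> x \<partial>\<nu>)"
  define k where "k = (\<lambda>\<theta> x. (sqrt (f0 x) - sqrt (f \<theta> x))\<^sup>2)"
  have [measurable]: "m \<in> borel_measurable U" unfolding m_def by measurable
  have k_meas[measurable]: "case_prod k \<in> borel_measurable (\<nu> \<Otimes>\<^sub>M U)"
    unfolding k_def by measurable
  have k_bd: "\<bar>k \<theta> x\<bar> \<le> 2 * hi" for \<theta> x
  proof -
    have "0 \<le> sqrt (f0 x) * sqrt (f \<theta> x)"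
      using bdens_pos[OF f0, of x] f_pos[of \<theta> x] by (simp add: less_imp_le)
    then have "k \<theta> x \<le> f0 x + f \<theta> x"
      unfolding k_def sq_sqrt_diff[OF f0 f_bdens] by simp
    then show ?thesis
      using bdens_hi[OF f0, of x] bdens_hi[OF f_bdens, of \<theta> x] by (simp add: k_def)
  qed
  note fub = fubini_bounded[OF prior.prob_space_axioms prob_space_axioms k_meas k_bd]
  have pw: "(sqrt (f0 x) - sqrt (m x))\<^sup>2 \<le> (\<integral>\<theta>. k \<theta> x \<partial>\<nu>)" if x: "x \<in> space U" for x
  proof -
    have [measurable]: "(\<lambda>\<theta>. f \<theta> x) \<in> borel_measurable \<nu>"
      using measurable_Pair1[OF f_meas x] by simp
    have int: "integrable \<nu> (\<lambda>\<theta>. f \<theta> x)"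
      using bdens_hi[OF f_bdens, of _ x] f_pos[of _ x]
      by (intro prior.integrable_bounded[where c = hi]) (auto simp: abs_of_pos)
    have int_sqrt: "integrable \<nu> (\<lambda>\<theta>. sqrt (f \<theta> x))"
      using bdens_hi[OF f_bdens, of _ x] f_pos[of _ x]
      by (intro prior.integrable_bounded[where c = "sqrt hi"]) (auto simp: less_imp_le)
    have sq: "(sqrt (f \<theta> x))\<^sup>2 = f \<theta> x" for \<theta> using f_pos[of \<theta> x] by simp
    have m_pos: "0 \<le> m x" unfolding m_def
      using f_pos by (intro Bochner_Integration.integral_nonneg) (simp add: less_imp_le)
    have "(\<integral>\<theta>. sqrt (f \<theta> x) \<partial>\<nu>)\<^sup>2 \<le> m x"
      using prior.square_integral_le[OF int_sqrt] int by (simp add: sq m_def)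
    then have jensen: "(\<integral>\<theta>. sqrt (f \<theta> x) \<partial>\<nu>) \<le> sqrt (m x)"
      by (rule real_le_rsqrt)
    have "(sqrt (f0 x) - sqrt (m x))\<^sup>2 = f0 x + m x - 2 * sqrt (f0 x) * sqrt (m x)"
      using bdens_pos[OF f0, of x] m_pos by (simp add: power2_diff)
    also have "\<dots> \<le> f0 x + m x - 2 * sqrt (f0 x) * (\<integral>\<theta>. sqrt (f \<theta> x) \<partial>\<nu>)"
      using jensen bdens_pos[OF f0, of x] by (intro diff_left_mono mult_left_mono) auto
    also have "\<dots> = (\<integral>\<theta>. f0 x + f \<theta> x - 2 * sqrt (f0 x) * sqrt (f \<theta> x) \<partial>\<nu>)"
      using int int_sqrt by (simp add: m_def prior.prob_space)
    also have "\<dots> = (\<integral>\<theta>. k \<theta> x \<partial>\<nu>)"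
      unfolding k_def sq_sqrt_diff[OF f0 f_bdens] by (simp add: mult.assoc)
    finally show ?thesis .
  qed
  have "hell2 f0 m \<le> (\<integral>x. \<integral>\<theta>. k \<theta> x \<partial>\<nu> \<partial>U)"
    unfolding hell2_def using fub(3) pw
    by (rule integral_mono') (auto simp: k_def intro!: Bochner_Integration.integral_nonneg)
  also have "\<dots> = (\<integral>\<theta>. hell2 f0 (f \<theta>) \<partial>\<nu>)"
    unfolding fub(1)[symmetric] by (simp add: k_def hell2_def)
  finally show ?thesis by (simp add: m_def)
qed

end

text \<open>Interchanging the two integrals turns a prior average of products over independent observations into
  \<open>n\<close>-th powers of integrals over a single observation. Every moment of the posterior that is needed has this form.\<close>

lemma restricted_product_integral:
  fixes h :: "'a \<Rightarrow> 'b \<Rightarrow> real"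
  assumes \<nu>: "prob_space \<nu>" and U: "prob_space U" and "finite I" and A[measurable]: "A \<in> sets \<nu>"
    and hm[measurable]: "case_prod h \<in> borel_measurable (\<nu> \<Otimes>\<^sub>M U)"
    and h: "\<And>\<theta> x. 0 \<le> h \<theta> x" "\<And>\<theta> x. h \<theta> x \<le> c"
    and le: "\<And>\<theta>. \<theta> \<in> A \<Longrightarrow> (\<integral>x. h \<theta> x \<partial>U) \<le> e"
  defines "F \<equiv> \<lambda>X. \<integral>\<theta>. indicator A \<theta> * (\<Prod>i\<in>I. h \<theta> (X i)) \<partial>\<nu>"
  shows "integrable (PiM I (\<lambda>_. U)) F"
    and "(\<integral>X. F X \<partial>PiM I (\<lambda>_. U)) \<le> measure \<nu> A * e ^ card I"
proof -
  interpret \<nu>: prob_space \<nu> by fact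
  interpret U: prob_space U by fact
  interpret P: product_prob_space "\<lambda>_. U" I ..
  have hi[measurable]: "(\<lambda>p. h (snd p) (fst p i)) \<in> borel_measurable (PiM I (\<lambda>_. U) \<Otimes>\<^sub>M \<nu>)" if "i \<in> I" for i
  proof -
    have "(\<lambda>p. (snd p, fst p i)) \<in> PiM I (\<lambda>_. U) \<Otimes>\<^sub>M \<nu> \<rightarrow>\<^sub>M \<nu> \<Otimes>\<^sub>M U"
      using that by measurable
    from measurable_compose[OF this hm] show ?thesis by simp
  qed
  define k where "k = (\<lambda>X \<theta>. indicator A \<theta> * (\<Prod>i\<in>I. h \<theta> (X i)))"
  have k_meas[measurable]: "case_prod k \<in> borel_measurable (PiM I (\<lambda>_. U) \<Otimes>\<^sub>M \<nu>)"
    unfolding k_def case_prod_beta by measurable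
  have k_bd: "\<bar>k X \<theta>\<bar> \<le> c ^ card I" for X \<theta>
  proof -
    have "(\<Prod>i\<in>I. h \<theta> (X i)) \<le> c ^ card I"
      using prod_mono[of I "\<lambda>i. h \<theta> (X i)" "\<lambda>_. c"] h by simp
    moreover have "0 \<le> (\<Prod>i\<in>I. h \<theta> (X i))" using h by (simp add: prod_nonneg)
    ultimately show ?thesis by (auto simp: k_def indicator_def)
  qed
  note fub = fubini_bounded[OF P.prob_space_axioms \<nu> k_meas k_bd]
  show "integrable (PiM I (\<lambda>_. U)) F" using fub(2) by (simp add: F_def k_def)
  have hint: "integrable U (h \<theta>)" if "\<theta> \<in> space \<nu>" for \<theta>
    using measurable_Pair2[OF hm that] h
    by (intro U.integrable_bounded[where c = c]) auto
  have "(\<integral>X. F X \<partial>PiM I (\<lambda>_. U)) = (\<integral>\<theta>. \<integral>X. k X \<theta> \<partial>PiM I (\<lambda>_. U) \<partial>\<nu>)"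
    using fub(1) by (simp add: F_def k_def)
  also have "\<dots> = (\<integral>\<theta>. indicator A \<theta> * (\<integral>x. h \<theta> x \<partial>U) ^ card I \<partial>\<nu>)"
  proof (intro Bochner_Integration.integral_cong refl)
    fix \<theta> assume \<theta>: "\<theta> \<in> space \<nu>"
    have "(\<integral>X. (\<Prod>i\<in>I. h \<theta> (X i)) \<partial>PiM I (\<lambda>_. U)) = (\<Prod>i\<in>I. \<integral>x. h \<theta> x \<partial>U)"
      using hint[OF \<theta>] \<open>finite I\<close> by (intro P.product_integral_prod) auto
    then show "(\<integral>X. k X \<theta> \<partial>PiM I (\<lambda>_. U)) = indicator A \<theta> * (\<integral>x. h \<theta> x \<partial>U) ^ card I"
      by (simp add: k_def)
  qed
  also have "\<dots> \<le> (\<integral>\<theta>. indicator A \<theta> * e ^ card I \<partial>\<nu>)"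
  proof (rule integral_mono')
    fix \<theta> assume "\<theta> \<in> space \<nu>"
    have "0 \<le> (\<integral>x. h \<theta> x \<partial>U)" using h by (intro Bochner_Integration.integral_nonneg) auto
    then show "indicator A \<theta> * (\<integral>x. h \<theta> x \<partial>U) ^ card I \<le> indicator A \<theta> * e ^ card I"
      "0 \<le> indicator A \<theta> * e ^ card I"
      using le[of \<theta>] by (auto simp: indicator_def intro: power_mono)
  qed (rule \<nu>.integrable_bounded[where c = "\<bar>e ^ card I\<bar>"], auto simp: indicator_def)
  also have "\<dots> = measure \<nu> A * e ^ card I" by simp
  finally show "(\<integral>X. F X \<partial>PiM I (\<lambda>_. U)) \<le> measure \<nu> A * e ^ card I" .
qed

context density_family
begin

definition likelihood :: "'i set \<Rightarrow> ('i \<Rightarrow> 'b) \<Rightarrow> 'a \<Rightarrow> real" where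
  "likelihood I X \<theta> = (\<Prod>i\<in>I. f \<theta> (X i))"

definition post_mean :: "'i set \<Rightarrow> ('i \<Rightarrow> 'b) \<Rightarrow> 'b \<Rightarrow> real" where
  "post_mean I X x = (\<integral>\<theta>. f \<theta> x * likelihood I X \<theta> \<partial>\<nu>) / (\<integral>\<theta>. likelihood I X \<theta> \<partial>\<nu>)"

lemma likelihood_bounds:
  "lo ^ card I \<le> likelihood I X \<theta>" "likelihood I X \<theta> \<le> hi ^ card I" "0 < likelihood I X \<theta>"
proof -
  show "0 < likelihood I X \<theta>" unfolding likelihood_def using f_pos by (simp add: prod_pos)
  show "lo ^ card I \<le> likelihood I X \<theta>"
    unfolding likelihood_def using prod_mono[of I "\<lambda>_. lo" "\<lambda>i. f \<theta> (X i)"] bdens_lo[OF f_bdens] lo_pos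
    by (simp add: less_imp_le)
  show "likelihood I X \<theta> \<le> hi ^ card I"
    unfolding likelihood_def using prod_mono[of I "\<lambda>i. f \<theta> (X i)" "\<lambda>_. hi"] bdens_hi[OF f_bdens] f_pos
    by (simp add: less_imp_le)
qed

lemma likelihood_pair_meas[measurable]:
  "(\<lambda>p. likelihood I (fst p) (snd p)) \<in> borel_measurable (PiM I (\<lambda>_. U) \<Otimes>\<^sub>M \<nu>)"
proof -
  have [measurable]: "(\<lambda>p. f (snd p) (fst p i)) \<in> borel_measurable (PiM I (\<lambda>_. U) \<Otimes>\<^sub>M \<nu>)" if "i \<in> I" for i
  proof -
    have "(\<lambda>p. (snd p, fst p i)) \<in> PiM I (\<lambda>_. U) \<Otimes>\<^sub>M \<nu> \<rightarrow>\<^sub>M \<nu> \<Otimes>\<^sub>M U"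
      using that by measurable
    from measurable_compose[OF this f_meas] show ?thesis by simp
  qed
  show ?thesis unfolding likelihood_def by measurable
qed

lemma likelihood_meas[measurable]:
  assumes "X \<in> space (PiM I (\<lambda>_. U))"
  shows "likelihood I X \<in> borel_measurable \<nu>"
  using measurable_Pair2[OF likelihood_pair_meas assms] by simp

lemma evidence_meas[measurable]:
  "(\<lambda>X. \<integral>\<theta>. likelihood I X \<theta> \<partial>\<nu>) \<in> borel_measurable (PiM I (\<lambda>_. U))"
proof -
  have [measurable]: "(\<lambda>(X, \<theta>). likelihood I X \<theta>) \<in> borel_measurable (PiM I (\<lambda>_. U) \<Otimes>\<^sub>M \<nu>)"
    using likelihood_pair_meas by (simp add: case_prod_beta)
  show ?thesis by measurable
qed

lemma likelihood_integrable:
  assumes "X \<in> space (PiM I (\<lambda>_. U))"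
  shows "integrable \<nu> (likelihood I X)"
  using likelihood_meas[OF assms] likelihood_bounds[of I X]
  by (intro prior.integrable_bounded[where c = "hi ^ card I"]) (auto simp: abs_of_pos)

lemma evidence_pos:
  assumes "X \<in> space (PiM I (\<lambda>_. U))"
  shows "0 < (\<integral>\<theta>. likelihood I X \<theta> \<partial>\<nu>)"
proof -
  have "lo ^ card I \<le> (\<integral>\<theta>. likelihood I X \<theta> \<partial>\<nu>)"
    using likelihood_integrable[OF assms] likelihood_bounds by (intro prior.integral_ge_const) auto
  then show ?thesis using lo_pos by (meson less_le_trans zero_less_power)
qed

lemma post_mean_meas[measurable]:
  "(\<lambda>(X, x). post_mean I X x) \<in> borel_measurable (PiM I (\<lambda>_. U) \<Otimes>\<^sub>M U)"
proof -
  have [measurable]: "(\<lambda>p. f (snd p) (snd (fst p))) \<in> borel_measurable ((PiM I (\<lambda>_. U) \<Otimes>\<^sub>M U) \<Otimes>\<^sub>M \<nu>)"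
  proof -
    have "(\<lambda>p. (snd p, snd (fst p))) \<in> (PiM I (\<lambda>_. U) \<Otimes>\<^sub>M U) \<Otimes>\<^sub>M \<nu> \<rightarrow>\<^sub>M \<nu> \<Otimes>\<^sub>M U" by measurable
    from measurable_compose[OF this f_meas] show ?thesis by simp
  qed
  have [measurable]: "(\<lambda>p. likelihood I (fst (fst p)) (snd p)) \<in> borel_measurable ((PiM I (\<lambda>_. U) \<Otimes>\<^sub>M U) \<Otimes>\<^sub>M \<nu>)"
  proof -
    have "(\<lambda>p. (fst (fst p), snd p)) \<in> (PiM I (\<lambda>_. U) \<Otimes>\<^sub>M U) \<Otimes>\<^sub>M \<nu> \<rightarrow>\<^sub>M PiM I (\<lambda>_. U) \<Otimes>\<^sub>M \<nu>" by measurable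
    from measurable_compose[OF this likelihood_pair_meas] show ?thesis by simp
  qed
  have "(\<lambda>p. post_mean I (fst p) (snd p)) \<in> borel_measurable (PiM I (\<lambda>_. U) \<Otimes>\<^sub>M U)"
    unfolding post_mean_def by measurable
  then show ?thesis by (simp add: case_prod_beta)
qed

text \<open>The posterior has the density \<open>likelihood / evidence\<close> with respect to the prior, so the convexity
  of the loss applies to the family of densities mixed by the posterior.\<close>

lemma hell2_post_mean_le:
  assumes f0: "bdens f0" and X: "X \<in> space (PiM I (\<lambda>_. U))"
  shows "hell2 f0 (post_mean I X) \<le>
    (\<integral>\<theta>. hell2 f0 (f \<theta>) * likelihood I X \<theta> \<partial>\<nu>) / (\<integral>\<theta>. likelihood I X \<theta> \<partial>\<nu>)"
proof -
  note [measurable] = likelihood_meas[OF X] hell2_meas[OF f0]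
  define D where "D = (\<integral>\<theta>. likelihood I X \<theta> \<partial>\<nu>)"
  have D: "0 < D" using evidence_pos[OF X] by (simp add: D_def)
  define \<rho> where "\<rho> = density \<nu> (\<lambda>\<theta>. ennreal (likelihood I X \<theta> / D))"
  have nn: "0 \<le> likelihood I X \<theta> / D" for \<theta>
    using likelihood_bounds(3)[of I X \<theta>] D by simp
  interpret \<rho>: prob_space \<rho>
  proof
    have "emeasure \<rho> (space \<rho>) = (\<integral>\<^sup>+\<theta>. ennreal (likelihood I X \<theta> / D) \<partial>\<nu>)"
      by (simp add: \<rho>_def emeasure_density cong: nn_integral_cong)
    also have "\<dots> = ennreal (\<integral>\<theta>. likelihood I X \<theta> / D \<partial>\<nu>)"
      using likelihood_integrable[OF X] nn by (intro nn_integral_eq_integral) auto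
    also have "\<dots> = 1" using D by (simp add: D_def)
    finally show "emeasure \<rho> (space \<rho>) = 1" .
  qed
  have int_\<rho>: "(\<integral>\<theta>. g \<theta> \<partial>\<rho>) = (\<integral>\<theta>. g \<theta> * likelihood I X \<theta> \<partial>\<nu>) / D" if "g \<in> borel_measurable \<nu>" for g :: "'a \<Rightarrow> real"
    unfolding \<rho>_def using that nn by (subst integral_density) (auto simp: mult.commute)
  have sets_\<rho>: "sets \<rho> = sets \<nu>" by (simp add: \<rho>_def)
  interpret P: density_family U lo hi \<rho> f
    by unfold_locales (auto simp: f_bdens f_meas measurable_cong_sets[OF sets_pair_measure_cong[OF sets_\<rho> refl] refl])
  have "hell2 f0 (post_mean I X) = hell2 f0 (\<lambda>x. \<integral>\<theta>. f \<theta> x \<partial>\<rho>)"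
    unfolding hell2_def
  proof (intro Bochner_Integration.integral_cong refl)
    fix x assume "x \<in> space U"
    then have "(\<lambda>\<theta>. f \<theta> x) \<in> borel_measurable \<nu>"
      using measurable_Pair1[OF f_meas] by simp
    then show "(sqrt (f0 x) - sqrt (post_mean I X x))\<^sup>2 = (sqrt (f0 x) - sqrt (\<integral>\<theta>. f \<theta> x \<partial>\<rho>))\<^sup>2"
      by (simp add: int_\<rho> post_mean_def D_def)
  qed
  also have "\<dots> \<le> (\<integral>\<theta>. hell2 f0 (f \<theta>) \<partial>\<rho>)" by (rule P.hell2_mixture_le[OF f0])
  also have "\<dots> = (\<integral>\<theta>. hell2 f0 (f \<theta>) * likelihood I X \<theta> \<partial>\<nu>) / D"
    using hell2_meas[OF f0] by (rule int_\<rho>)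
  finally show ?thesis by (simp add: D_def)
qed

end

context density_family
begin

text \<open>The two errors of the test between the truth and a cell \<open>A\<close> with representative \<open>g\<close>: with \<open>u\<close> the square
  root of the likelihood ratio of \<open>f0\<close> to \<open>g\<close>, the mass of the cell tilted by \<open>u\<close>, and the inverse of \<open>u\<close>
  under the truth.\<close>

lemma likelihood_ratio_test_bounds:
  fixes \<delta> r :: real
  assumes f0: "bdens f0" and g: "bdens g" and "finite I"
    and A: "A \<in> sets \<nu>" "\<And>\<theta>. \<theta> \<in> A \<Longrightarrow> dist2 (f \<theta>) g \<le> \<delta>"
    and far: "r < hell2 f0 g" "8 * \<delta> / lo \<le> r"
  defines "u \<equiv> \<lambda>X. \<Prod>i\<in>I. sqrt (f0 (X i)) / sqrt (g (X i))"
    and "F \<equiv> \<lambda>X. \<integral>\<theta>. indicator A \<theta> * likelihood I X \<theta> \<partial>\<nu>"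
  shows "integrable (PiM I (\<lambda>_. U)) (\<lambda>X. F X * u X)"
    and "(\<integral>X. F X * u X \<partial>PiM I (\<lambda>_. U)) \<le> exp (- (card I * r / 8))"
    and "integrable (PiM I (\<lambda>_. U)) (\<lambda>X. (\<Prod>i\<in>I. f0 (X i)) / u X)"
    and "(\<integral>X. (\<Prod>i\<in>I. f0 (X i)) / u X \<partial>PiM I (\<lambda>_. U)) \<le> exp (- (card I * r / 8))"
proof -
  note [measurable] = bdens_meas[OF f0] bdens_meas[OF g]
  note pos = bdens_pos[OF f0] bdens_pos[OF g]
  define e where "e = exp (- (r / 8))"
  have e: "e ^ card I = exp (- (card I * r / 8))"
    by (simp add: e_def exp_of_nat_mult[symmetric])
  define h where "h = (\<lambda>\<theta> x. f \<theta> x * (sqrt (f0 x) / sqrt (g x)))"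
  have hm: "case_prod h \<in> borel_measurable (\<nu> \<Otimes>\<^sub>M U)" unfolding h_def by measurable
  have h0: "0 \<le> h \<theta> x" for \<theta> x using f_pos[of \<theta> x] pos[of x] by (simp add: h_def less_imp_le)
  have hc: "h \<theta> x \<le> hi * (sqrt hi / sqrt lo)" for \<theta> x
    unfolding h_def using bdens_hi[OF f_bdens] bdens_hi[OF f0] bdens_lo[OF g] lo_pos f_pos[of \<theta> x] pos[of x] hi_pos[OF f0]
    by (intro mult_mono frac_le) (auto simp: less_imp_le)
  have hle: "(\<integral>x. h \<theta> x \<partial>U) \<le> e" if "\<theta> \<in> A" for \<theta>
  proof -
    have "(\<integral>x. h \<theta> x \<partial>U) \<le> 1 - hell2 f0 g / 4 + dist2 (f \<theta>) g / lo"
      unfolding h_def using tilted_mean_le[OF f_bdens f0 g] .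
    also have "dist2 (f \<theta>) g / lo \<le> \<delta> / lo"
      using A(2)[OF that] lo_pos by (simp add: divide_right_mono)
    also have "1 - hell2 f0 g / 4 + \<delta> / lo \<le> 1 + (- (r / 8))" using far by simp
    also have "\<dots> \<le> e" unfolding e_def by (rule exp_ge_add_one_self)
    finally show ?thesis by simp
  qed
  have F_eq: "F X * u X = (\<integral>\<theta>. indicator A \<theta> * (\<Prod>i\<in>I. h \<theta> (X i)) \<partial>\<nu>)" for X
  proof -
    have "F X * u X = (\<integral>\<theta>. indicator A \<theta> * likelihood I X \<theta> * u X \<partial>\<nu>)" by (simp add: F_def)
    then show ?thesis by (simp only: u_def h_def likelihood_def prod.distrib mult.assoc)
  qed
  note rp = restricted_product_integral[OF prior.prob_space_axioms prob_space_axioms \<open>finite I\<close> A(1) hm h0 hc hle]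
  show "integrable (PiM I (\<lambda>_. U)) (\<lambda>X. F X * u X)"
    unfolding F_eq by (rule rp)
  have "(\<integral>X. F X * u X \<partial>PiM I (\<lambda>_. U)) \<le> prior.prob A * e ^ card I"
    unfolding F_eq by (rule rp)
  also have "\<dots> \<le> 1 * e ^ card I" by (intro mult_right_mono) (auto simp: e_def)
  finally show "(\<integral>X. F X * u X \<partial>PiM I (\<lambda>_. U)) \<le> exp (- (card I * r / 8))" by (simp add: e)

  interpret P: product_prob_space "\<lambda>_. U" I ..
  have eq: "(\<Prod>i\<in>I. f0 (X i)) / u X = (\<Prod>i\<in>I. sqrt (f0 (X i)) * sqrt (g (X i)))" for X
  proof -
    have "f0 x / (sqrt (f0 x) / sqrt (g x)) = sqrt (f0 x) * sqrt (g x)" for x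
      using pos[of x] real_div_sqrt[of "f0 x"] by (simp add: field_simps)
    then show ?thesis by (simp add: u_def prod_dividef[symmetric])
  qed
  show "integrable (PiM I (\<lambda>_. U)) (\<lambda>X. (\<Prod>i\<in>I. f0 (X i)) / u X)"
    unfolding eq using integrable_sqrt_prod[OF f0 g] \<open>finite I\<close> by (intro P.product_integrable_prod) auto
  have "(\<integral>X. (\<Prod>i\<in>I. f0 (X i)) / u X \<partial>PiM I (\<lambda>_. U)) = (\<Prod>i\<in>I. 1 - hell2 f0 g / 2)"
    unfolding eq using integrable_sqrt_prod[OF f0 g] \<open>finite I\<close>
    by (subst P.product_integral_prod) (auto simp: affinity_eq[OF f0 g])
  also have "\<dots> \<le> e ^ card I"
  proof -
    have "1 - hell2 f0 g / 2 \<le> 1 + (- (r / 8))" using far hell2_nonneg[of f0 g] by linarith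
    also have "\<dots> \<le> e" unfolding e_def by (rule exp_ge_add_one_self)
    finally have "1 - hell2 f0 g / 2 \<le> e" .
    moreover have "0 \<le> 1 - hell2 f0 g / 2" using hell2_le_2[OF f0 g] by simp
    ultimately show ?thesis by (simp add: power_mono)
  qed
  finally show "(\<integral>X. (\<Prod>i\<in>I. f0 (X i)) / u X \<partial>PiM I (\<lambda>_. U)) \<le> exp (- (card I * r / 8))"
    by (simp add: e)
qed

text \<open>The inverse of the normalised evidence has a mean that is only exponential in \<open>card I * \<delta>\<close>,
  because the chi-square divergence of densities bounded away from zero is of the order of the squared \<open>L\<^sup>2\<close> distance.\<close>

lemma inverse_evidence_bound:
  fixes \<delta> :: real
  assumes f0: "bdens f0" and "finite I" and B[measurable]: "B \<in> sets \<nu>" and b: "0 < prior.prob B"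
    and near: "\<And>\<theta>. \<theta> \<in> B \<Longrightarrow> dist2 f0 (f \<theta>) \<le> \<delta>"
  defines "F \<equiv> \<lambda>X. (\<Prod>i\<in>I. f0 (X i))\<^sup>2 / (\<integral>\<theta>. likelihood I X \<theta> \<partial>\<nu>)"
  shows "integrable (PiM I (\<lambda>_. U)) F"
    and "(\<integral>X. F X \<partial>PiM I (\<lambda>_. U)) \<le> exp (card I * \<delta> / lo) / prior.prob B"
proof -
  note [measurable] = bdens_meas[OF f0]
  note pos = bdens_pos[OF f0]
  interpret P: product_prob_space "\<lambda>_. U" I ..
  define h where "h = (\<lambda>\<theta> x. (f0 x)\<^sup>2 / f \<theta> x)"
  have hm: "case_prod h \<in> borel_measurable (\<nu> \<Otimes>\<^sub>M U)" unfolding h_def by measurable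
  have h0: "0 \<le> h \<theta> x" for \<theta> x using f_pos[of \<theta> x] by (simp add: h_def less_imp_le)
  have hc: "h \<theta> x \<le> hi\<^sup>2 / lo" for \<theta> x
    unfolding h_def using bdens_lo[OF f_bdens] bdens_hi[OF f0] lo_pos pos
    by (intro frac_le power_mono) (auto simp: less_imp_le)
  have hle: "(\<integral>x. h \<theta> x \<partial>U) \<le> exp (\<delta> / lo)" if "\<theta> \<in> B" for \<theta>
  proof -
    have "(\<integral>x. h \<theta> x \<partial>U) \<le> 1 + dist2 f0 (f \<theta>) / lo"
      unfolding h_def by (rule chi_square_le[OF f0 f_bdens])
    also have "\<dots> \<le> 1 + \<delta> / lo" using near[OF that] lo_pos by (simp add: divide_right_mono)
    also have "\<dots> \<le> exp (\<delta> / lo)" by (rule exp_ge_add_one_self)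
    finally show ?thesis .
  qed
  note rp = restricted_product_integral[OF prior.prob_space_axioms prob_space_axioms \<open>finite I\<close> B hm h0 hc hle]
  have pw: "F X \<le> (\<integral>\<theta>. indicator B \<theta> * (\<Prod>i\<in>I. h \<theta> (X i)) \<partial>\<nu>) / (prior.prob B)\<^sup>2"
    if X: "X \<in> space (PiM I (\<lambda>_. U))" for X
  proof -
    define l0 where "l0 = (\<Prod>i\<in>I. f0 (X i))"
    have "(prior.prob B)\<^sup>2 / (\<integral>\<theta>. likelihood I X \<theta> \<partial>\<nu>) \<le> (\<integral>\<theta>. indicator B \<theta> * (1 / likelihood I X \<theta>) \<partial>\<nu>)"
      using likelihood_meas[OF X] B likelihood_bounds lo_pos
      by (intro prior.square_prob_div_integral_le[where l = "lo ^ card I" and h = "hi ^ card I"]) auto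
    then have "l0\<^sup>2 * ((prior.prob B)\<^sup>2 / (\<integral>\<theta>. likelihood I X \<theta> \<partial>\<nu>)) \<le>
        l0\<^sup>2 * (\<integral>\<theta>. indicator B \<theta> * (1 / likelihood I X \<theta>) \<partial>\<nu>)"
      by (intro mult_left_mono) auto
    also have "\<dots> = (\<integral>\<theta>. indicator B \<theta> * (\<Prod>i\<in>I. h \<theta> (X i)) \<partial>\<nu>)"
      by (simp add: h_def l0_def likelihood_def prod_dividef prod_power_distrib mult.commute
            flip: Bochner_Integration.integral_mult_right_zero)
    finally show ?thesis using b by (simp add: F_def l0_def field_simps)
  qed
  have F0: "0 \<le> F X" if "X \<in> space (PiM I (\<lambda>_. U))" for X
    using evidence_pos[OF that] by (simp add: F_def)
  have maj: "integrable (PiM I (\<lambda>_. U)) (\<lambda>X. (\<integral>\<theta>. indicator B \<theta> * (\<Prod>i\<in>I. h \<theta> (X i)) \<partial>\<nu>) / (prior.prob B)\<^sup>2)"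
    using rp(1) by simp
  have Fm: "F \<in> borel_measurable (PiM I (\<lambda>_. U))" unfolding F_def by measurable
  show "integrable (PiM I (\<lambda>_. U)) F"
  proof (rule Bochner_Integration.integrable_bound[OF maj Fm], rule AE_I2)
    fix X assume X: "X \<in> space (PiM I (\<lambda>_. U))"
    show "norm (F X) \<le> norm ((\<integral>\<theta>. indicator B \<theta> * (\<Prod>i\<in>I. h \<theta> (X i)) \<partial>\<nu>) / (prior.prob B)\<^sup>2)"
      using pw[OF X] F0[OF X] unfolding real_norm_def by linarith
  qed
  have "(\<integral>X. F X \<partial>PiM I (\<lambda>_. U)) \<le> 
      (\<integral>X. (\<integral>\<theta>. indicator B \<theta> * (\<Prod>i\<in>I. h \<theta> (X i)) \<partial>\<nu>) / (prior.prob B)\<^sup>2 \<partial>PiM I (\<lambda>_. U))"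
    using maj pw by (rule integral_mono') (use pw F0 in \<open>auto intro: order_trans\<close>)
  also have "\<dots> = (\<integral>X. (\<integral>\<theta>. indicator B \<theta> * (\<Prod>i\<in>I. h \<theta> (X i)) \<partial>\<nu>) \<partial>PiM I (\<lambda>_. U)) / (prior.prob B)\<^sup>2"
    by simp
  also have "\<dots> \<le> prior.prob B * exp (\<delta> / lo) ^ card I / (prior.prob B)\<^sup>2"
    using rp(2) by (intro divide_right_mono) auto
  also have "\<dots> = exp (card I * \<delta> / lo) / prior.prob B"
    using b by (simp add: power2_eq_square exp_of_nat_mult[symmetric])
  finally show "(\<integral>X. F X \<partial>PiM I (\<lambda>_. U)) \<le> exp (card I * \<delta> / lo) / prior.prob B" .
qed

text \<open>The function \<open>c\<close> labels at most \<open>K\<close> cells of squared \<open>L\<^sup>2\<close> diameter \<open>\<delta>\<close>, and \<open>r\<close> is the squared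
  Hellinger distance beyond which a cell is tested away. The threshold \<open>\<mu>\<close> for the evidence is free: lowering it makes
  small evidence rarer but weakens the tests. It is to be chosen so that both terms in the parentheses
  are negligible against \<open>r / K\<close>.\<close>

theorem post_mean_risk:
  fixes c :: "'a \<Rightarrow> 'c" and \<delta> r \<mu> K :: real
  assumes f0: "bdens f0" and "finite I"
    and fin: "finite (c ` space \<nu>)" and card: "real (card (c ` space \<nu>)) \<le> K"
    and c_meas: "\<And>k. {\<theta> \<in> space \<nu>. c \<theta> = k} \<in> sets \<nu>"
    and cell: "\<And>\<theta> \<theta>'. \<theta> \<in> space \<nu> \<Longrightarrow> \<theta>' \<in> space \<nu> \<Longrightarrow> c \<theta> = c \<theta>' \<Longrightarrow> dist2 (f \<theta>) (f \<theta>') \<le> \<delta>"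
    and B: "B \<in> sets \<nu>" "0 < prior.prob B" "\<And>\<theta>. \<theta> \<in> B \<Longrightarrow> dist2 f0 (f \<theta>) \<le> \<delta>"
    and r: "8 * \<delta> / lo \<le> r" and "0 < \<mu>"
  shows "(\<integral>X. (\<Prod>i\<in>I. f0 (X i)) * hell2 f0 (post_mean I X) \<partial>PiM I (\<lambda>_. U))
    \<le> 3 * r + 2 * K * (exp (- (card I * r / 8)) / sqrt \<mu> + \<mu> * (exp (card I * \<delta> / lo) / prior.prob B))"
proof -
  note [measurable] = bdens_meas[OF f0]
  let ?W = "PiM I (\<lambda>_. U)"
  interpret P: product_prob_space "\<lambda>_. U" I ..
  define rep where "rep k = (SOME \<theta>. \<theta> \<in> space \<nu> \<and> c \<theta> = k)" for k
  define cl where "cl k = {\<theta> \<in> space \<nu>. c \<theta> = k}" for k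
  define far where "far = {k \<in> c ` space \<nu>. r < hell2 f0 (f (rep k))}"
  have rep: "rep k \<in> space \<nu>" "c (rep k) = k" if "k \<in> c ` space \<nu>" for k
  proof -
    have "\<exists>\<theta>. \<theta> \<in> space \<nu> \<and> c \<theta> = k" using that by auto
    from someI_ex[OF this] show "rep k \<in> space \<nu>" "c (rep k) = k" by (auto simp: rep_def)
  qed
  have finfar: "finite far" using fin by (auto simp: far_def)
  have cardfar: "real (card far) \<le> K"
    using card_mono[OF fin, of far] card by (auto simp: far_def)
  have cl_meas[measurable]: "cl k \<in> sets \<nu>" for k using c_meas by (simp add: cl_def)
  have cl_near: "dist2 (f \<theta>) (f (rep k)) \<le> \<delta>" if "k \<in> c ` space \<nu>" "\<theta> \<in> cl k" for k \<theta>
    using cell rep[OF that(1)] that(2) by (auto simp: cl_def)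
  have \<delta>0: "0 \<le> \<delta>"
  proof -
    obtain \<theta> where "\<theta> \<in> space \<nu>" using prior.not_empty by auto
    then show ?thesis using cell[of \<theta> \<theta>] dist2_nonneg order_trans by blast
  qed
  have r0: "0 \<le> r" "\<delta> / lo \<le> r"
  proof -
    have "0 \<le> \<delta> / lo" using \<delta>0 lo_pos by simp
    then show "0 \<le> r" "\<delta> / lo \<le> r" using r by linarith+
  qed

  define N where "N k X = (\<integral>\<theta>. indicator (cl k) \<theta> * likelihood I X \<theta> \<partial>\<nu>)" for k X
  define D where "D X = (\<integral>\<theta>. likelihood I X \<theta> \<partial>\<nu>)" for X
  define l0 where "l0 X = (\<Prod>i\<in>I. f0 (X i))" for X
  define u where "u k X = (\<Prod>i\<in>I. sqrt (f0 (X i)) / sqrt (f (rep k) (X i)))" for k X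

  \<comment> \<open>In a near cell the representative is close to the truth, so the distance is at most \<open>3 * r\<close>;
    in a far cell it is bounded by 2, like every squared Hellinger distance.\<close>
  have split: "hell2 f0 (f \<theta>) \<le> 3 * r + 2 * (\<Sum>k\<in>far. indicator (cl k) \<theta>)" if \<theta>: "\<theta> \<in> space \<nu>" for \<theta>
  proof (cases "c \<theta> \<in> far")
    case True
    have "(1::real) = indicator (cl (c \<theta>)) \<theta>" using \<theta> by (simp add: cl_def)
    also have "\<dots> \<le> (\<Sum>k\<in>far. indicator (cl k) \<theta>)"
      using True finfar by (intro member_le_sum) auto
    finally show ?thesis using hell2_le_2[OF f0 f_bdens, of \<theta>] r0 by linarith
  next
    case False
    have k: "c \<theta> \<in> c ` space \<nu>" using \<theta> by auto
    have tri: "hell2 f0 (f \<theta>) \<le> 2 * hell2 f0 (f (rep (c \<theta>))) + 2 * hell2 (f (rep (c \<theta>))) (f \<theta>)"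
      by (rule hell2_triangle[OF f0 f_bdens f_bdens])
    have near: "hell2 f0 (f (rep (c \<theta>))) \<le> r" using False k by (auto simp: far_def)
    have "hell2 (f (rep (c \<theta>))) (f \<theta>) \<le> dist2 (f \<theta>) (f (rep (c \<theta>))) / (4 * lo)"
      unfolding hell2_commute[of "f (rep (c \<theta>))"] by (rule hell2_le_dist2[OF f_bdens f_bdens])
    also have "\<dots> \<le> \<delta> / (4 * lo)"
      using cl_near[OF k, of \<theta>] \<theta> lo_pos by (intro divide_right_mono) (auto simp: cl_def)
    also have "\<delta> / (4 * lo) = (\<delta> / lo) / 4" by simp
    also have "\<dots> \<le> r / 4" using r0 by (intro divide_right_mono) auto
    finally have "hell2 f0 (f \<theta>) \<le> 3 * r" using tri near r0(1) by linarith
    moreover have "(0::real) \<le> (\<Sum>k\<in>far. indicator (cl k) \<theta>)" by (intro sum_nonneg) auto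
    ultimately show ?thesis by linarith
  qed

  have pw: "l0 X * hell2 f0 (post_mean I X) \<le> 3 * r * l0 X +
      2 * (\<Sum>k\<in>far. (N k X * u k X + l0 X / u k X) / (2 * sqrt \<mu>) + \<mu> * ((l0 X)\<^sup>2 / D X))"
    if X: "X \<in> space ?W" for X
  proof -
    note [measurable] = likelihood_meas[OF X] hell2_meas[OF f0]
    have D: "0 < D X" using evidence_pos[OF X] by (simp add: D_def)
    have l0: "0 < l0 X" unfolding l0_def using bdens_pos[OF f0] by (simp add: prod_pos)
    have intL: "integrable \<nu> (likelihood I X)" by (rule likelihood_integrable[OF X])
    have intN: "integrable \<nu> (\<lambda>\<theta>. indicator (cl k) \<theta> * likelihood I X \<theta>)" for k
      by (rule Bochner_Integration.integrable_bound[OF intL]) (auto simp: indicator_def)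
    have NX: "0 \<le> N k X" "N k X \<le> D X" for k
      unfolding N_def D_def using intN intL likelihood_bounds(3)[of I X]
      by (auto intro!: Bochner_Integration.integral_nonneg integral_mono simp: indicator_def less_imp_le)
    have "(\<integral>\<theta>. hell2 f0 (f \<theta>) * likelihood I X \<theta> \<partial>\<nu>) \<le>
        (\<integral>\<theta>. 3 * r * likelihood I X \<theta> + 2 * (\<Sum>k\<in>far. indicator (cl k) \<theta> * likelihood I X \<theta>) \<partial>\<nu>)"
    proof (rule integral_mono')
      show "integrable \<nu> (\<lambda>\<theta>. 3 * r * likelihood I X \<theta> + 2 * (\<Sum>k\<in>far. indicator (cl k) \<theta> * likelihood I X \<theta>))"
        using intL intN by auto
      fix \<theta> assume \<theta>: "\<theta> \<in> space \<nu>"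
      have "hell2 f0 (f \<theta>) * likelihood I X \<theta> \<le> (3 * r + 2 * (\<Sum>k\<in>far. indicator (cl k) \<theta>)) * likelihood I X \<theta>"
        using split[OF \<theta>] likelihood_bounds(3)[of I X \<theta>] by (intro mult_right_mono) auto
      then show *: "hell2 f0 (f \<theta>) * likelihood I X \<theta> \<le> 3 * r * likelihood I X \<theta> + 2 * (\<Sum>k\<in>far. indicator (cl k) \<theta> * likelihood I X \<theta>)"
        by (simp add: algebra_simps sum_distrib_left)
      have "0 \<le> hell2 f0 (f \<theta>) * likelihood I X \<theta>"
        using hell2_nonneg likelihood_bounds(3)[of I X \<theta>] by (simp add: less_imp_le)
      then show "0 \<le> 3 * r * likelihood I X \<theta> + 2 * (\<Sum>k\<in>far. indicator (cl k) \<theta> * likelihood I X \<theta>)"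
        using * by linarith
    qed
    also have "\<dots> = 3 * r * D X + 2 * (\<Sum>k\<in>far. N k X)"
      using intL intN by (simp add: D_def N_def)
    finally have le: "(\<integral>\<theta>. hell2 f0 (f \<theta>) * likelihood I X \<theta> \<partial>\<nu>) \<le> 3 * r * D X + 2 * (\<Sum>k\<in>far. N k X)" .
    have "hell2 f0 (post_mean I X) \<le> (3 * r * D X + 2 * (\<Sum>k\<in>far. N k X)) / D X"
      using hell2_post_mean_le[OF f0 X] divide_right_mono[OF le, of "D X"] D by (simp add: D_def)
    also have "\<dots> = 3 * r + 2 * (\<Sum>k\<in>far. N k X / D X)"
      unfolding sum_divide_distrib[symmetric] using D by (simp add: add_divide_distrib)
    finally have "l0 X * hell2 f0 (post_mean I X) \<le> l0 X * (3 * r + 2 * (\<Sum>k\<in>far. N k X / D X))"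
      using l0 by (intro mult_left_mono) auto
    also have "\<dots> = 3 * r * l0 X + 2 * (\<Sum>k\<in>far. l0 X * (N k X / D X))"
      by (simp add: algebra_simps sum_distrib_left)
    also have "(\<Sum>k\<in>far. l0 X * (N k X / D X)) \<le>
        (\<Sum>k\<in>far. (N k X * u k X + l0 X / u k X) / (2 * sqrt \<mu>) + \<mu> * ((l0 X)\<^sup>2 / D X))"
    proof (rule sum_mono)
      fix k
      have u: "0 < u k X"
        unfolding u_def using bdens_pos[OF f0] f_pos by (intro prod_pos) simp
      have "N k X / D X = (N k X / l0 X) / (D X / l0 X)" using l0 by simp
      also have "\<dots> \<le> (N k X / l0 X * u k X + 1 / u k X) / (2 * sqrt \<mu>) + \<mu> / (D X / l0 X)"
        using NX[of k] D l0 u \<open>0 < \<mu>\<close> by (intro posterior_mass_bound) (auto simp: divide_right_mono)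
      finally have "l0 X * (N k X / D X) \<le>
          l0 X * ((N k X / l0 X * u k X + 1 / u k X) / (2 * sqrt \<mu>) + \<mu> / (D X / l0 X))"
        using l0 by (intro mult_left_mono) auto
      also have "\<dots> = (l0 X * (N k X / l0 X * u k X + 1 / u k X)) / (2 * sqrt \<mu>) + l0 X * (\<mu> / (D X / l0 X))"
        by (simp add: distrib_left)
      also have "l0 X * (N k X / l0 X * u k X + 1 / u k X) = N k X * u k X + l0 X / u k X"
        using l0 by (simp add: distrib_left)
      also have "l0 X * (\<mu> / (D X / l0 X)) = \<mu> * ((l0 X)\<^sup>2 / D X)"
        by (simp add: power2_eq_square)
      finally show "l0 X * (N k X / D X) \<le> (N k X * u k X + l0 X / u k X) / (2 * sqrt \<mu>) + \<mu> * ((l0 X)\<^sup>2 / D X)" .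
    qed
    finally show ?thesis by simp
  qed

  have test: "integrable ?W (\<lambda>X. N k X * u k X)" "(\<integral>X. N k X * u k X \<partial>?W) \<le> exp (- (card I * r / 8))"
      "integrable ?W (\<lambda>X. l0 X / u k X)" "(\<integral>X. l0 X / u k X \<partial>?W) \<le> exp (- (card I * r / 8))"
    if "k \<in> far" for k
  proof -
    have k: "k \<in> c ` space \<nu>" "r < hell2 f0 (f (rep k))" using that by (auto simp: far_def)
    note * = likelihood_ratio_test_bounds[OF f0 f_bdens \<open>finite I\<close> cl_meas cl_near[OF k(1)] k(2) r]
    show "integrable ?W (\<lambda>X. N k X * u k X)" "(\<integral>X. N k X * u k X \<partial>?W) \<le> exp (- (card I * r / 8))"
      "integrable ?W (\<lambda>X. l0 X / u k X)" "(\<integral>X. l0 X / u k X \<partial>?W) \<le> exp (- (card I * r / 8))"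
      unfolding N_def l0_def u_def using * by auto
  qed
  have inv: "integrable ?W (\<lambda>X. (l0 X)\<^sup>2 / D X)"
      "(\<integral>X. (l0 X)\<^sup>2 / D X \<partial>?W) \<le> exp (card I * \<delta> / lo) / prior.prob B"
    unfolding l0_def D_def using inverse_evidence_bound[OF f0 \<open>finite I\<close> B] by auto
  have l0_int: "integrable ?W l0" "(\<integral>X. l0 X \<partial>?W) = 1"
    unfolding l0_def using bdens_integrable[OF f0] bdens_int[OF f0] \<open>finite I\<close>
      P.product_integral_prod[OF \<open>finite I\<close>, of "\<lambda>_. f0"]
    by (auto intro: P.product_integrable_prod)

  have int_far: "integrable ?W (\<lambda>X. (N k X * u k X + l0 X / u k X) / (2 * sqrt \<mu>) + \<mu> * ((l0 X)\<^sup>2 / D X))"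
    if "k \<in> far" for k
    by (intro Bochner_Integration.integrable_add integrable_divide integrable_mult_right impI test that inv)
  have int_sum: "integrable ?W (\<lambda>X. \<Sum>k\<in>far. (N k X * u k X + l0 X / u k X) / (2 * sqrt \<mu>) + \<mu> * ((l0 X)\<^sup>2 / D X))"
    by (intro Bochner_Integration.integrable_sum int_far)
  have far_eq: "(\<integral>X. (N k X * u k X + l0 X / u k X) / (2 * sqrt \<mu>) + \<mu> * ((l0 X)\<^sup>2 / D X) \<partial>?W)
      = ((\<integral>X. N k X * u k X \<partial>?W) + (\<integral>X. l0 X / u k X \<partial>?W)) / (2 * sqrt \<mu>) + \<mu> * (\<integral>X. (l0 X)\<^sup>2 / D X \<partial>?W)"
    if "k \<in> far" for k
    using test[OF that] inv
    by (subst Bochner_Integration.integral_add)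
      (auto simp only: Bochner_Integration.integral_add integral_divide_zero
         Bochner_Integration.integral_mult_right_zero intro!: Bochner_Integration.integrable_add integrable_divide integrable_mult_right)

  have "(\<integral>X. l0 X * hell2 f0 (post_mean I X) \<partial>?W) \<le> (\<integral>X. 3 * r * l0 X +
      2 * (\<Sum>k\<in>far. (N k X * u k X + l0 X / u k X) / (2 * sqrt \<mu>) + \<mu> * ((l0 X)\<^sup>2 / D X)) \<partial>?W)"
  proof (rule integral_mono')
    show "integrable ?W (\<lambda>X. 3 * r * l0 X +
      2 * (\<Sum>k\<in>far. (N k X * u k X + l0 X / u k X) / (2 * sqrt \<mu>) + \<mu> * ((l0 X)\<^sup>2 / D X)))"
      by (intro Bochner_Integration.integrable_add integrable_mult_right impI int_sum l0_int)
    fix X assume X: "X \<in> space ?W"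
    show *: "l0 X * hell2 f0 (post_mean I X) \<le> 3 * r * l0 X +
      2 * (\<Sum>k\<in>far. (N k X * u k X + l0 X / u k X) / (2 * sqrt \<mu>) + \<mu> * ((l0 X)\<^sup>2 / D X))" by (rule pw[OF X])
    have "0 \<le> l0 X" unfolding l0_def using bdens_pos[OF f0] by (intro prod_nonneg) (simp add: less_imp_le)
    then have "0 \<le> l0 X * hell2 f0 (post_mean I X)" using hell2_nonneg by simp
    then show "0 \<le> 3 * r * l0 X +
      2 * (\<Sum>k\<in>far. (N k X * u k X + l0 X / u k X) / (2 * sqrt \<mu>) + \<mu> * ((l0 X)\<^sup>2 / D X))" using * by linarith
  qed
  also have "\<dots> = 3 * r + 2 * (\<Sum>k\<in>far. ((\<integral>X. N k X * u k X \<partial>?W) + (\<integral>X. l0 X / u k X \<partial>?W)) / (2 * sqrt \<mu>)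
      + \<mu> * (\<integral>X. (l0 X)\<^sup>2 / D X \<partial>?W))"
    using int_sum l0_int
    by (simp only: Bochner_Integration.integral_add integrable_mult_right
          Bochner_Integration.integral_mult_right_zero Bochner_Integration.integral_sum int_far far_eq mult_1_right cong: sum.cong)
  also have "\<dots> \<le> 3 * r + 2 * (\<Sum>k\<in>far. exp (- (card I * r / 8)) / sqrt \<mu> + \<mu> * (exp (card I * \<delta> / lo) / prior.prob B))"
  proof (intro add_left_mono mult_left_mono sum_mono add_mono)
    fix k assume k: "k \<in> far"
    have "((\<integral>X. N k X * u k X \<partial>?W) + (\<integral>X. l0 X / u k X \<partial>?W)) / (2 * sqrt \<mu>) \<le>
        (2 * exp (- (card I * r / 8))) / (2 * sqrt \<mu>)"
      using test(2,4)[OF k] \<open>0 < \<mu>\<close> by (intro divide_right_mono) auto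
    then show "((\<integral>X. N k X * u k X \<partial>?W) + (\<integral>X. l0 X / u k X \<partial>?W)) / (2 * sqrt \<mu>) \<le> exp (- (card I * r / 8)) / sqrt \<mu>"
      by simp
  qed (use inv \<open>0 < \<mu>\<close> in auto)
  also have "\<dots> \<le> 3 * r + 2 * (K * (exp (- (card I * r / 8)) / sqrt \<mu> + \<mu> * (exp (card I * \<delta> / lo) / prior.prob B)))"
    using cardfar \<open>0 < \<mu>\<close> by (simp add: mult_right_mono)
  finally show ?thesis by (simp add: l0_def mult.assoc)
qed

end

section \<open>A lower bound over a hypercube of densities\<close>

lemma abs_mult_le: "\<bar>x\<bar> \<le> a \<Longrightarrow> \<bar>y\<bar> \<le> b \<Longrightarrow> \<bar>x * y\<bar> \<le> a * (b::real)"
  by (simp add: abs_mult mult_mono')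

text \<open>The coefficients of \<open>h\<close> with respect to an orthonormal system are at least as close to \<open>t\<close> as \<open>h\<close> is to the combination with
  coefficients \<open>t\<close>, since projecting onto the span of the system does not increase distances.\<close>

lemma (in prob_space) bessel_distance:
  fixes h :: "'a \<Rightarrow> real" and \<phi> :: "'j \<Rightarrow> 'a \<Rightarrow> real"
  assumes "finite J" and h[measurable]: "h \<in> borel_measurable M" and hb: "\<And>x. x \<in> space M \<Longrightarrow> \<bar>h x\<bar> \<le> c"
    and \<phi>[measurable]: "\<And>j. \<phi> j \<in> borel_measurable M" and \<phi>b: "\<And>j x. \<bar>\<phi> j x\<bar> \<le> d"
    and on: "\<And>i j. i \<in> J \<Longrightarrow> j \<in> J \<Longrightarrow> (\<integral>x. \<phi> i x * \<phi> j x \<partial>M) = (if i = j then 1 else 0)"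
  shows "(\<Sum>j\<in>J. ((\<integral>x. h x * \<phi> j x \<partial>M) - t j)\<^sup>2) \<le> (\<integral>x. (h x - (\<Sum>j\<in>J. t j * \<phi> j x))\<^sup>2 \<partial>M)"
proof -
  have i1: "integrable M (\<lambda>x. (h x)\<^sup>2)"
    using hb by (intro integrable_bounded[where c = "c\<^sup>2"])
      (auto simp: abs_le_square_iff[symmetric] intro: order_trans[OF _ abs_ge_self])
  have i2: "integrable M (\<lambda>x. h x * \<phi> j x)" for j
    using hb \<phi>b by (intro integrable_bounded[where c = "c * d"] abs_mult_le) auto
  have i3: "integrable M (\<lambda>x. \<phi> i x * \<phi> j x)" for i j
    using \<phi>b by (intro integrable_bounded[where c = "d * d"] abs_mult_le) auto
  define b where "b j = (\<integral>x. h x * \<phi> j x \<partial>M)" for j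
  have expand: "(\<integral>x. (h x - (\<Sum>j\<in>J. s j * \<phi> j x))\<^sup>2 \<partial>M)
      = (\<integral>x. (h x)\<^sup>2 \<partial>M) - 2 * (\<Sum>j\<in>J. s j * b j) + (\<Sum>j\<in>J. (s j)\<^sup>2)" for s
  proof -
    have "(h x - (\<Sum>j\<in>J. s j * \<phi> j x))\<^sup>2 = (h x)\<^sup>2 - 2 * (\<Sum>j\<in>J. s j * (h x * \<phi> j x))
        + (\<Sum>i\<in>J. \<Sum>j\<in>J. s i * s j * (\<phi> i x * \<phi> j x))" for x
    proof -
      have "(\<Sum>j\<in>J. s j * \<phi> j x)\<^sup>2 = (\<Sum>i\<in>J. \<Sum>j\<in>J. s i * s j * (\<phi> i x * \<phi> j x))"
        unfolding power2_eq_square sum_product by (intro sum.cong refl) (simp add: mult_ac)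
      moreover have "h x * (\<Sum>j\<in>J. s j * \<phi> j x) = (\<Sum>j\<in>J. s j * (h x * \<phi> j x))"
        unfolding sum_distrib_left by (intro sum.cong refl) (simp add: mult_ac)
      ultimately show ?thesis by (simp add: power2_diff)
    qed
    then have "(\<integral>x. (h x - (\<Sum>j\<in>J. s j * \<phi> j x))\<^sup>2 \<partial>M) = (\<integral>x. (h x)\<^sup>2 \<partial>M) - 2 * (\<Sum>j\<in>J. s j * b j)
        + (\<Sum>i\<in>J. \<Sum>j\<in>J. s i * s j * (\<integral>x. \<phi> i x * \<phi> j x \<partial>M))"
      using i1 i2 i3 by (simp add: b_def)
    also have "(\<Sum>i\<in>J. \<Sum>j\<in>J. s i * s j * (\<integral>x. \<phi> i x * \<phi> j x \<partial>M)) = (\<Sum>i\<in>J. \<Sum>j\<in>J. if i = j then s i * s j else 0)"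
      by (intro sum.cong refl) (simp add: on)
    also have "\<dots> = (\<Sum>j\<in>J. (s j)\<^sup>2)"
      using \<open>finite J\<close> by (intro sum.cong) (auto simp: power2_eq_square)
    finally show ?thesis .
  qed
  have "0 \<le> (\<integral>x. (h x - (\<Sum>j\<in>J. b j * \<phi> j x))\<^sup>2 \<partial>M)" by (intro Bochner_Integration.integral_nonneg) auto
  then have bessel: "(\<Sum>j\<in>J. (b j)\<^sup>2) \<le> (\<integral>x. (h x)\<^sup>2 \<partial>M)"
    unfolding expand by (simp add: power2_eq_square)
  have "(\<Sum>j\<in>J. (b j - t j)\<^sup>2) = (\<Sum>j\<in>J. (b j)\<^sup>2) - 2 * (\<Sum>j\<in>J. t j * b j) + (\<Sum>j\<in>J. (t j)\<^sup>2)"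
    by (simp add: power2_diff sum.distrib sum_subtractf sum_distrib_left mult_ac)
  then show ?thesis using bessel by (simp add: expand b_def)
qed

context bounded_densities
begin

text \<open>With \<open>x = b + \<gamma> / 2\<close> and \<open>y = \<gamma> / 2 - b\<close>, so that \<open>x + y = \<gamma>\<close>, the minimum of the right-hand side over \<open>b\<close> is
  \<open>\<gamma>\<^sup>2 * l * l' / (l + l')\<close>. The left-hand side minorises this by a tangent (\<open>z\<^sup>2 / w \<ge> 2 * t * z - t\<^sup>2 * w\<close>),
  and its integral only involves the Hellinger affinity of the likelihoods \<open>l\<close> and \<open>l'\<close>.\<close>

lemma two_point_pointwise:
  fixes b \<gamma> t l l' :: real
  assumes "0 \<le> l" "0 \<le> l'"
  shows "\<gamma>\<^sup>2 * (2 * t * (sqrt l * sqrt l') - t\<^sup>2 * (l + l')) \<le> l * (b + \<gamma> / 2)\<^sup>2 + l' * (b - \<gamma> / 2)\<^sup>2"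
proof -
  define A B x y where "A = sqrt l" and "B = sqrt l'" and "x = b + \<gamma> / 2" and "y = \<gamma> / 2 - b"
  have l: "l = A\<^sup>2" "l' = B\<^sup>2" using assms by (auto simp: A_def B_def)
  have \<gamma>: "\<gamma> = x + y" by (simp add: x_def y_def)
  have y2: "(b - \<gamma> / 2)\<^sup>2 = y\<^sup>2" by (simp add: y_def power2_commute)
  have "0 \<le> (A * x - \<gamma> * t * B)\<^sup>2 + (B * y - \<gamma> * t * A)\<^sup>2" by simp
  also have "\<dots> = A\<^sup>2 * x\<^sup>2 + B\<^sup>2 * y\<^sup>2 + \<gamma>\<^sup>2 * t\<^sup>2 * (A\<^sup>2 + B\<^sup>2) - 2 * \<gamma> * t * A * B * (x + y)"
    by (simp add: power2_eq_square algebra_simps)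
  also have "\<dots> = A\<^sup>2 * x\<^sup>2 + B\<^sup>2 * y\<^sup>2 - \<gamma>\<^sup>2 * (2 * t * (A * B) - t\<^sup>2 * (A\<^sup>2 + B\<^sup>2))"
    unfolding \<gamma>[symmetric] by (simp add: power2_eq_square algebra_simps)
  finally show ?thesis unfolding y2 by (simp add: l(1,2)[symmetric] A_def[symmetric] B_def[symmetric] x_def[symmetric])
qed

text \<open>Assouad's method. By \<open>lin\<close> the square root of \<open>f S\<close> has the coefficients \<open>\<plusminus> \<gamma> / 2\<close> up to the error \<open>\<rho>\<close>, with the sign of
  the coefficient of index \<open>j\<close> telling whether \<open>j\<close> belongs to \<open>S\<close>. An estimator yields coefficients \<open>b j\<close>, and for each \<open>j\<close>
  the sets \<open>S\<close> come in pairs \<open>S\<close>, \<open>insert j S\<close> on which \<open>b j\<close> cannot be right twice, because by \<open>aff\<close>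
  the laws of the samples overlap. Averaging over all \<open>S\<close> gives a vertex with large risk.\<close>

theorem hypercube_lower_bound:
  fixes \<phi> :: "'j \<Rightarrow> 'b \<Rightarrow> real" and f :: "'j set \<Rightarrow> 'b \<Rightarrow> real" and \<gamma> a \<rho> c d :: real
    and est :: "('i \<Rightarrow> 'b) \<Rightarrow> 'b \<Rightarrow> real"
  assumes "finite I" and J: "finite J"
    and \<phi>[measurable]: "\<And>j. \<phi> j \<in> borel_measurable U" and \<phi>b: "\<And>j x. \<bar>\<phi> j x\<bar> \<le> d"
    and on: "\<And>i j. i \<in> J \<Longrightarrow> j \<in> J \<Longrightarrow> (\<integral>x. \<phi> i x * \<phi> j x \<partial>U) = (if i = j then 1 else 0)"
    and f: "\<And>S. S \<subseteq> J \<Longrightarrow> bdens (f S)"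
    and lin: "\<And>S. S \<subseteq> J \<Longrightarrow>
      (\<integral>x. (sqrt (f S x) - 1 - (\<Sum>j\<in>J. (if j \<in> S then \<gamma> / 2 else - (\<gamma> / 2)) * \<phi> j x))\<^sup>2 \<partial>U) \<le> \<rho>"
    and aff: "\<And>S j. S \<subseteq> J \<Longrightarrow> j \<in> J \<Longrightarrow> j \<notin> S \<Longrightarrow> a \<le> (\<integral>x. sqrt (f S x) * sqrt (f (insert j S) x) \<partial>U)"
    and "0 \<le> a"
    and est[measurable]: "(\<lambda>(X, x). est X x) \<in> borel_measurable (PiM I (\<lambda>_. U) \<Otimes>\<^sub>M U)"
    and estb: "\<And>X x. X \<in> space (PiM I (\<lambda>_. U)) \<Longrightarrow> x \<in> space U \<Longrightarrow> 0 \<le> est X x \<and> est X x \<le> c"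
  shows "\<exists>S\<subseteq>J. card J * \<gamma>\<^sup>2 * a ^ (2 * card I) / 8 - \<rho> \<le>
    (\<integral>X. (\<Prod>i\<in>I. f S (X i)) * hell2 (f S) (est X) \<partial>PiM I (\<lambda>_. U))"
proof -
  let ?W = "PiM I (\<lambda>_. U)"
  interpret P: product_prob_space "\<lambda>_. U" I ..
  define l where "l S X = (\<Prod>i\<in>I. f S (X i))" for S X
  define b where "b j X = (\<integral>x. (sqrt (est X x) - 1) * \<phi> j x \<partial>U)" for j X
  define s where "s S j = (if j \<in> S then \<gamma> / 2 else - (\<gamma> / 2))" for S and j :: 'j
  define R where "R S = (\<integral>X. l S X * hell2 (f S) (est X) \<partial>?W)" for S
  define e where "e j S = (\<integral>X. l S X * (b j X - s S j)\<^sup>2 \<partial>?W)" for j S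
  note fm[measurable] = bdens_meas[OF f]
  have l_meas[measurable]: "l S \<in> borel_measurable ?W" if "S \<subseteq> J" for S
    unfolding l_def using fm[OF that] by measurable
  have l_pos: "0 \<le> l S X" if "S \<subseteq> J" for S X
    unfolding l_def using bdens_pos[OF f[OF that]] by (intro prod_nonneg) (simp add: less_imp_le)
  have l_le: "l S X \<le> hi ^ card I" if "S \<subseteq> J" for S X
    unfolding l_def using prod_mono[of I "\<lambda>i. f S (X i)" "\<lambda>_. hi"] bdens_pos[OF f[OF that]] bdens_hi[OF f[OF that]]
    by (simp add: less_imp_le)
  have l_int: "integrable ?W (l S)" "(\<integral>X. l S X \<partial>?W) = 1" if "S \<subseteq> J" for S
    unfolding l_def using bdens_integrable[OF f[OF that]] bdens_int[OF f[OF that]] \<open>finite I\<close>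
      P.product_integral_prod[OF \<open>finite I\<close>, of "\<lambda>_. f S"]
    by (auto intro: P.product_integrable_prod)
  have l_mult: "integrable ?W (\<lambda>X. l S X * g X)"
    if "S \<subseteq> J" "g \<in> borel_measurable ?W" "\<And>X. X \<in> space ?W \<Longrightarrow> \<bar>g X\<bar> \<le> C" for S g C
  proof (rule P.integrable_bounded[where c = "hi ^ card I * \<bar>C\<bar>"])
    show "(\<lambda>X. l S X * g X) \<in> borel_measurable ?W" using that by measurable
    fix X assume "X \<in> space ?W"
    then show "\<bar>l S X * g X\<bar> \<le> hi ^ card I * \<bar>C\<bar>"
      using that(3)[of X] l_le[OF that(1), of X] l_pos[OF that(1), of X]
      by (auto simp: abs_mult intro!: mult_mono)
  qed
  have estX[measurable]: "est X \<in> borel_measurable U" if "X \<in> space ?W" for X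
    using measurable_Pair2[OF est that] by simp
  have est_sqrt: "\<bar>sqrt (est X x) - 1\<bar> \<le> sqrt \<bar>c\<bar> + 1" if "X \<in> space ?W" "x \<in> space U" for X x
  proof -
    have "0 \<le> sqrt (est X x)" "sqrt (est X x) \<le> sqrt \<bar>c\<bar>"
      using estb[OF that] by auto
    then show ?thesis by linarith
  qed
  have b_meas[measurable]: "b j \<in> borel_measurable ?W" for j
    unfolding b_def by measurable
  have b_le: "\<bar>b j X\<bar> \<le> (sqrt \<bar>c\<bar> + 1) * d" if X: "X \<in> space ?W" for j X
    unfolding b_def
  proof (rule integral_le_bound)
    show "(\<lambda>x. (sqrt (est X x) - 1) * \<phi> j x) \<in> borel_measurable U" using estX[OF X] by measurable
    fix x assume "x \<in> space U"
    then show "\<bar>(sqrt (est X x) - 1) * \<phi> j x\<bar> \<le> (sqrt \<bar>c\<bar> + 1) * d"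
      using est_sqrt[OF X] \<phi>b by (intro abs_mult_le) auto
  qed
  have bs_le: "\<bar>(b j X - s S j)\<^sup>2\<bar> \<le> ((sqrt \<bar>c\<bar> + 1) * d + \<bar>\<gamma>\<bar>)\<^sup>2" if X: "X \<in> space ?W" for j S X
  proof -
    have "\<bar>b j X - s S j\<bar> \<le> (sqrt \<bar>c\<bar> + 1) * d + \<bar>\<gamma>\<bar>"
      using b_le[OF X, of j] by (auto simp: s_def abs_if split: if_splits)
    from power_mono[OF this, of 2] show ?thesis by simp
  qed
  have e_int: "integrable ?W (\<lambda>X. l S X * (b j X - s S j)\<^sup>2)" if "S \<subseteq> J" for S j
    by (rule l_mult[OF that _ bs_le]) auto

  \<comment> \<open>Bessel's inequality for \<open>sqrt (est X) - 1\<close>.\<close>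
  have risk: "(\<Sum>j\<in>J. e j S) / 2 - \<rho> \<le> R S" if S: "S \<subseteq> J" for S
  proof -
    have pw: "(\<Sum>j\<in>J. (b j X - s S j)\<^sup>2) / 2 - \<rho> \<le> hell2 (f S) (est X)" and
      hb: "\<bar>hell2 (f S) (est X)\<bar> \<le> hi + \<bar>c\<bar>" if X: "X \<in> space ?W" for X
    proof -
      note [measurable] = estX[OF X] fm[OF S]
      define q where "q x = (\<Sum>j\<in>J. s S j * \<phi> j x)" for x
      have [measurable]: "q \<in> borel_measurable U" unfolding q_def by measurable
      have qb: "\<bar>q x\<bar> \<le> (\<Sum>j\<in>J. \<bar>\<gamma>\<bar> * d)" for x
        unfolding q_def
      proof (rule order_trans[OF sum_abs sum_mono])
        fix j show "\<bar>s S j * \<phi> j x\<bar> \<le> \<bar>\<gamma>\<bar> * d"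
          by (intro abs_mult_le \<phi>b) (simp add: s_def)
      qed
      define u v where "u x = sqrt (f S x) - sqrt (est X x)" and "v x = sqrt (f S x) - 1 - q x" for x
      have [measurable]: "u \<in> borel_measurable U" "v \<in> borel_measurable U" unfolding u_def v_def by measurable
      have fs: "0 \<le> sqrt (f S x)" "sqrt (f S x) \<le> sqrt hi" for x
        using bdens_hi[OF f[OF S], of x] bdens_pos[OF f[OF S], of x] by auto
      have ub: "(u x)\<^sup>2 \<le> hi + \<bar>c\<bar>" if x: "x \<in> space U" for x
      proof -
        have "0 \<le> sqrt (f S x) * sqrt (est X x)"
          using bdens_pos[OF f[OF S], of x] estb[OF X x] by simp
        then have "(u x)\<^sup>2 \<le> f S x + est X x"
          unfolding u_def power2_diff using bdens_pos[OF f[OF S], of x] estb[OF X x]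
          by (simp add: power2_eq_square[of "sqrt _"])
        then show ?thesis using bdens_hi[OF f[OF S], of x] estb[OF X x] by linarith
      qed
      have ui: "integrable U (\<lambda>x. (u x)\<^sup>2)"
        using ub by (intro integrable_bounded[where c = "hi + \<bar>c\<bar>"]) auto
      have vi: "integrable U (\<lambda>x. (v x)\<^sup>2)"
      proof (rule integrable_bounded)
        fix x
        have "\<bar>v x\<bar> \<le> sqrt hi + 1 + (\<Sum>j\<in>J. \<bar>\<gamma>\<bar> * d)"
          unfolding v_def using fs[of x] qb[of x] by linarith
        from power_mono[OF this, of 2] show "\<bar>(v x)\<^sup>2\<bar> \<le> (sqrt hi + 1 + (\<Sum>j\<in>J. \<bar>\<gamma>\<bar> * d))\<^sup>2" by simp
      qed measurable
      have hell: "hell2 (f S) (est X) = (\<integral>x. (u x)\<^sup>2 \<partial>U)" by (simp add: hell2_def u_def)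
      show "\<bar>hell2 (f S) (est X)\<bar> \<le> hi + \<bar>c\<bar>"
        unfolding hell using ub by (intro integral_le_bound) auto
      have "(\<Sum>j\<in>J. (b j X - s S j)\<^sup>2) \<le> (\<integral>x. ((sqrt (est X x) - 1) - q x)\<^sup>2 \<partial>U)"
        unfolding b_def q_def
        using est_sqrt[OF X] by (intro bessel_distance[OF J _ _ \<phi> \<phi>b on]) auto
      also have "\<dots> \<le> (\<integral>x. 2 * (u x)\<^sup>2 + 2 * (v x)\<^sup>2 \<partial>U)"
      proof (rule integral_mono')
        fix x
        have "((sqrt (est X x) - 1) - q x)\<^sup>2 = (- u x + v x)\<^sup>2"
          by (rule arg_cong[where f = "\<lambda>z. z\<^sup>2"]) (simp add: u_def v_def)
        also have "\<dots> \<le> 2 * (u x)\<^sup>2 + 2 * (v x)\<^sup>2" using square_add_le[of "- u x" "v x"] by simp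
        finally show "((sqrt (est X x) - 1) - q x)\<^sup>2 \<le> 2 * (u x)\<^sup>2 + 2 * (v x)\<^sup>2" .
      qed (use ui vi in auto)
      also have "\<dots> = 2 * hell2 (f S) (est X) + 2 * (\<integral>x. (v x)\<^sup>2 \<partial>U)" using ui vi by (simp add: hell)
      also have "(\<integral>x. (v x)\<^sup>2 \<partial>U) \<le> \<rho>" using lin[OF S] by (simp add: v_def q_def s_def)
      finally show "(\<Sum>j\<in>J. (b j X - s S j)\<^sup>2) / 2 - \<rho> \<le> hell2 (f S) (est X)" by simp
    qed
    have hm: "(\<lambda>X. hell2 (f S) (est X)) \<in> borel_measurable ?W"
      unfolding hell2_def using fm[OF S] by measurable
    have "(\<integral>X. (\<Sum>j\<in>J. l S X * (b j X - s S j)\<^sup>2) / 2 - \<rho> * l S X \<partial>?W) \<le> R S"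
      unfolding R_def
    proof (rule integral_mono)
      show "integrable ?W (\<lambda>X. (\<Sum>j\<in>J. l S X * (b j X - s S j)\<^sup>2) / 2 - \<rho> * l S X)"
        using e_int[OF S] l_int[OF S] by auto
      show "integrable ?W (\<lambda>X. l S X * hell2 (f S) (est X))"
        by (rule l_mult[OF S hm hb])
      fix X assume X: "X \<in> space ?W"
      have "l S X * ((\<Sum>j\<in>J. (b j X - s S j)\<^sup>2) / 2 - \<rho>) \<le> l S X * hell2 (f S) (est X)"
        using pw[OF X] l_pos[OF S] by (intro mult_left_mono) auto
      then show "(\<Sum>j\<in>J. l S X * (b j X - s S j)\<^sup>2) / 2 - \<rho> * l S X \<le> l S X * hell2 (f S) (est X)"
        by (simp add: sum_distrib_left[symmetric] right_diff_distrib mult.commute)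
    qed
    moreover have "(\<integral>X. (\<Sum>j\<in>J. l S X * (b j X - s S j)\<^sup>2) / 2 - \<rho> * l S X \<partial>?W) = (\<Sum>j\<in>J. e j S) / 2 - \<rho>"
      using e_int[OF S] l_int[OF S] by (simp add: e_def)
    ultimately show ?thesis by simp
  qed

  have pair: "\<gamma>\<^sup>2 * a ^ (2 * card I) / 2 \<le> e j S + e j (insert j S)"
    if S: "S \<subseteq> J" and j: "j \<in> J" "j \<notin> S" for j S
  proof -
    have S': "insert j S \<subseteq> J" using S j by simp
    define A where "A = (\<integral>X. sqrt (l S X) * sqrt (l (insert j S) X) \<partial>?W)"
    have sq: "sqrt (l S X) * sqrt (l (insert j S) X) = (\<Prod>i\<in>I. sqrt (f S (X i)) * sqrt (f (insert j S) (X i)))" for X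
    proof -
      have "sqrt (\<Prod>i\<in>I. g i) = (\<Prod>i\<in>I. sqrt (g i))" for g :: "'i \<Rightarrow> real"
        by (induction I rule: infinite_finite_induct) (auto simp: real_sqrt_mult)
      then show ?thesis by (simp add: l_def prod.distrib)
    qed
    note sp = integrable_sqrt_prod[OF f[OF S] f[OF S']]
    have Ai: "integrable ?W (\<lambda>X. sqrt (l S X) * sqrt (l (insert j S) X))"
      unfolding sq using sp \<open>finite I\<close> by (intro P.product_integrable_prod) auto
    have "A = (\<integral>x. sqrt (f S x) * sqrt (f (insert j S) x) \<partial>U) ^ card I"
      unfolding A_def sq
      using P.product_integral_prod[OF \<open>finite I\<close>, of "\<lambda>_ x. sqrt (f S x) * sqrt (f (insert j S) x)"] sp by simp
    then have A: "a ^ card I \<le> A" using aff[OF S j] \<open>0 \<le> a\<close> by (simp add: power_mono)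
    \<comment> \<open>This \<open>t\<close> maximises \<open>2 * t * a ^ n - 2 * t\<^sup>2\<close>.\<close>
    define t where "t = a ^ card I / 2"
    have "\<gamma>\<^sup>2 * a ^ (2 * card I) / 2 = \<gamma>\<^sup>2 * (2 * t * a ^ card I - t\<^sup>2 * 2)"
      by (simp add: t_def power_mult power2_eq_square power_mult_distrib field_simps flip: power_add)
    also have "\<dots> \<le> \<gamma>\<^sup>2 * (2 * t * A - t\<^sup>2 * 2)"
      using A \<open>0 \<le> a\<close> by (intro mult_left_mono diff_right_mono) (auto simp: t_def)
    also have "\<dots> = (\<integral>X. \<gamma>\<^sup>2 * (2 * t * (sqrt (l S X) * sqrt (l (insert j S) X)) - t\<^sup>2 * (l S X + l (insert j S) X)) \<partial>?W)"
      using Ai l_int[OF S] l_int[OF S'] by (simp add: A_def)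
    also have "\<dots> \<le> (\<integral>X. l S X * (b j X - s S j)\<^sup>2 + l (insert j S) X * (b j X - s (insert j S) j)\<^sup>2 \<partial>?W)"
    proof (rule integral_mono)
      show "integrable ?W (\<lambda>X. \<gamma>\<^sup>2 * (2 * t * (sqrt (l S X) * sqrt (l (insert j S) X)) - t\<^sup>2 * (l S X + l (insert j S) X)))"
        using Ai l_int[OF S] l_int[OF S'] by auto
      show "integrable ?W (\<lambda>X. l S X * (b j X - s S j)\<^sup>2 + l (insert j S) X * (b j X - s (insert j S) j)\<^sup>2)"
        using e_int[OF S] e_int[OF S'] by auto
      fix X
      show "\<gamma>\<^sup>2 * (2 * t * (sqrt (l S X) * sqrt (l (insert j S) X)) - t\<^sup>2 * (l S X + l (insert j S) X))
        \<le> l S X * (b j X - s S j)\<^sup>2 + l (insert j S) X * (b j X - s (insert j S) j)\<^sup>2"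
        using two_point_pointwise[OF l_pos[OF S] l_pos[OF S'], of \<gamma> t X X "b j X"] j by (simp add: s_def)
    qed
    also have "\<dots> = e j S + e j (insert j S)" using e_int[OF S] e_int[OF S'] by (simp add: e_def)
    finally show ?thesis .
  qed

  have col: "2 ^ card J * (\<gamma>\<^sup>2 * a ^ (2 * card I) / 4) \<le> (\<Sum>S\<in>Pow J. e j S)" if j: "j \<in> J" for j
  proof -
    define K where "K = J - {j}"
    have J_eq: "J = insert j K" "j \<notin> K" "finite K" using j J by (auto simp: K_def)
    have "(\<Sum>S\<in>Pow J. e j S) = (\<Sum>S\<in>Pow K. e j S) + (\<Sum>S\<in>insert j ` Pow K. e j S)"
      unfolding J_eq(1) Pow_insert using J_eq(2,3) by (intro sum.union_disjoint) auto
    also have "(\<Sum>S\<in>insert j ` Pow K. e j S) = (\<Sum>S\<in>Pow K. e j (insert j S))"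
    proof -
      have "inj_on (insert j) (Pow K)"
      proof (rule inj_onI)
        fix A B assume "A \<in> Pow K" "B \<in> Pow K" "insert j A = insert j B"
        then show "A = B" using J_eq(2) insert_ident[of j A B] by auto
      qed
      from sum.reindex[OF this, of "e j"] show ?thesis by simp
    qed
    also have "(\<Sum>S\<in>Pow K. e j S) + (\<Sum>S\<in>Pow K. e j (insert j S)) = (\<Sum>S\<in>Pow K. e j S + e j (insert j S))"
      by (simp add: sum.distrib)
    also have "\<dots> \<ge> (\<Sum>S\<in>Pow K. \<gamma>\<^sup>2 * a ^ (2 * card I) / 2)"
      using j J_eq by (intro sum_mono pair) auto
    also have "(\<Sum>S\<in>Pow K. \<gamma>\<^sup>2 * a ^ (2 * card I) / 2) = 2 ^ card J * (\<gamma>\<^sup>2 * a ^ (2 * card I) / 4)"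
      using J_eq(2,3) by (simp add: J_eq(1) card_Pow)
    finally show ?thesis .
  qed

  show ?thesis
  proof (rule ccontr)
    assume "\<not> ?thesis"
    then have less: "R S < card J * \<gamma>\<^sup>2 * a ^ (2 * card I) / 8 - \<rho>" if "S \<subseteq> J" for S
      using that by (auto simp: R_def l_def not_le)
    have "(\<Sum>S\<in>Pow J. R S) < (\<Sum>S\<in>Pow J. card J * \<gamma>\<^sup>2 * a ^ (2 * card I) / 8 - \<rho>)"
      using J less by (intro sum_strict_mono) auto
    also have "\<dots> = (\<Sum>j\<in>J. 2 ^ card J * (\<gamma>\<^sup>2 * a ^ (2 * card I) / 4)) / 2 - 2 ^ card J * \<rho>"
      using J by (simp add: card_Pow right_diff_distrib)
    also have "\<dots> \<le> (\<Sum>j\<in>J. \<Sum>S\<in>Pow J. e j S) / 2 - 2 ^ card J * \<rho>"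
      by (intro diff_right_mono divide_right_mono sum_mono col) auto
    also have "(\<Sum>j\<in>J. \<Sum>S\<in>Pow J. e j S) = (\<Sum>S\<in>Pow J. \<Sum>j\<in>J. e j S)" by (rule sum.swap)
    also have "\<dots> / 2 - 2 ^ card J * \<rho> = (\<Sum>S\<in>Pow J. (\<Sum>j\<in>J. e j S) / 2 - \<rho>)"
      using J by (simp add: sum_subtractf sum_divide_distrib card_Pow)
    also have "\<dots> \<le> (\<Sum>S\<in>Pow J. R S)"
      by (intro sum_mono risk) auto
    finally show False by simp
  qed
qed

end

section \<open>Densities proportional to the exponential of a bounded function\<close>

lemma exp_diff_le:
  fixes u v b :: real
  assumes "u \<le> b" "v \<le> b"
  shows "\<bar>exp u - exp v\<bar> \<le> exp b * \<bar>u - v\<bar>"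
proof -
  have *: "exp x - exp y \<le> exp b * (x - y)" if "y \<le> x" "x \<le> b" for x y :: real
  proof -
    have "exp x - exp y = exp x * (1 - exp (y - x))" by (simp add: right_diff_distrib flip: exp_add)
    also have "\<dots> \<le> exp x * (x - y)"
      using exp_ge_add_one_self[of "y - x"] by (intro mult_left_mono) (linarith, simp)
    also have "\<dots> \<le> exp b * (x - y)" using that by (intro mult_right_mono) auto
    finally show ?thesis .
  qed
  show ?thesis
  proof (cases "v \<le> u")
    case True
    then have "exp v \<le> exp u" by simp
    then show ?thesis using *[OF True assms(1)] True by (simp add: abs_if)
  next
    case False
    then have "u \<le> v" "exp u \<le> exp v" by auto
    then show ?thesis using *[OF \<open>u \<le> v\<close> assms(2)] by (simp add: abs_if)
  qed
qed

lemma exp_minus_linear_bound: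
  fixes x :: real
  assumes "\<bar>x\<bar> \<le> 1"
  shows "\<bar>exp x - 1 - x\<bar> \<le> x\<^sup>2"
proof -
  have "exp x \<le> 1 + x + x\<^sup>2"
  proof (cases "0 \<le> x")
    case True
    then show ?thesis using exp_bound[of x] assms by simp
  next
    case False
    define t where "t = - x"
    have t: "0 \<le> t" "t \<le> 1" using False assms by (auto simp: t_def)
    have "1 \<le> 1 + t\<^sup>2 / 2 + t ^ 3 / 2 + t ^ 4 / 2" using t by simp
    also have "\<dots> = (1 - t + t\<^sup>2) * (1 + t + t\<^sup>2 / 2)"
      by (simp add: power2_eq_square power3_eq_cube power4_eq_xxxx field_simps)
    also have "\<dots> \<le> (1 - t + t\<^sup>2) * exp t"
      using t exp_lower_Taylor_quadratic[of t] by (intro mult_left_mono) auto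
    finally have "exp (- t) \<le> 1 - t + t\<^sup>2" by (simp add: exp_minus field_simps)
    then show ?thesis by (simp add: t_def)
  qed
  moreover have "1 + x \<le> exp x" by (rule exp_ge_add_one_self)
  ultimately show ?thesis using zero_le_power2[of x] unfolding abs_le_iff by linarith
qed

context prob_space
begin

definition gibbs :: "('a \<Rightarrow> real) \<Rightarrow> 'a \<Rightarrow> real" where
  "gibbs u x = exp (u x) / (\<integral>y. exp (u y) \<partial>M)"

lemma gibbs_normaliser:
  fixes b :: real
  assumes [measurable]: "u \<in> borel_measurable M" and u: "\<And>x. \<bar>u x\<bar> \<le> b"
  shows "integrable M (\<lambda>x. exp (u x))"
    and "exp (- b) \<le> (\<integral>y. exp (u y) \<partial>M)" "(\<integral>y. exp (u y) \<partial>M) \<le> exp b"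
proof -
  show i: "integrable M (\<lambda>x. exp (u x))"
    using u by (intro integrable_bounded[where c = "exp b"]) (auto simp: abs_le_iff)
  have "- b \<le> u x" "u x \<le> b" for x using u[of x] by auto
  then show "exp (- b) \<le> (\<integral>y. exp (u y) \<partial>M)" "(\<integral>y. exp (u y) \<partial>M) \<le> exp b"
    using i by (auto intro!: integral_ge_const[OF i] integral_le_const[OF i])
qed

lemma gibbs_bdens:
  fixes b :: real
  assumes u[measurable]: "u \<in> borel_measurable M" and ub: "\<And>x. \<bar>u x\<bar> \<le> b"
  shows "bounded_densities.bdens M (exp (- 2 * b)) (exp (2 * b)) (gibbs u)"
proof -
  interpret bounded_densities M "exp (- 2 * b)" "exp (2 * b)" by unfold_locales simp
  note Z = gibbs_normaliser[OF u ub]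
  let ?Z = "\<integral>y. exp (u y) \<partial>M"
  have Zpos: "0 < ?Z" using Z(2) by (rule less_le_trans[OF exp_gt_zero])
  show ?thesis unfolding bdens_def
  proof (intro conjI allI)
    show "gibbs u \<in> borel_measurable M" unfolding gibbs_def by measurable
    fix x
    have ux: "- b \<le> u x" "u x \<le> b" using ub[of x] by auto
    have "exp (- 2 * b) = exp (- b) / exp b" by (simp flip: exp_diff)
    also have "\<dots> \<le> gibbs u x" unfolding gibbs_def using ux Z(3) Zpos by (intro frac_le) auto
    finally show "exp (- 2 * b) \<le> gibbs u x" .
    have "gibbs u x \<le> exp b / exp (- b)" unfolding gibbs_def using ux Z(2) Zpos by (intro frac_le) auto
    also have "\<dots> = exp (2 * b)" by (simp flip: exp_diff)
    finally show "gibbs u x \<le> exp (2 * b)" .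
    show "(\<integral>x. gibbs u x \<partial>M) = 1" unfolding gibbs_def using Zpos by simp
  qed
qed

text \<open>The numerator \<open>exp u\<close> is pointwise Lipschitz in \<open>u\<close>, and the normalising constant is Lipschitz in the \<open>L\<^sup>1\<close>
  distance, which on a probability space is at most the \<open>L\<^sup>2\<close> distance.\<close>

lemma gibbs_dist2_le:
  fixes b :: real
  assumes u[measurable]: "u \<in> borel_measurable M" and ub: "\<And>x. \<bar>u x\<bar> \<le> b"
    and v[measurable]: "v \<in> borel_measurable M" and vb: "\<And>x. \<bar>v x\<bar> \<le> b"
  shows "(\<integral>x. (gibbs u x - gibbs v x)\<^sup>2 \<partial>M) \<le> 4 * exp (8 * b) * (\<integral>x. (u x - v x)\<^sup>2 \<partial>M)"
proof -
  have b0: "0 \<le> b" using order_trans[OF abs_ge_zero ub] .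
  note Zu = gibbs_normaliser[OF u ub] and Zv = gibbs_normaliser[OF v vb]
  define Y Z where "Y = (\<integral>y. exp (u y) \<partial>M)" and "Z = (\<integral>y. exp (v y) \<partial>M)"
  have YZ: "exp (- b) \<le> Y" "exp (- b) \<le> Z" "0 < Y" "0 < Z"
    using Zu(2) Zv(2) less_le_trans[OF exp_gt_zero Zu(2)] less_le_trans[OF exp_gt_zero Zv(2)]
    by (auto simp: Y_def Z_def)
  have ux: "u x \<le> b" "v x \<le> b" for x using ub[of x] vb[of x] by auto
  have wb: "\<bar>u x - v x\<bar> \<le> 2 * b" for x using ub[of x] vb[of x] by linarith
  have iw: "integrable M (\<lambda>x. \<bar>u x - v x\<bar>)"
    using wb by (intro integrable_bounded[where c = "2 * b"]) auto
  have iw2: "integrable M (\<lambda>x. (u x - v x)\<^sup>2)"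
  proof (rule integrable_bounded)
    fix x show "\<bar>(u x - v x)\<^sup>2\<bar> \<le> (2 * b)\<^sup>2" using power_mono[OF wb[of x], of 2] by simp
  qed measurable
  define m where "m = (\<integral>x. \<bar>u x - v x\<bar> \<partial>M)"
  have m2: "m\<^sup>2 \<le> (\<integral>x. (u x - v x)\<^sup>2 \<partial>M)"
    using square_integral_le[of "\<lambda>x. \<bar>u x - v x\<bar>"] iw iw2 by (simp add: m_def)
  have ZY: "\<bar>Z - Y\<bar> \<le> exp b * m"
  proof -
    have "\<bar>Z - Y\<bar> = \<bar>\<integral>x. exp (v x) - exp (u x) \<partial>M\<bar>" using Zu(1) Zv(1) by (simp add: Y_def Z_def)
    also have "\<dots> \<le> (\<integral>x. \<bar>exp (v x) - exp (u x)\<bar> \<partial>M)"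
      using integral_norm_bound[of M "\<lambda>x. exp (v x) - exp (u x)"] by simp
    also have "\<dots> \<le> (\<integral>x. exp b * \<bar>u x - v x\<bar> \<partial>M)"
      using iw exp_diff_le[OF ux(2) ux(1)] by (intro integral_mono') (auto simp: abs_minus_commute)
    finally show ?thesis by (simp add: m_def)
  qed
  have "\<bar>gibbs u x - gibbs v x\<bar> \<le> exp (2 * b) * \<bar>u x - v x\<bar> + exp (4 * b) * m" for x
  proof -
    have inv: "inverse Y \<le> exp b" "inverse Z \<le> exp b"
      using le_imp_inverse_le[OF YZ(1)] le_imp_inverse_le[OF YZ(2)] by (auto simp: exp_minus)
    have "gibbs u x - gibbs v x = (exp (u x) - exp (v x)) * inverse Y + (Z - Y) * (exp (v x) * (inverse Y * inverse Z))"
      unfolding gibbs_def Y_def[symmetric] Z_def[symmetric] using YZ by (simp add: field_simps)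
    also have "\<bar>\<dots>\<bar> \<le> exp b * \<bar>u x - v x\<bar> * exp b + exp b * m * (exp b * (exp b * exp b))"
    proof (rule order_trans[OF abs_triangle_ineq add_mono])
      show "\<bar>(exp (u x) - exp (v x)) * inverse Y\<bar> \<le> exp b * \<bar>u x - v x\<bar> * exp b"
        using exp_diff_le[OF ux] inv YZ by (intro abs_mult_le) auto
      show "\<bar>(Z - Y) * (exp (v x) * (inverse Y * inverse Z))\<bar> \<le> exp b * m * (exp b * (exp b * exp b))"
        using ZY inv YZ ux by (intro abs_mult_le) auto
    qed
    also have "\<dots> = exp (2 * b) * \<bar>u x - v x\<bar> + exp (4 * b) * m"
    proof -
      have "exp (2 * b) = exp b * exp b" "exp (4 * b) = exp b * (exp b * (exp b * exp b))"
        by (simp_all flip: exp_add)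
      then show ?thesis by (simp add: mult_ac)
    qed
    finally show ?thesis .
  qed
  then have pw: "(gibbs u x - gibbs v x)\<^sup>2 \<le> 2 * (exp (2 * b) * \<bar>u x - v x\<bar>)\<^sup>2 + 2 * (exp (4 * b) * m)\<^sup>2" for x
    using power_mono[of "\<bar>gibbs u x - gibbs v x\<bar>" _ 2] square_add_le order_trans by fastforce
  have "(\<integral>x. (gibbs u x - gibbs v x)\<^sup>2 \<partial>M) \<le> (\<integral>x. 2 * (exp (2 * b) * \<bar>u x - v x\<bar>)\<^sup>2 + 2 * (exp (4 * b) * m)\<^sup>2 \<partial>M)"
    using iw2 pw by (intro integral_mono') (auto simp: power_mult_distrib)
  also have "\<dots> = 2 * exp (4 * b) * (\<integral>x. (u x - v x)\<^sup>2 \<partial>M) + 2 * exp (8 * b) * m\<^sup>2"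
    using iw2 by (simp add: power_mult_distrib prob_space flip: exp_double)
  also have "\<dots> \<le> 2 * exp (8 * b) * (\<integral>x. (u x - v x)\<^sup>2 \<partial>M) + 2 * exp (8 * b) * (\<integral>x. (u x - v x)\<^sup>2 \<partial>M)"
    using m2 b0 by (intro add_mono mult_mono mult_left_mono) auto
  finally show ?thesis by simp
qed

text \<open>To first order the square root of the density is \<open>1 + u / 2\<close>: the normalising constant
  enters only quadratically, because \<open>u\<close> has mean zero.\<close>

lemma sqrt_gibbs_linearisation:
  fixes \<kappa> :: real
  assumes u[measurable]: "u \<in> borel_measurable M" and ub: "\<And>x. \<bar>u x\<bar> \<le> \<kappa>" and "\<kappa> \<le> 1"
    and mean: "(\<integral>x. u x \<partial>M) = 0"
  shows "(\<integral>x. (sqrt (gibbs u x) - 1 - u x / 2)\<^sup>2 \<partial>M) \<le> 10 * \<kappa>\<^sup>2 * (\<integral>x. (u x)\<^sup>2 \<partial>M)"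
proof -
  have \<kappa>0: "0 \<le> \<kappa>" using order_trans[OF abs_ge_zero ub] .
  define m where "m = (\<integral>x. (u x)\<^sup>2 \<partial>M)"
  define Z where "Z = (\<integral>x. exp (u x) \<partial>M)"
  have iu: "integrable M u" using ub by (intro integrable_bounded) auto
  have u2: "(u x)\<^sup>2 \<le> \<kappa>\<^sup>2" for x using power_mono[OF ub[of x], of 2] by simp
  have iu2: "integrable M (\<lambda>x. (u x)\<^sup>2)" using u2 by (intro integrable_bounded[where c = "\<kappa>\<^sup>2"]) auto
  have m: "0 \<le> m" "m \<le> \<kappa>\<^sup>2" unfolding m_def using iu2 u2
    by (auto intro!: Bochner_Integration.integral_nonneg integral_le_const)
  have ie: "integrable M (\<lambda>x. exp (u x))" by (rule gibbs_normaliser[OF u ub])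
  have "(\<integral>x. 1 + u x \<partial>M) \<le> Z" unfolding Z_def
    using iu ie exp_ge_add_one_self by (intro integral_mono) auto
  then have Z1: "1 \<le> Z" using iu mean by (simp add: prob_space)
  have "Z \<le> (\<integral>x. 1 + u x + (u x)\<^sup>2 \<partial>M)" unfolding Z_def
  proof (rule integral_mono)
    fix x
    have "\<bar>u x\<bar> \<le> 1" using ub[of x] \<open>\<kappa> \<le> 1\<close> by linarith
    from exp_minus_linear_bound[OF this] show "exp (u x) \<le> 1 + u x + (u x)\<^sup>2" by linarith
  qed (use iu iu2 ie in auto)
  then have Z2: "Z \<le> 1 + m" using iu iu2 mean by (simp add: prob_space m_def)
  define q where "q = 1 / sqrt Z"
  have q: "1 - q \<le> m" "0 \<le> 1 - q"
  proof -
    have "sqrt Z * 1 \<le> sqrt Z * sqrt Z" using Z1 by (intro mult_left_mono) auto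
    then have "sqrt Z \<le> Z" using Z1 by simp
    then have "1 / Z \<le> q" unfolding q_def using Z1 by (intro divide_left_mono) auto
    moreover have "1 - 1 / Z \<le> Z - 1"
    proof -
      have "(Z - 1) / Z \<le> (Z - 1) / 1" using Z1 by (intro divide_left_mono) auto
      then show ?thesis using Z1 by (simp add: diff_divide_distrib)
    qed
    ultimately show "1 - q \<le> m" using Z2 by linarith
    show "0 \<le> 1 - q" using Z1 by (simp add: q_def)
  qed
  have pw: "(sqrt (gibbs u x) - 1 - u x / 2)\<^sup>2 \<le> 2 * (\<kappa>\<^sup>2 * (u x)\<^sup>2) + 8 * m\<^sup>2" for x
  proof -
    have ux: "\<bar>u x / 2\<bar> \<le> 1" "u x / 2 \<le> 1 / 2" using ub[of x] \<open>\<kappa> \<le> 1\<close> by auto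
    define E where "E = exp (u x / 2)"
    have "sqrt (exp (u x)) = E"
      by (rule real_sqrt_unique) (simp_all add: E_def flip: exp_double)
    then have "sqrt (gibbs u x) = E * q" by (simp add: gibbs_def Z_def[symmetric] q_def real_sqrt_divide)
    then have eq: "sqrt (gibbs u x) - 1 - u x / 2 = (E - 1 - u x / 2) + E * (q - 1)"
      by (simp add: algebra_simps)
    have E1: "\<bar>E - 1 - u x / 2\<bar> \<le> (u x)\<^sup>2"
    proof -
      have "(u x / 2)\<^sup>2 \<le> (u x)\<^sup>2" by (simp add: power_divide)
      then show ?thesis using exp_minus_linear_bound[OF ux(1)] unfolding E_def by linarith
    qed
    have "E \<le> exp (1 / 2)" unfolding E_def using ux(2) by simp
    also have "\<dots> \<le> 1 + 1 / 2 + (1 / 2)\<^sup>2" by (rule exp_bound) auto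
    also have "\<dots> \<le> (2::real)" by (simp add: power2_eq_square)
    finally have "\<bar>E * (q - 1)\<bar> \<le> 2 * m" using q by (intro abs_mult_le) (auto simp: E_def)
    then have "\<bar>sqrt (gibbs u x) - 1 - u x / 2\<bar> \<le> (u x)\<^sup>2 + 2 * m" unfolding eq using E1 by linarith
    from power_mono[OF this, of 2] have "(sqrt (gibbs u x) - 1 - u x / 2)\<^sup>2 \<le> ((u x)\<^sup>2 + 2 * m)\<^sup>2" by simp
    also have "\<dots> \<le> 2 * ((u x)\<^sup>2)\<^sup>2 + 2 * (2 * m)\<^sup>2" by (rule square_add_le)
    also have "((u x)\<^sup>2)\<^sup>2 \<le> \<kappa>\<^sup>2 * (u x)\<^sup>2"
      unfolding power2_eq_square[of "(u x)\<^sup>2"] using u2 by (intro mult_right_mono) auto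
    finally show ?thesis by (simp add: power_mult_distrib)
  qed
  have "(\<integral>x. (sqrt (gibbs u x) - 1 - u x / 2)\<^sup>2 \<partial>M) \<le> (\<integral>x. 2 * (\<kappa>\<^sup>2 * (u x)\<^sup>2) + 8 * m\<^sup>2 \<partial>M)"
    using iu2 pw by (intro integral_mono') auto
  also have "\<dots> = 2 * \<kappa>\<^sup>2 * m + 8 * (m * m)" using iu2 by (simp add: m_def prob_space power2_eq_square)
  also have "m * m \<le> \<kappa>\<^sup>2 * m" using m by (intro mult_right_mono) auto
  finally show ?thesis by (simp add: m_def)
qed

end

section \<open>The trigonometric system\<close>

abbreviation unif :: "real measure" where
  "unif \<equiv> restrict_space lborel {0..1}"

interpretation unif: prob_space unif
  by (rule prob_spaceI) (simp add: emeasure_restrict_space space_restrict_space)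

lemma integral_unif: "(\<integral>x. f x \<partial>unif) = (LBINT x:{0..1}. f x)" for f :: "real \<Rightarrow> real"
  by (simp add: integral_restrict_space set_lebesgue_integral_def)

lemma borel_measurable_unif[measurable (raw)]: "f \<in> borel_measurable borel \<Longrightarrow> f \<in> borel_measurable unif"
  by (simp add: measurable_restrict_space1)

lemma integral_cos_period:
  "(\<integral>x. cos (2 * pi * of_int m * x - s) \<partial>unif) = (if m = 0 then cos s else 0)"
proof (cases "m = 0")
  case True
  then show ?thesis using unif.prob_space by simp
next
  case False
  define w where "w = 2 * pi * real_of_int m"
  have w: "w \<noteq> 0" using False by (simp add: w_def)
  have "(\<integral>x. cos (w * x - s) * indicator {0..1} x \<partial>lborel) = sin (w * 1 - s) / w - sin (w * 0 - s) / w"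
    using w by (intro integral_FTC_Icc_real) (auto intro!: derivative_eq_intros continuous_intros)
  also have "sin (w * 1 - s) = sin (- s)"
  proof -
    have "sin (w * 1 - s) = sin (w - s)" by simp
    also have "\<dots> = sin w * cos s - cos w * sin s" by (rule sin_diff)
    also have "sin w = 0" unfolding w_def using sin_int_2pin[of m] by simp
    also have "cos w = 1" unfolding w_def using cos_int_2pin[of m] by simp
    finally show ?thesis by simp
  qed
  finally show ?thesis using False
    by (simp add: integral_restrict_space w_def mult.commute)
qed

text \<open>A sine is a cosine shifted by \<open>pi / 2\<close>. Treating both alike reduces the orthogonality relations to one addition formula
  and one integral.\<close>

definition trig_shift :: "nat \<Rightarrow> real" where
  "trig_shift j = (if odd j then pi / 2 else 0)"

definition wave :: "nat \<Rightarrow> int" where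
  "wave j = int ((j + 1) div 2)"

lemma trig_eq_cos:
  assumes "j \<noteq> 0"
  shows "trig j x = sqrt 2 * cos (2 * pi * of_int (wave j) * x - trig_shift j)"
proof (cases "odd j")
  case True
  then show ?thesis using assms
    by (simp add: trig_def trig_shift_def wave_def cos_diff)
next
  case False
  then have "(j + 1) div 2 = j div 2" by auto
  then show ?thesis using assms False by (simp add: trig_def trig_shift_def wave_def)
qed

lemma trig_measurable[measurable]: "trig j \<in> borel_measurable borel"
proof (cases "j = 0")
  case False
  then show ?thesis unfolding trig_eq_cos[OF False, abs_def] by measurable
qed (simp add: trig_def[abs_def])

lemma abs_trig_le: "\<bar>trig j x\<bar> \<le> sqrt 2"
proof (cases "j = 0")
  case False
  have "sqrt 2 * \<bar>cos y\<bar> \<le> sqrt 2 * 1" for y by (intro mult_left_mono) auto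
  then show ?thesis by (simp add: trig_eq_cos[OF False] abs_mult)
qed (simp add: trig_def)

lemma trig_mean_zero: "j \<noteq> 0 \<Longrightarrow> (\<integral>x. trig j x \<partial>unif) = 0"
proof -
  assume j: "j \<noteq> 0"
  then have "wave j \<noteq> 0" by (auto simp: wave_def)
  then show ?thesis by (simp add: trig_eq_cos[OF j] integral_cos_period)
qed

lemma trig_orthonormal:
  assumes "i \<noteq> 0" "j \<noteq> 0"
  shows "(\<integral>x. trig i x * trig j x \<partial>unif) = (if i = j then 1 else 0)"
proof -
  let ?A = "\<lambda>x. cos (2 * pi * of_int (wave i - wave j) * x - (trig_shift i - trig_shift j))"
  let ?B = "\<lambda>x. cos (2 * pi * of_int (wave i + wave j) * x - (trig_shift i + trig_shift j))"
  have w: "wave i + wave j \<noteq> 0" using assms by (auto simp: wave_def)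
  have "trig i x * trig j x = ?A x + ?B x" for x
  proof -
    have "trig i x * trig j x = 2 * (cos (2 * pi * of_int (wave i) * x - trig_shift i) * cos (2 * pi * of_int (wave j) * x - trig_shift j))"
      by (simp add: trig_eq_cos assms)
    also have "\<dots> = ?A x + ?B x"
      unfolding cos_times_cos by (simp add: algebra_simps)
    finally show ?thesis .
  qed
  then have "(\<integral>x. trig i x * trig j x \<partial>unif) = (\<integral>x. ?A x \<partial>unif) + (\<integral>x. ?B x \<partial>unif)"
    by (simp only:) (intro Bochner_Integration.integral_add unif.integrable_bounded[where c = 1]; simp)
  also have "\<dots> = (if wave i = wave j then cos (trig_shift i - trig_shift j) else 0)"
    unfolding integral_cos_period using w by simp
  also have "\<dots> = (if i = j then 1 else 0)"
  proof (cases "wave i = wave j \<and> i \<noteq> j")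
    case True
    then have "odd i \<noteq> odd j" unfolding wave_def by presburger
    then show ?thesis using True by (auto simp: trig_shift_def)
  qed auto
  finally show ?thesis .
qed

lemma integral_square_trig_sum:
  assumes "finite J" "0 \<notin> J"
  shows "(\<integral>x. (\<Sum>j\<in>J. d j * trig j x)\<^sup>2 \<partial>unif) = (\<Sum>j\<in>J. (d j)\<^sup>2)"
proof -
  have i: "integrable unif (\<lambda>x. trig i x * trig j x)" for i j
    by (intro unif.integrable_bounded[where c = "sqrt 2 * sqrt 2"] abs_mult_le abs_trig_le) measurable
  have "(\<Sum>j\<in>J. d j * trig j x)\<^sup>2 = (\<Sum>i\<in>J. \<Sum>j\<in>J. d i * d j * (trig i x * trig j x))" for x
    unfolding power2_eq_square sum_product by (intro sum.cong refl) (simp add: mult_ac)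
  then have "(\<integral>x. (\<Sum>j\<in>J. d j * trig j x)\<^sup>2 \<partial>unif) = (\<Sum>i\<in>J. \<Sum>j\<in>J. d i * d j * (\<integral>x. trig i x * trig j x \<partial>unif))"
    using i by simp
  also have "\<dots> = (\<Sum>i\<in>J. \<Sum>j\<in>J. if i = j then d i * d j else 0)"
    using assms by (intro sum.cong refl) (metis mult.right_neutral mult_zero_right trig_orthonormal)
  also have "\<dots> = (\<Sum>j\<in>J. (d j)\<^sup>2)"
    using \<open>finite J\<close> by (intro sum.cong) (auto simp: power2_eq_square)
  finally show ?thesis .
qed

definition log_dens :: "(nat \<Rightarrow> real) \<Rightarrow> real \<Rightarrow> real" where
  "log_dens \<theta> x = (\<Sum>j. \<theta> (Suc j) * trig (Suc j) x)"

lemma log_dens_measurable[measurable]: "log_dens \<theta> \<in> borel_measurable borel"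
  unfolding log_dens_def by measurable

lemma dens_eq_gibbs: "dens \<theta> = unif.gibbs (log_dens \<theta>)"
  by (rule ext) (simp add: dens_def unif.gibbs_def exp_series_def log_dens_def integral_unif)

lemma log_dens_summable:
  assumes "summable (\<lambda>j. \<bar>\<theta> (Suc j)\<bar>)"
  shows "summable (\<lambda>j. \<theta> (Suc j) * trig (Suc j) x)"
    and "\<bar>\<Sum>j. \<theta> (Suc j) * trig (Suc j) x\<bar> \<le> sqrt 2 * (\<Sum>j. \<bar>\<theta> (Suc j)\<bar>)"
    and "\<bar>\<Sum>j<n. \<theta> (Suc j) * trig (Suc j) x\<bar> \<le> sqrt 2 * (\<Sum>j. \<bar>\<theta> (Suc j)\<bar>)"
proof -
  have le: "\<bar>\<theta> (Suc j) * trig (Suc j) x\<bar> \<le> \<bar>\<theta> (Suc j)\<bar> * sqrt 2" for j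
    by (intro abs_mult_le abs_trig_le) simp
  have s1: "summable (\<lambda>j. \<bar>\<theta> (Suc j)\<bar> * sqrt 2)" using assms by (rule summable_mult2)
  have s: "summable (\<lambda>j. \<bar>\<theta> (Suc j) * trig (Suc j) x\<bar>)"
    by (rule summable_comparison_test'[OF s1, where N = 0]) (use le in simp)
  then show "summable (\<lambda>j. \<theta> (Suc j) * trig (Suc j) x)" by (rule summable_rabs_cancel)
  have tot: "(\<Sum>j. \<bar>\<theta> (Suc j) * trig (Suc j) x\<bar>) \<le> sqrt 2 * (\<Sum>j. \<bar>\<theta> (Suc j)\<bar>)"
    using suminf_le[OF le s s1] suminf_mult2[OF assms, of "sqrt 2"] by (simp add: mult.commute)
  show "\<bar>\<Sum>j. \<theta> (Suc j) * trig (Suc j) x\<bar> \<le> sqrt 2 * (\<Sum>j. \<bar>\<theta> (Suc j)\<bar>)"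
    using summable_rabs[OF s] tot by linarith
  have "\<bar>\<Sum>j<n. \<theta> (Suc j) * trig (Suc j) x\<bar> \<le> (\<Sum>j<n. \<bar>\<theta> (Suc j) * trig (Suc j) x\<bar>)" by (rule sum_abs)
  also have "\<dots> \<le> (\<Sum>j. \<bar>\<theta> (Suc j) * trig (Suc j) x\<bar>)" by (rule sum_le_suminf[OF s]) auto
  finally show "\<bar>\<Sum>j<n. \<theta> (Suc j) * trig (Suc j) x\<bar> \<le> sqrt 2 * (\<Sum>j. \<bar>\<theta> (Suc j)\<bar>)" using tot by linarith
qed

lemma integral_square_log_dens_le:
  assumes abs: "summable (\<lambda>j. \<bar>d (Suc j)\<bar>)" and sq: "summable (\<lambda>j. (d (Suc j))\<^sup>2)"
  shows "(\<integral>x. (log_dens d x)\<^sup>2 \<partial>unif) \<le> (\<Sum>j. (d (Suc j))\<^sup>2)"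
proof (rule LIMSEQ_le_const2)
  define s where "s n x = (\<Sum>j<n. d (Suc j) * trig (Suc j) x)" for n x
  define c where "c = sqrt 2 * (\<Sum>j. \<bar>d (Suc j)\<bar>)"
  have [measurable]: "s n \<in> borel_measurable borel" for n unfolding s_def by measurable
  show "(\<lambda>n. \<integral>x. (s n x)\<^sup>2 \<partial>unif) \<longlonglongrightarrow> (\<integral>x. (log_dens d x)\<^sup>2 \<partial>unif)"
  proof (rule integral_dominated_convergence[where w = "\<lambda>_. c\<^sup>2"])
    show "AE x in unif. (\<lambda>n. (s n x)\<^sup>2) \<longlonglongrightarrow> (log_dens d x)\<^sup>2"
      using log_dens_summable(1)[OF abs] unfolding s_def log_dens_def
      by (intro AE_I2 tendsto_power summable_LIMSEQ) auto
    show "AE x in unif. norm ((s n x)\<^sup>2) \<le> c\<^sup>2" for n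
    proof (rule AE_I2)
      fix x
      have "\<bar>s n x\<bar> \<le> c" unfolding s_def c_def by (rule log_dens_summable(3)[OF abs])
      from power_mono[OF this, of 2] show "norm ((s n x)\<^sup>2) \<le> c\<^sup>2" by simp
    qed
  qed auto
  have "(\<integral>x. (s n x)\<^sup>2 \<partial>unif) \<le> (\<Sum>j. (d (Suc j))\<^sup>2)" for n
  proof -
    have "s n x = (\<Sum>j\<in>Suc ` {..<n}. d j * trig j x)" for x by (simp add: s_def sum.reindex)
    then have "(\<integral>x. (s n x)\<^sup>2 \<partial>unif) = (\<Sum>j\<in>Suc ` {..<n}. (d j)\<^sup>2)"
      by (simp add: integral_square_trig_sum)
    also have "\<dots> = (\<Sum>j<n. (d (Suc j))\<^sup>2)" by (simp add: sum.reindex)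
    also have "\<dots> \<le> (\<Sum>j. (d (Suc j))\<^sup>2)" by (rule sum_le_suminf[OF sq]) auto
    finally show ?thesis .
  qed
  then show "\<exists>N. \<forall>n\<ge>N. (\<integral>x. (s n x)\<^sup>2 \<partial>unif) \<le> (\<Sum>j. (d (Suc j))\<^sup>2)" by blast
qed

section \<open>Sobolev ellipsoids\<close>

lemma freq_bounds: "j \<le> freq j" "freq j \<le> Suc j"
  by (auto simp: freq_def)

lemma freq_Suc_pos: "0 < freq (Suc j)"
  by (simp add: freq_def)

lemma summable_inverse_freq:
  assumes "p \<ge> 1"
  shows "summable (\<lambda>j. 1 / real (freq (Suc j)) ^ (2 * p))"
proof (rule summable_comparison_test'[where N = 0])
  show "summable (\<lambda>j. 1 / real (Suc j) ^ 2)"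
    using inverse_power_summable[of 2, where ?'a = real] summable_Suc_iff[of "\<lambda>j. 1 / real j ^ 2"]
    by (simp add: divide_inverse del: of_nat_Suc)
  fix j
  have "real (Suc j) ^ 2 \<le> real (Suc j) ^ (2 * p)" using assms by (intro power_increasing) auto
  also have "\<dots> \<le> real (freq (Suc j)) ^ (2 * p)" using freq_bounds(1)[of "Suc j"] by (intro power_mono) auto
  finally show "norm (1 / real (freq (Suc j)) ^ (2 * p)) \<le> 1 / real (Suc j) ^ 2"
    by (simp add: frac_le)
qed

lemma ellipsoidD:
  assumes "\<theta> \<in> sobolev_ellipsoid p R"
  shows "summable (\<lambda>j. (\<theta> j)\<^sup>2)" "summable (\<lambda>j. real (freq j) ^ (2 * p) * (\<theta> j)\<^sup>2)"
    "(\<Sum>j. real (freq j) ^ (2 * p) * (\<theta> j)\<^sup>2) < R"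
  using assms by (auto simp: sobolev_ellipsoid_def)

lemma ellipsoid_mono: "R \<le> R' \<Longrightarrow> sobolev_ellipsoid p R \<subseteq> sobolev_ellipsoid p R'"
  by (auto simp: sobolev_ellipsoid_def)

lemma ellipsoid_partial_sum_le:
  assumes "\<theta> \<in> sobolev_ellipsoid p R"
  shows "(\<Sum>j<N. real (freq (Suc j)) ^ (2 * p) * (\<theta> (Suc j))\<^sup>2) \<le> R"
proof -
  have "(\<Sum>j<N. real (freq (Suc j)) ^ (2 * p) * (\<theta> (Suc j))\<^sup>2)
      = (\<Sum>j\<in>Suc ` {..<N}. real (freq j) ^ (2 * p) * (\<theta> j)\<^sup>2)"
    by (simp add: sum.reindex)
  also have "\<dots> \<le> (\<Sum>j. real (freq j) ^ (2 * p) * (\<theta> j)\<^sup>2)"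
    by (intro sum_le_suminf ellipsoidD[OF assms]) auto
  finally show ?thesis using ellipsoidD(3)[OF assms] by simp
qed

lemma ellipsoid_Suc:
  assumes "\<theta> \<in> sobolev_ellipsoid p R"
  shows "summable (\<lambda>j. (\<theta> (Suc j))\<^sup>2)"
    and "summable (\<lambda>j. real (freq (Suc j)) ^ (2 * p) * (\<theta> (Suc j))\<^sup>2)"
    and "(\<Sum>j. real (freq (Suc j)) ^ (2 * p) * (\<theta> (Suc j))\<^sup>2) \<le> R"
proof -
  show "summable (\<lambda>j. (\<theta> (Suc j))\<^sup>2)"
    using ellipsoidD(1)[OF assms] summable_Suc_iff[of "\<lambda>j. (\<theta> j)\<^sup>2"] by blast
  show s: "summable (\<lambda>j. real (freq (Suc j)) ^ (2 * p) * (\<theta> (Suc j))\<^sup>2)"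
    using ellipsoidD(2)[OF assms] summable_Suc_iff[of "\<lambda>j. real (freq j) ^ (2 * p) * (\<theta> j)\<^sup>2"] by blast
  show "(\<Sum>j. real (freq (Suc j)) ^ (2 * p) * (\<theta> (Suc j))\<^sup>2) \<le> R"
    by (intro suminf_le_const[OF s] ellipsoid_partial_sum_le[OF assms])
qed

text \<open>With the weight \<open>w\<close> of a coordinate, \<open>2 * \<bar>\<theta>\<bar> \<le> w * \<theta>\<^sup>2 + 1 / w\<close>, and the series of \<open>1 / w\<close> converges for \<open>p \<ge> 1\<close>. So
  the exponents of the densities are bounded uniformly over the ellipsoid.\<close>

lemma ellipsoid_abs_summable:
  assumes p: "p \<ge> 1" and \<theta>: "\<theta> \<in> sobolev_ellipsoid p R"
  shows "summable (\<lambda>j. \<bar>\<theta> (Suc j)\<bar>)" and "(\<Sum>j. \<bar>\<theta> (Suc j)\<bar>) \<le> (R + A_const p) / 2"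
proof -
  let ?w = "\<lambda>j. real (freq (Suc j)) ^ (2 * p)"
  have le: "\<bar>\<theta> (Suc j)\<bar> \<le> (?w j * (\<theta> (Suc j))\<^sup>2 + 1 / ?w j) / 2" for j
  proof -
    define v where "v = real (freq (Suc j)) ^ p"
    have v: "0 < v" "?w j = v\<^sup>2" using freq_Suc_pos[of j] by (auto simp: v_def power_mult mult.commute[of 2])
    have "2 * (v * \<bar>\<theta> (Suc j)\<bar>) * (1 / v) \<le> (v * \<bar>\<theta> (Suc j)\<bar>)\<^sup>2 + (1 / v)\<^sup>2" by (rule sum_squares_bound)
    then show ?thesis using v by (simp add: power_mult_distrib power_divide)
  qed
  note s1 = ellipsoid_Suc(2)[OF \<theta>] and tot = ellipsoid_Suc(3)[OF \<theta>]
  note s2 = summable_inverse_freq[OF p]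
  have s3: "summable (\<lambda>j. (?w j * (\<theta> (Suc j))\<^sup>2 + 1 / ?w j) / 2)"
    using s1 s2 by (intro summable_divide summable_add)
  show s: "summable (\<lambda>j. \<bar>\<theta> (Suc j)\<bar>)"
    by (rule summable_comparison_test'[OF s3, where N = 0]) (use le in simp)
  have "(\<Sum>j. \<bar>\<theta> (Suc j)\<bar>) \<le> (\<Sum>j. (?w j * (\<theta> (Suc j))\<^sup>2 + 1 / ?w j) / 2)" by (rule suminf_le[OF le s s3])
  also have "\<dots> = ((\<Sum>j. ?w j * (\<theta> (Suc j))\<^sup>2) + A_const p) / 2"
    using s1 s2 by (subst suminf_divide) (auto simp: suminf_add A_const_def intro: summable_add)
  also have "\<dots> \<le> (R + A_const p) / 2" using tot by simp
  finally show "(\<Sum>j. \<bar>\<theta> (Suc j)\<bar>) \<le> (R + A_const p) / 2" .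
qed

definition log_bound :: "nat \<Rightarrow> real \<Rightarrow> real" where
  "log_bound p R = sqrt 2 * ((R + A_const p) / 2)"

lemma abs_log_dens_le:
  assumes "p \<ge> 1" "\<theta> \<in> sobolev_ellipsoid p R"
  shows "\<bar>log_dens \<theta> x\<bar> \<le> log_bound p R"
proof -
  have "\<bar>log_dens \<theta> x\<bar> \<le> sqrt 2 * (\<Sum>j. \<bar>\<theta> (Suc j)\<bar>)"
    unfolding log_dens_def by (rule log_dens_summable(2)[OF ellipsoid_abs_summable(1)[OF assms]])
  also have "\<dots> \<le> log_bound p R"
    unfolding log_bound_def using ellipsoid_abs_summable(2)[OF assms] by (intro mult_left_mono) auto
  finally show ?thesis .
qed

lemma dens_dist2_le:
  assumes p: "p \<ge> 1" and \<theta>: "\<theta> \<in> sobolev_ellipsoid p R" and \<theta>': "\<theta>' \<in> sobolev_ellipsoid p R"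
  shows "(\<integral>x. (dens \<theta> x - dens \<theta>' x)\<^sup>2 \<partial>unif)
    \<le> 4 * exp (8 * log_bound p R) * (\<Sum>j. (\<theta> (Suc j) - \<theta>' (Suc j))\<^sup>2)"
proof -
  note s = ellipsoid_abs_summable(1)[OF p \<theta>] ellipsoid_abs_summable(1)[OF p \<theta>']
  define d where "d j = \<theta> j - \<theta>' j" for j
  have "log_dens \<theta> x - log_dens \<theta>' x = log_dens d x" for x
    unfolding log_dens_def d_def
    using suminf_diff[OF log_dens_summable(1)[of \<theta> x, OF s(1)] log_dens_summable(1)[of \<theta>' x, OF s(2)]] by (simp add: algebra_simps)
  then have "(\<integral>x. (dens \<theta> x - dens \<theta>' x)\<^sup>2 \<partial>unif) \<le> 4 * exp (8 * log_bound p R) * (\<integral>x. (log_dens d x)\<^sup>2 \<partial>unif)"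
    unfolding dens_eq_gibbs
    using unif.gibbs_dist2_le[of "log_dens \<theta>" "log_bound p R" "log_dens \<theta>'"] abs_log_dens_le[OF p \<theta>] abs_log_dens_le[OF p \<theta>']
    by simp
  also have "\<dots> \<le> 4 * exp (8 * log_bound p R) * (\<Sum>j. (d (Suc j))\<^sup>2)"
  proof (intro mult_left_mono integral_square_log_dens_le)
    show "summable (\<lambda>j. \<bar>d (Suc j)\<bar>)"
      by (rule summable_comparison_test'[OF summable_add[OF s], where N = 0]) (auto simp: d_def)
    have "summable (\<lambda>j. 2 * (\<theta> (Suc j))\<^sup>2 + 2 * (- \<theta>' (Suc j))\<^sup>2)"
      using ellipsoid_Suc(1)[OF \<theta>] ellipsoid_Suc(1)[OF \<theta>']
      by (intro summable_add summable_mult) simp_all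
    then show "summable (\<lambda>j. (d (Suc j))\<^sup>2)"
      by (rule summable_comparison_test'[where N = 0]) (use square_add_le[of "\<theta> (Suc _)" "- \<theta>' (Suc _)"] in \<open>auto simp: d_def\<close>)
  qed auto
  finally show ?thesis by (simp add: d_def)
qed

lemma sobolev_tail_le:
  assumes s: "summable (\<lambda>j. real (freq (Suc j)) ^ (2 * p) * (d (Suc j))\<^sup>2)"
    and le: "(\<Sum>j. real (freq (Suc j)) ^ (2 * p) * (d (Suc j))\<^sup>2) \<le> T" and "1 \<le> N"
  shows "summable (\<lambda>j. (d (Suc j))\<^sup>2)"
    and "(\<Sum>j. (d (Suc j))\<^sup>2) \<le> (\<Sum>j<N. (d (Suc j))\<^sup>2) + T / real N ^ (2 * p)"
proof -
  let ?g = "\<lambda>j. real (freq (Suc j)) ^ (2 * p) * (d (Suc j))\<^sup>2"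
  have 1: "(d (Suc j))\<^sup>2 \<le> ?g j" for j
  proof -
    have "1 * (d (Suc j))\<^sup>2 \<le> ?g j" using freq_Suc_pos[of j] by (intro mult_right_mono one_le_power) auto
    then show ?thesis by simp
  qed
  show sd: "summable (\<lambda>j. (d (Suc j))\<^sup>2)"
    by (rule summable_comparison_test'[OF s, where N = 0]) (use 1 in auto)
  have sN: "summable (\<lambda>j. ?g (j + N) / real N ^ (2 * p))"
    using s by (intro summable_divide) (rule summable_ignore_initial_segment)
  have "(\<Sum>j. (d (Suc (j + N)))\<^sup>2) \<le> (\<Sum>j. ?g (j + N) / real N ^ (2 * p))"
  proof (rule suminf_le[OF _ _ sN])
    fix j
    have "real N ^ (2 * p) * (d (Suc (j + N)))\<^sup>2 \<le> ?g (j + N)"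
      using freq_bounds(1)[of "Suc (j + N)"] by (intro mult_right_mono power_mono) auto
    then show "(d (Suc (j + N)))\<^sup>2 \<le> ?g (j + N) / real N ^ (2 * p)"
      using \<open>1 \<le> N\<close> by (simp add: field_simps)
    show "summable (\<lambda>j. (d (Suc (j + N)))\<^sup>2)" using summable_ignore_initial_segment[OF sd, of N] by simp
  qed
  also have "\<dots> = (\<Sum>j. ?g (j + N)) / real N ^ (2 * p)"
    by (rule suminf_divide[OF summable_ignore_initial_segment[OF s]])
  also have "\<dots> \<le> T / real N ^ (2 * p)"
  proof (intro divide_right_mono)
    have "(\<Sum>j. ?g (j + N)) \<le> (\<Sum>j. ?g j)"
      unfolding suminf_split_initial_segment[OF s, of N] by (simp add: sum_nonneg)
    then show "(\<Sum>j. ?g (j + N)) \<le> T" using le by simp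
  qed simp
  finally show "(\<Sum>j. (d (Suc j))\<^sup>2) \<le> (\<Sum>j<N. (d (Suc j))\<^sup>2) + T / real N ^ (2 * p)"
    unfolding suminf_split_initial_segment[OF sd, of N] by simp
qed

section \<open>Metric entropy of the ellipsoid\<close>

text \<open>The mesh is chosen so that errors of this size in \<open>N\<close> coordinates add up to \<open>1 / N ^ (2 * p)\<close>, which is also
  the order of the squared norm of the tail of a point in the ellipsoid.\<close>

definition mesh :: "nat \<Rightarrow> nat \<Rightarrow> real" where
  "mesh p N = 1 / (real N ^ p * sqrt (real N))"

lemma mesh_square: "1 \<le> N \<Longrightarrow> (mesh p N)\<^sup>2 = 1 / (real N ^ (2 * p) * real N)"
  by (simp add: mesh_def power_divide power_mult_distrib power_mult[symmetric] mult.commute[of p])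

lemma mesh_pos: "1 \<le> N \<Longrightarrow> 0 < mesh p N"
  by (simp add: mesh_def)

definition cell :: "nat \<Rightarrow> nat \<Rightarrow> (nat \<Rightarrow> real) \<Rightarrow> nat \<Rightarrow> int" where
  "cell p N \<theta> = (\<lambda>j\<in>{..<N}. \<lfloor>\<theta> (Suc j) / mesh p N\<rfloor>)"

lemma ellipsoid_dist_le:
  assumes \<theta>: "\<theta> \<in> sobolev_ellipsoid p R" and \<theta>': "\<theta>' \<in> sobolev_ellipsoid p R" and N: "1 \<le> N"
    and head: "\<And>j. j < N \<Longrightarrow> \<bar>\<theta> (Suc j) - \<theta>' (Suc j)\<bar> \<le> a * mesh p N"
  shows "(\<Sum>j. (\<theta> (Suc j) - \<theta>' (Suc j))\<^sup>2) \<le> (a\<^sup>2 + 4 * R) / real N ^ (2 * p)"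
proof -
  let ?w = "\<lambda>j. real (freq (Suc j)) ^ (2 * p)"
  define d where "d j = \<theta> j - \<theta>' j" for j
  note s1 = ellipsoid_Suc(2)[OF \<theta>] ellipsoid_Suc(2)[OF \<theta>'] and tot = ellipsoid_Suc(3)[OF \<theta>] ellipsoid_Suc(3)[OF \<theta>']
  have s2: "summable (\<lambda>j. 2 * (?w j * (\<theta> (Suc j))\<^sup>2) + 2 * (?w j * (\<theta>' (Suc j))\<^sup>2))"
    using s1 by (intro summable_add summable_mult)
  have le: "?w j * (d (Suc j))\<^sup>2 \<le> 2 * (?w j * (\<theta> (Suc j))\<^sup>2) + 2 * (?w j * (\<theta>' (Suc j))\<^sup>2)" for j
  proof -
    have "?w j * (d (Suc j))\<^sup>2 \<le> ?w j * (2 * (\<theta> (Suc j))\<^sup>2 + 2 * (- \<theta>' (Suc j))\<^sup>2)"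
      unfolding d_def using square_add_le[of "\<theta> (Suc j)" "- \<theta>' (Suc j)"] by (intro mult_left_mono) auto
    then show ?thesis by (simp add: algebra_simps)
  qed
  have s3: "summable (\<lambda>j. ?w j * (d (Suc j))\<^sup>2)"
    by (rule summable_comparison_test'[OF s2, where N = 0]) (use le in simp)
  have "(\<Sum>j. ?w j * (d (Suc j))\<^sup>2) \<le> (\<Sum>j. 2 * (?w j * (\<theta> (Suc j))\<^sup>2) + 2 * (?w j * (\<theta>' (Suc j))\<^sup>2))"
    by (rule suminf_le[OF le s3 s2])
  also have "\<dots> = 2 * (\<Sum>j. ?w j * (\<theta> (Suc j))\<^sup>2) + 2 * (\<Sum>j. ?w j * (\<theta>' (Suc j))\<^sup>2)"
    using s1 by (simp add: suminf_add[symmetric] suminf_mult summable_mult)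
  also have "\<dots> \<le> 4 * R" using tot by simp
  finally have "(\<Sum>j. (d (Suc j))\<^sup>2) \<le> (\<Sum>j<N. (d (Suc j))\<^sup>2) + 4 * R / real N ^ (2 * p)"
    using sobolev_tail_le(2)[OF s3 _ N] by simp
  also have "(\<Sum>j<N. (d (Suc j))\<^sup>2) \<le> (\<Sum>j<N. (a * mesh p N)\<^sup>2)"
  proof (rule sum_mono)
    fix j assume "j \<in> {..<N}"
    then have "\<bar>d (Suc j)\<bar> \<le> a * mesh p N" using head by (simp add: d_def)
    from power_mono[OF this, of 2] show "(d (Suc j))\<^sup>2 \<le> (a * mesh p N)\<^sup>2" by simp
  qed
  also have "(\<Sum>j<N. (a * mesh p N)\<^sup>2) = a\<^sup>2 / real N ^ (2 * p)"
    using N by (simp add: mesh_square power_mult_distrib)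
  finally show ?thesis by (simp add: d_def add_divide_distrib)
qed

lemma cell_diameter:
  assumes \<theta>: "\<theta> \<in> sobolev_ellipsoid p R" and \<theta>': "\<theta>' \<in> sobolev_ellipsoid p R" and N: "1 \<le> N"
    and eq: "cell p N \<theta> = cell p N \<theta>'"
  shows "(\<Sum>j. (\<theta> (Suc j) - \<theta>' (Suc j))\<^sup>2) \<le> (1\<^sup>2 + 4 * R) / real N ^ (2 * p)"
proof (rule ellipsoid_dist_le[OF \<theta> \<theta>' N])
  fix j assume "j < N"
  then have "\<lfloor>\<theta> (Suc j) / mesh p N\<rfloor> = \<lfloor>\<theta>' (Suc j) / mesh p N\<rfloor>"
    using fun_cong[OF eq, of j] by (simp add: cell_def)
  then have "\<bar>\<theta> (Suc j) / mesh p N - \<theta>' (Suc j) / mesh p N\<bar> \<le> 1" by linarith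
  then show "\<bar>\<theta> (Suc j) - \<theta>' (Suc j)\<bar> \<le> 1 * mesh p N"
    using mesh_pos[OF N, of p] by (simp add: field_simps abs_le_iff)
qed

lemma power_le_fact_exp:
  fixes x :: real
  assumes "0 \<le> x"
  shows "x ^ n \<le> fact n * exp x"
proof -
  have "x ^ n /\<^sub>R fact n \<le> (\<Sum>k. x ^ k /\<^sub>R fact k)"
    using assms sum_le_suminf[OF summable_exp_generic[of x], of "{n}"] by simp
  then show ?thesis by (simp add: exp_def field_simps)
qed

lemma prod_inverse_ratio_le:
  assumes "1 \<le> N"
  shows "(\<Prod>j<N. real N / real (Suc j)) \<le> exp (real N)"
proof -
  have "(\<Prod>j<N. real N / real (Suc j)) = real N ^ N / fact N"
    by (simp add: prod_dividef fact_prod_Suc of_nat_prod atLeast0LessThan)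
  also have "\<dots> \<le> exp (real N)" using power_le_fact_exp[of "real N" N] by (simp add: divide_le_eq mult.commute)
  finally show ?thesis .
qed

lemma sum_gauss_int_le:
  fixes s :: real
  assumes "0 < s"
  shows "(\<Sum>k=-int M..int M. exp (- (s\<^sup>2 * (of_int k)\<^sup>2))) \<le> 2 * exp 1 * (1 + 1 / s)"
proof -
  define g where "g k = exp (- (s\<^sup>2 * (real_of_int k)\<^sup>2))" for k
  define q where "q = exp (- (2 * s))"
  have q: "0 < q" "q < 1" using assms by (auto simp: q_def)
  \<comment> \<open>A geometric series dominates the Gaussian one, as \<open>2 * s * k \<le> s\<^sup>2 * k\<^sup>2 + 1\<close>.\<close>
  have gk: "g (int k) \<le> exp 1 * q ^ k" "g (- int k) \<le> exp 1 * q ^ k" for k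
  proof -
    have "2 * (s * real k) * 1 \<le> (s * real k)\<^sup>2 + 1\<^sup>2" by (rule sum_squares_bound)
    then have "- (s\<^sup>2 * (real k)\<^sup>2) \<le> 1 + real k * - (2 * s)" by (simp add: power_mult_distrib algebra_simps)
    then have "exp (- (s\<^sup>2 * (real k)\<^sup>2)) \<le> exp (1 + real k * - (2 * s))" by simp
    also have "\<dots> = exp 1 * q ^ k" unfolding q_def exp_add exp_of_nat_mult ..
    finally show "g (int k) \<le> exp 1 * q ^ k" "g (- int k) \<le> exp 1 * q ^ k" by (auto simp: g_def)
  qed
  let ?A = "int ` {..M}" and ?B = "(\<lambda>k. - int k) ` {..M}"
  have sub: "{-int M..int M} \<subseteq> ?A \<union> ?B"
  proof
    fix k assume k: "k \<in> {-int M..int M}"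
    show "k \<in> ?A \<union> ?B"
    proof (cases "0 \<le> k")
      case True
      then have "k = int (nat k)" "nat k \<le> M" using k by auto
      then show ?thesis by blast
    next
      case False
      then have "k = - int (nat (- k))" "nat (- k) \<le> M" using k by auto
      then show ?thesis by blast
    qed
  qed
  have "(\<Sum>k=-int M..int M. g k) \<le> sum g (?A \<union> ?B)"
    using sub by (intro sum_mono2) (auto simp: g_def)
  also have "\<dots> \<le> sum g ?A + sum g ?B"
  proof -
    have "sum g (?A \<union> ?B) + sum g (?A \<inter> ?B) = sum g ?A + sum g ?B" by (rule sum.union_inter) auto
    moreover have "0 \<le> sum g (?A \<inter> ?B)" by (intro sum_nonneg) (simp add: g_def)
    ultimately show ?thesis by linarith
  qed
  also have "sum g ?A = (\<Sum>k\<le>M. g (int k))" by (subst sum.reindex) auto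
  also have "sum g ?B = (\<Sum>k\<le>M. g (- int k))" by (subst sum.reindex) (auto simp: inj_on_def)
  also have "(\<Sum>k\<le>M. g (int k)) + (\<Sum>k\<le>M. g (- int k)) \<le> (\<Sum>k\<le>M. exp 1 * q ^ k) + (\<Sum>k\<le>M. exp 1 * q ^ k)"
    by (intro add_mono sum_mono gk)
  also have "\<dots> = 2 * exp 1 * (\<Sum>k\<le>M. q ^ k)" by (simp add: sum_distrib_left mult.assoc)
  also have "(\<Sum>k\<le>M. q ^ k) \<le> (\<Sum>k. q ^ k)"
    using q by (intro sum_le_suminf summable_geometric) auto
  also have "(\<Sum>k. q ^ k) = 1 / (1 - q)" using q by (intro suminf_geometric) auto
  also have "1 / (1 - q) \<le> 1 + 1 / s"
  proof -
    have "1 + s \<le> exp s" by (rule exp_ge_add_one_self)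
    also have "exp s \<le> exp (2 * s)" using assms by simp
    finally have "1 + s \<le> 1 / q" by (simp add: q_def exp_minus field_simps)
    then have "q * (1 + s) \<le> 1" using q by (simp add: field_simps)
    then have "s \<le> (1 + s) * (1 - q)" by (simp add: algebra_simps)
    then have "s / (1 - q) \<le> 1 + s" using q by (simp add: divide_le_eq)
    then have "s / (1 - q) / s \<le> (1 + s) / s" using assms by (intro divide_right_mono) auto
    then show ?thesis using assms by (simp add: add_divide_distrib)
  qed
  finally show ?thesis by (simp add: g_def)
qed

text \<open>Rankin's trick: every lattice point of the ellipsoid contributes at least 1 to
  \<open>exp T * (\<Sum>k. exp (- \<Sum>j. (s j * k j)\<^sup>2))\<close>, and this sum over all lattice points
  factorises. Counting coordinatewise would lose a logarithmic factor in the exponent.\<close>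

lemma lattice_points_le:
  fixes s :: "nat \<Rightarrow> real" and T L :: real
  assumes L: "0 < L" "\<And>j. j < N \<Longrightarrow> L \<le> (s j)\<^sup>2" and s: "\<And>j. j < N \<Longrightarrow> 0 < s j"
  defines "G \<equiv> {k \<in> {..<N} \<rightarrow>\<^sub>E (UNIV :: int set). (\<Sum>j<N. (s j)\<^sup>2 * (of_int (k j))\<^sup>2) \<le> T}"
  shows "finite G" and "real (card G) \<le> exp T * (\<Prod>j<N. 2 * exp 1 * (1 + 1 / s j))"
proof -
  define M where "M = nat \<lceil>T / L\<rceil>"
  define P where "P = {..<N} \<rightarrow>\<^sub>E {-int M..int M}"
  have finP: "finite P" unfolding P_def by (intro finite_PiE) auto
  have sub: "G \<subseteq> P"
  proof
    fix k assume k: "k \<in> G"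
    have "k j \<in> {-int M..int M}" if j: "j < N" for j
    proof -
      have "L * (of_int (k j))\<^sup>2 \<le> (s j)\<^sup>2 * (of_int (k j))\<^sup>2" using L(2)[OF j] by (intro mult_right_mono) auto
      also have "\<dots> \<le> (\<Sum>j<N. (s j)\<^sup>2 * (of_int (k j))\<^sup>2)" using j by (intro member_le_sum) auto
      also have "\<dots> \<le> T" using k by (simp add: G_def)
      finally have le: "(real_of_int (k j))\<^sup>2 \<le> T / L" using L(1) by (simp add: field_simps)
      have "\<bar>k j\<bar> \<le> (k j)\<^sup>2"
        using self_le_power[of "\<bar>k j\<bar>" 2] by (cases "k j = 0") auto
      then have "real_of_int \<bar>k j\<bar> \<le> (real_of_int (k j))\<^sup>2" by (metis of_int_le_iff of_int_power)
      then have "real_of_int \<bar>k j\<bar> \<le> T / L" using le by linarith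
      then have "\<bar>k j\<bar> \<le> \<lceil>T / L\<rceil>" using le_of_int_ceiling[of "T / L"] by linarith
      moreover have "\<lceil>T / L\<rceil> \<le> int M" unfolding M_def by arith
      ultimately have "\<bar>k j\<bar> \<le> int M" by (rule order_trans)
      then show ?thesis by auto
    qed
    then show "k \<in> P" using k by (auto simp: G_def P_def PiE_def Pi_def)
  qed
  show "finite G" using finite_subset[OF sub finP] .
  have "real (card G) = (\<Sum>k\<in>G. 1)" by simp
  also have "\<dots> \<le> (\<Sum>k\<in>G. exp (T - (\<Sum>j<N. (s j)\<^sup>2 * (of_int (k j))\<^sup>2)))"
    by (intro sum_mono) (auto simp: G_def)
  also have "\<dots> \<le> (\<Sum>k\<in>P. exp (T - (\<Sum>j<N. (s j)\<^sup>2 * (of_int (k j))\<^sup>2)))"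
    by (intro sum_mono2 finP sub) auto
  also have "\<dots> = exp T * (\<Sum>k\<in>P. \<Prod>j<N. exp (- ((s j)\<^sup>2 * (of_int (k j))\<^sup>2)))"
  proof -
    have "exp (T - (\<Sum>j<N. (s j)\<^sup>2 * (of_int (k j))\<^sup>2)) = exp T * (\<Prod>j<N. exp (- ((s j)\<^sup>2 * (of_int (k j))\<^sup>2)))" for k
    proof -
      have "T - (\<Sum>j<N. (s j)\<^sup>2 * (of_int (k j))\<^sup>2) = T + (\<Sum>j<N. - ((s j)\<^sup>2 * (of_int (k j))\<^sup>2))"
        by (simp add: sum_negf)
      then show ?thesis by (simp only: exp_add exp_sum finite_lessThan)
    qed
    then show ?thesis by (simp only: sum_distrib_left)
  qed
  also have "(\<Sum>k\<in>P. \<Prod>j<N. exp (- ((s j)\<^sup>2 * (of_int (k j))\<^sup>2))) =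
      (\<Prod>j<N. \<Sum>k=-int M..int M. exp (- ((s j)\<^sup>2 * (of_int k)\<^sup>2)))"
    unfolding P_def by (rule prod_sum_PiE[symmetric]) auto
  also have "\<dots> \<le> (\<Prod>j<N. 2 * exp 1 * (1 + 1 / s j))"
    using sum_gauss_int_le s by (intro prod_mono) (auto intro: sum_nonneg)
  finally show "real (card G) \<le> exp T * (\<Prod>j<N. 2 * exp 1 * (1 + 1 / s j))" by simp
qed

definition entropy_const :: "nat \<Rightarrow> real \<Rightarrow> real" where
  "entropy_const p R = 2 * R + 2 * 4 ^ p + 3 + real p"

text \<open>Coordinate \<open>j\<close> of the ellipsoid is about \<open>(N / j) ^ p * sqrt N\<close> mesh widths long. The exponential weights of
  \<open>lattice_points_le\<close> remove the factor \<open>sqrt N\<close>, and the remaining product of \<open>(N / j) ^ p\<close> over \<open>j \<le> N\<close> is at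
  most \<open>exp (p * N)\<close>, because \<open>N ^ N \<le> N! * exp N\<close>.\<close>

lemma cell_count:
  assumes "1 \<le> N"
  shows "finite (cell p N ` sobolev_ellipsoid p R)"
    and "real (card (cell p N ` sobolev_ellipsoid p R)) \<le> exp (entropy_const p R * real N)"
proof -
  define s where "s j = (real (freq (Suc j)) / real N) ^ p" for j
  define T where "T = (2 * R + 2 * 4 ^ p) * real N"
  define L where "L = (1 / real N ^ p)\<^sup>2"
  define G where "G = {k \<in> {..<N} \<rightarrow>\<^sub>E (UNIV :: int set). (\<Sum>j<N. (s j)\<^sup>2 * (of_int (k j))\<^sup>2) \<le> T}"
  have spos: "0 < s j" for j using freq_Suc_pos[of j] assms by (simp add: s_def)
  have L0: "0 < L" using assms by (simp add: L_def)
  have sL: "L \<le> (s j)\<^sup>2" for j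
    unfolding L_def s_def power_divide[symmetric] using freq_Suc_pos[of j] assms
    by (intro power_mono) (auto simp: power_divide divide_right_mono)
  have s2: "(s j)\<^sup>2 = real (freq (Suc j)) ^ (2 * p) / real N ^ (2 * p)" for j
    by (simp add: s_def power_divide power_mult[symmetric] mult.commute[of p])
  have sub: "cell p N ` sobolev_ellipsoid p R \<subseteq> G"
  proof (rule image_subsetI)
    fix \<theta> assume \<theta>: "\<theta> \<in> sobolev_ellipsoid p R"
    have "(\<Sum>j<N. (s j)\<^sup>2 * (of_int (cell p N \<theta> j))\<^sup>2) \<le>
        (\<Sum>j<N. 2 * (real (freq (Suc j)) ^ (2 * p) * (\<theta> (Suc j))\<^sup>2) * real N + 2 * 4 ^ p)"
    proof (rule sum_mono)
      fix j assume j: "j \<in> {..<N}"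
      define y where "y = \<theta> (Suc j) / mesh p N"
      have "cell p N \<theta> j = \<lfloor>y\<rfloor>" using j by (simp add: cell_def y_def)
      then have "\<bar>of_int (cell p N \<theta> j)\<bar> \<le> \<bar>y\<bar> + 1" by linarith
      from power_mono[OF this, of 2] have "(of_int (cell p N \<theta> j))\<^sup>2 \<le> (\<bar>y\<bar> + 1)\<^sup>2" by simp
      also have "\<dots> \<le> 2 * y\<^sup>2 + 2" using square_add_le[of "\<bar>y\<bar>" 1] by simp
      finally have "(s j)\<^sup>2 * (of_int (cell p N \<theta> j))\<^sup>2 \<le> (s j)\<^sup>2 * (2 * y\<^sup>2 + 2)"
        by (intro mult_left_mono) auto
      also have "\<dots> = 2 * ((s j)\<^sup>2 * y\<^sup>2) + 2 * (s j)\<^sup>2" by (simp add: algebra_simps)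
      also have "(s j)\<^sup>2 * y\<^sup>2 = real (freq (Suc j)) ^ (2 * p) * (\<theta> (Suc j))\<^sup>2 * real N"
        using assms by (simp add: s2 y_def power_divide mesh_square)
      also have "(s j)\<^sup>2 \<le> 4 ^ p"
      proof -
        have "s j \<le> 2 ^ p" unfolding s_def
          using j freq_bounds(2)[of "Suc j"] assms by (intro power_mono) (auto simp: divide_le_eq)
        from power_mono[OF this, of 2] spos[of j] show ?thesis
          by (simp add: power_mult[symmetric] mult.commute[of p] less_imp_le) (simp add: power_mult)
      qed
      finally show "(s j)\<^sup>2 * (of_int (cell p N \<theta> j))\<^sup>2 \<le> 2 * (real (freq (Suc j)) ^ (2 * p) * (\<theta> (Suc j))\<^sup>2) * real N + 2 * 4 ^ p"
        by simp
    qed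
    also have "\<dots> = 2 * real N * (\<Sum>j<N. real (freq (Suc j)) ^ (2 * p) * (\<theta> (Suc j))\<^sup>2) + 2 * 4 ^ p * real N"
      by (simp add: sum.distrib sum_distrib_left mult_ac)
    also have "\<dots> \<le> 2 * real N * R + 2 * 4 ^ p * real N"
      by (intro add_right_mono mult_left_mono ellipsoid_partial_sum_le[OF \<theta>]) auto
    also have "\<dots> = T" by (simp add: T_def algebra_simps)
    finally show "cell p N \<theta> \<in> G" by (auto simp: G_def cell_def)
  qed
  have count: "finite G" "real (card G) \<le> exp T * (\<Prod>j<N. 2 * exp 1 * (1 + 1 / s j))"
    unfolding G_def using lattice_points_le[where s = s and N = N and L = L and T = T] L0 sL spos by auto
  show "finite (cell p N ` sobolev_ellipsoid p R)" using finite_subset[OF sub count(1)] .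
  have "real (card (cell p N ` sobolev_ellipsoid p R)) \<le> real (card G)"
    using card_mono[OF count(1) sub] by simp
  also note count(2)
  also have "(\<Prod>j<N. 2 * exp 1 * (1 + 1 / s j)) \<le> (\<Prod>j<N. exp 3 * (real N / real (Suc j)) ^ p)"
  proof (rule prod_mono, intro conjI)
    fix j assume j: "j \<in> {..<N}"
    show "0 \<le> 2 * exp 1 * (1 + 1 / s j)" using spos[of j] by (simp add: add_nonneg_nonneg)
    define r where "r = (real N / real (Suc j)) ^ p"
    have r1: "1 \<le> r" unfolding r_def using j by (intro one_le_power) auto
    have "(real (Suc j) / real N) ^ p \<le> s j" unfolding s_def
      using freq_bounds(1)[of "Suc j"] by (intro power_mono divide_right_mono) auto
    then have "1 / s j \<le> 1 / (real (Suc j) / real N) ^ p"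
      using assms by (intro divide_left_mono) (auto simp: spos)
    also have "\<dots> = r" using assms by (simp add: r_def power_divide)
    finally have "1 + 1 / s j \<le> 2 * r" using r1 by simp
    then have "2 * exp 1 * (1 + 1 / s j) \<le> 2 * exp 1 * (2 * r)" by (intro mult_left_mono) auto
    also have "\<dots> = (2 * 2) * exp 1 * r" by simp
    also have "\<dots> \<le> (exp 1 * exp 1) * exp 1 * r"
      using exp_ge_add_one_self[of 1] r1 by (intro mult_right_mono mult_mono) auto
    also have "exp 1 * exp 1 * exp 1 = exp (3 :: real)" by (simp flip: exp_add)
    finally show "2 * exp 1 * (1 + 1 / s j) \<le> exp 3 * (real N / real (Suc j)) ^ p" by (simp add: r_def)
  qed
  also have "\<dots> = exp 3 ^ N * (\<Prod>j<N. real N / real (Suc j)) ^ p"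
    by (simp add: prod.distrib prod_power_distrib)
  also have "\<dots> \<le> exp 3 ^ N * exp (real N) ^ p"
    using prod_inverse_ratio_le[OF assms] by (intro mult_left_mono power_mono) (auto intro: prod_nonneg)
  also have "exp T * (exp 3 ^ N * exp (real N) ^ p) = exp (entropy_const p R * real N)"
  proof -
    have "exp 3 ^ N = exp (real N * 3)" "exp (real N) ^ p = exp (real p * real N)"
      by (simp_all only: exp_of_nat_mult)
    moreover have "T + (real N * 3 + real p * real N) = entropy_const p R * real N"
      by (simp add: T_def entropy_const_def algebra_simps)
    ultimately show ?thesis by (simp only: exp_add[symmetric])
  qed
  finally show "real (card (cell p N ` sobolev_ellipsoid p R)) \<le> exp (entropy_const p R * real N)"
    by simp
qed

section \<open>Prior mass of neighbourhoods\<close>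

lemma (in product_prob_space) nn_integral_finite_coordinates:
  assumes "finite J" "J \<subseteq> I" and [measurable]: "\<And>j. j \<in> J \<Longrightarrow> g j \<in> borel_measurable (M j)"
  shows "(\<integral>\<^sup>+x. (\<Prod>j\<in>J. g j (x j)) \<partial>PiM I M) = (\<Prod>j\<in>J. \<integral>\<^sup>+y. g j y \<partial>M j)"
proof -
  have "(\<integral>\<^sup>+x. (\<Prod>j\<in>J. g j (x j)) \<partial>PiM I M) = (\<integral>\<^sup>+x. (\<Prod>j\<in>J. g j (restrict x J j)) \<partial>PiM I M)"
    by (intro nn_integral_cong prod.cong) auto
  also have "\<dots> = (\<integral>\<^sup>+x. (\<Prod>j\<in>J. g j (x j)) \<partial>distr (PiM I M) (PiM J M) (\<lambda>x. restrict x J))"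
    using assms(2) by (subst nn_integral_distr) (auto intro!: measurable_restrict_subset)
  also have "\<dots> = (\<integral>\<^sup>+x. (\<Prod>j\<in>J. g j (x j)) \<partial>PiM J M)"
    by (simp add: distr_PiM_restrict_finite[OF assms(1,2)])
  also have "\<dots> = (\<Prod>j\<in>J. \<integral>\<^sup>+y. g j y \<partial>M j)"
    using assms by (intro product_nn_integral_prod) auto
  finally show ?thesis .
qed

lemma prob_space_gaussian: "0 < v \<Longrightarrow> prob_space (gaussian m v)"
  unfolding gaussian_def by (intro prob_space_normal_density) simp

lemma sets_gaussian[simp, measurable_cong]: "sets (gaussian m v) = sets borel"
  and space_gaussian[simp]: "space (gaussian m v) = UNIV"
  by (simp_all add: gaussian_def)

lemma gaussian_second_moment:
  assumes "0 < v"
  shows "(\<integral>\<^sup>+x. ennreal (x\<^sup>2) \<partial>gaussian 0 v) = ennreal v"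
proof -
  have "has_bochner_integral lborel (\<lambda>x. normal_density 0 (sqrt v) x * x\<^sup>2) v"
    using normal_moment_even[of "sqrt v" 0 1] assms by simp
  then have "integrable lborel (\<lambda>x. normal_density 0 (sqrt v) x * x\<^sup>2)" "(\<integral>x. normal_density 0 (sqrt v) x * x\<^sup>2 \<partial>lborel) = v"
    by (auto simp: has_bochner_integral_iff)
  then have "(\<integral>\<^sup>+x. ennreal (normal_density 0 (sqrt v) x * x\<^sup>2) \<partial>lborel) = ennreal v"
    by (subst nn_integral_eq_integral) auto
  then show ?thesis unfolding gaussian_def
    by (subst nn_integral_density) (auto simp: ennreal_mult'')
qed

text \<open>On the interval, \<open>x\<^sup>2 \<le> 2 * (a\<^sup>2 + \<delta>\<^sup>2)\<close>, which bounds the density from below.\<close>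

lemma gaussian_interval_ge:
  assumes "0 < v" "0 \<le> \<delta>"
  shows "ennreal (2 * \<delta> / sqrt (2 * pi * v) * exp (- ((a\<^sup>2 + \<delta>\<^sup>2) / v))) \<le> emeasure (gaussian 0 v) {a - \<delta>..a + \<delta>}"
proof -
  define c where "c = exp (- ((a\<^sup>2 + \<delta>\<^sup>2) / v)) / sqrt (2 * pi * v)"
  have c: "0 \<le> c" using assms by (simp add: c_def)
  have le: "c \<le> normal_density 0 (sqrt v) x" if x: "x \<in> {a - \<delta>..a + \<delta>}" for x
  proof -
    have "\<bar>x - a\<bar> \<le> \<delta>" using x by auto
    from power_mono[OF this, of 2] have "(x - a)\<^sup>2 \<le> \<delta>\<^sup>2" by simp
    then have "x\<^sup>2 \<le> 2 * (a\<^sup>2 + \<delta>\<^sup>2)" using square_add_le[of "x - a" a] by simp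
    then have "x\<^sup>2 / (2 * v) \<le> 2 * (a\<^sup>2 + \<delta>\<^sup>2) / (2 * v)" using assms by (intro divide_right_mono) auto
    also have "2 * (a\<^sup>2 + \<delta>\<^sup>2) / (2 * v) = (a\<^sup>2 + \<delta>\<^sup>2) / v"
      by (rule mult_divide_mult_cancel_left) simp
    finally have "x\<^sup>2 / (2 * v) \<le> (a\<^sup>2 + \<delta>\<^sup>2) / v" .
    then have "c \<le> exp (- (x\<^sup>2 / (2 * v))) / sqrt (2 * pi * v)"
      unfolding c_def using assms by (intro divide_right_mono) auto
    then show ?thesis using assms by (simp add: normal_density_def)
  qed
  have "ennreal (2 * \<delta> / sqrt (2 * pi * v) * exp (- ((a\<^sup>2 + \<delta>\<^sup>2) / v))) = ennreal c * emeasure lborel {a - \<delta>..a + \<delta>}"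
    using c assms by (simp add: ennreal_mult'[symmetric] c_def mult_ac)
  also have "\<dots> = (\<integral>\<^sup>+x. ennreal c * indicator {a - \<delta>..a + \<delta>} x \<partial>lborel)"
    by (simp add: nn_integral_cmult_indicator)
  also have "\<dots> \<le> (\<integral>\<^sup>+x. ennreal (normal_density 0 (sqrt v) x) * indicator {a - \<delta>..a + \<delta>} x \<partial>lborel)"
    using le by (intro nn_integral_mono) (auto simp: indicator_def intro: ennreal_leI)
  also have "\<dots> = emeasure (gaussian 0 v) {a - \<delta>..a + \<delta>}"
    unfolding gaussian_def by (subst emeasure_density) auto
  finally show ?thesis .
qed

text \<open>Markov's inequality on the event \<open>H\<close>: as \<open>H\<close> only involves coordinates that do not occur in the
  series, conditioning on it leaves the mean of the series unchanged.\<close>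

lemma (in product_prob_space) rectangle_and_small_series:
  fixes \<kappa> :: "nat \<Rightarrow> 'i"
  assumes J: "finite J" "J \<subseteq> I" and \<kappa>: "\<And>j. \<kappa> j \<in> I - J"
    and A[measurable]: "\<And>j. j \<in> J \<Longrightarrow> A j \<in> sets (M j)"
    and g[measurable]: "\<And>j. g j \<in> borel_measurable (M (\<kappa> j))"
    and small: "(\<Sum>j. \<integral>\<^sup>+y. g j y \<partial>M (\<kappa> j)) \<le> ennreal (\<eta> / 2)" and "0 < \<eta>"
  defines "H \<equiv> {x \<in> space (PiM I M). \<forall>j\<in>J. x j \<in> A j}"
  shows "H \<in> sets (PiM I M)"
    and "{x \<in> H. (\<Sum>j. g j (x (\<kappa> j))) < ennreal \<eta>} \<in> sets (PiM I M)"
    and "prob H = (\<Prod>j\<in>J. measure (M j) (A j))"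
    and "prob H / 2 \<le> prob {x \<in> H. (\<Sum>j. g j (x (\<kappa> j))) < ennreal \<eta>}"
proof -
  have \<kappa>I: "\<kappa> j \<in> I" for j using \<kappa> by auto
  have comp[measurable]: "(\<lambda>x. g j (x (\<kappa> j))) \<in> borel_measurable (PiM I M)" for j
    by (rule measurable_compose[OF _ g, where f = "\<lambda>x. x (\<kappa> j)"]) (rule measurable_component_singleton[OF \<kappa>I])
  show H[measurable]: "H \<in> sets (PiM I M)"
  proof -
    have "{x \<in> space (PiM I M). x j \<in> A j} \<in> sets (PiM I M)" if "j \<in> J" for j
      using that J by (intro sets_Collect_single') auto
    then show ?thesis unfolding H_def using J by (intro sets.sets_Collect_finite_All) auto
  qed
  define S where "S x = (\<Sum>j. g j (x (\<kappa> j)))" for x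
  have S[measurable]: "S \<in> borel_measurable (PiM I M)" unfolding S_def by measurable
  have HS: "{x \<in> H. S x < ennreal \<eta>} = H \<inter> {x \<in> space (PiM I M). S x < ennreal \<eta>}"
    by (auto simp: H_def)
  show HSm: "{x \<in> H. (\<Sum>j. g j (x (\<kappa> j))) < ennreal \<eta>} \<in> sets (PiM I M)"
    unfolding S_def[symmetric] HS by measurable
  have indH: "indicator H x = (\<Prod>j\<in>J. indicator (A j) (x j) :: ennreal)" if sp: "x \<in> space (PiM I M)" for x
  proof (cases "x \<in> H")
    case True
    then show ?thesis by (auto simp: H_def intro!: prod.neutral[symmetric])
  next
    case False
    then obtain j where "j \<in> J" "x j \<notin> A j" using sp by (auto simp: H_def)
    then show ?thesis using False J by (auto simp: prod_zero_iff indicator_def intro!: bexI[of _ j])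
  qed
  have eH: "emeasure (PiM I M) H = (\<Prod>j\<in>J. emeasure (M j) (A j))"
  proof -
    have "emeasure (PiM I M) H = (\<integral>\<^sup>+x. indicator H x \<partial>PiM I M)" by simp
    also have "\<dots> = (\<integral>\<^sup>+x. (\<Prod>j\<in>J. indicator (A j) (x j)) \<partial>PiM I M)"
      by (intro nn_integral_cong indH)
    also have "\<dots> = (\<Prod>j\<in>J. emeasure (M j) (A j))"
      using J by (subst nn_integral_finite_coordinates) auto
    finally show ?thesis .
  qed
  show "prob H = (\<Prod>j\<in>J. measure (M j) (A j))"
    using eH by (simp add: emeasure_eq_measure M.emeasure_eq_measure prod_ennreal prod_nonneg)
  have one: "(\<integral>\<^sup>+x. g j (x (\<kappa> j)) * indicator H x \<partial>PiM I M) = (\<integral>\<^sup>+y. g j y \<partial>M (\<kappa> j)) * emeasure (PiM I M) H" for j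
  proof -
    define h where "h i = (if i = \<kappa> j then g j else indicator (A i))" for i
    have hJ: "(\<Prod>i\<in>J. q i (h i)) = (\<Prod>i\<in>J. q i (indicator (A i)))" for q :: "'i \<Rightarrow> _ \<Rightarrow> ennreal"
      using \<kappa>[of j] by (intro prod.cong refl) (auto simp: h_def)
    have "(\<integral>\<^sup>+x. g j (x (\<kappa> j)) * indicator H x \<partial>PiM I M) = (\<integral>\<^sup>+x. (\<Prod>i\<in>insert (\<kappa> j) J. h i (x i)) \<partial>PiM I M)"
    proof (rule nn_integral_cong)
      fix x assume x: "x \<in> space (PiM I M)"
      have "(\<Prod>i\<in>insert (\<kappa> j) J. h i (x i)) = h (\<kappa> j) (x (\<kappa> j)) * (\<Prod>i\<in>J. h i (x i))"
        using J \<kappa>[of j] by (intro prod.insert) auto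
      then show "g j (x (\<kappa> j)) * indicator H x = (\<Prod>i\<in>insert (\<kappa> j) J. h i (x i))"
        using hJ[of "\<lambda>i f. f (x i)"] by (simp add: h_def indH[OF x])
    qed
    also have "\<dots> = (\<Prod>i\<in>insert (\<kappa> j) J. \<integral>\<^sup>+y. h i y \<partial>M i)"
      using J \<kappa>I[of j] by (intro nn_integral_finite_coordinates) (auto simp: h_def)
    also have "\<dots> = (\<integral>\<^sup>+y. h (\<kappa> j) y \<partial>M (\<kappa> j)) * (\<Prod>i\<in>J. \<integral>\<^sup>+y. h i y \<partial>M i)"
      using J \<kappa>[of j] by (intro prod.insert) auto
    also have "\<dots> = (\<integral>\<^sup>+y. g j y \<partial>M (\<kappa> j)) * emeasure (PiM I M) H"
      using hJ[of "\<lambda>i f. \<integral>\<^sup>+y. f y \<partial>M i"] by (simp add: h_def eH)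
    finally show ?thesis .
  qed
  have "(\<integral>\<^sup>+x. S x * indicator H x \<partial>PiM I M) = (\<Sum>j. \<integral>\<^sup>+x. g j (x (\<kappa> j)) * indicator H x \<partial>PiM I M)"
    unfolding S_def ennreal_suminf_multc[symmetric] by (subst nn_integral_suminf) auto
  also have "\<dots> = (\<Sum>j. \<integral>\<^sup>+y. g j y \<partial>M (\<kappa> j)) * emeasure (PiM I M) H"
    unfolding one ennreal_suminf_multc ..
  also have "\<dots> \<le> ennreal (\<eta> / 2) * emeasure (PiM I M) H" by (intro mult_right_mono small) auto
  finally have mean: "(\<integral>\<^sup>+x. S x * indicator H x \<partial>PiM I M) \<le> ennreal (\<eta> / 2) * emeasure (PiM I M) H" .
  have cover: "H \<subseteq> {x \<in> H. S x < ennreal \<eta>} \<union> {x \<in> H. 1 \<le> ennreal (1 / \<eta>) * S x}"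
  proof
    fix x assume x: "x \<in> H"
    show "x \<in> {x \<in> H. S x < ennreal \<eta>} \<union> {x \<in> H. 1 \<le> ennreal (1 / \<eta>) * S x}"
    proof (cases "S x < ennreal \<eta>")
      case False
      then have "ennreal (1 / \<eta>) * ennreal \<eta> \<le> ennreal (1 / \<eta>) * S x" by (intro mult_left_mono) auto
      then show ?thesis using x \<open>0 < \<eta>\<close> by (simp add: ennreal_mult'[symmetric])
    qed (use x in auto)
  qed
  have m2: "{x \<in> H. 1 \<le> ennreal (1 / \<eta>) * S x} \<in> sets (PiM I M)"
  proof -
    have "{x \<in> H. 1 \<le> ennreal (1 / \<eta>) * S x} = H \<inter> {x \<in> space (PiM I M). 1 \<le> ennreal (1 / \<eta>) * S x}"
      by (auto simp: H_def)
    then show ?thesis by (simp only:) measurable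
  qed
  have "emeasure (PiM I M) H \<le> emeasure (PiM I M) ({x \<in> H. S x < ennreal \<eta>} \<union> {x \<in> H. 1 \<le> ennreal (1 / \<eta>) * S x})"
    using HSm m2 cover by (intro emeasure_mono) (auto simp: S_def)
  also have "\<dots> \<le> emeasure (PiM I M) {x \<in> H. S x < ennreal \<eta>} + emeasure (PiM I M) {x \<in> H. 1 \<le> ennreal (1 / \<eta>) * S x}"
    using HSm m2 by (intro emeasure_subadditive) (auto simp: S_def)
  also have "emeasure (PiM I M) {x \<in> H. 1 \<le> ennreal (1 / \<eta>) * S x} \<le> ennreal (1 / \<eta>) * (\<integral>\<^sup>+x. S x * indicator H x \<partial>PiM I M)"
    by (rule nn_integral_Markov_inequality) auto
  also have "\<dots> \<le> ennreal (1 / \<eta>) * (ennreal (\<eta> / 2) * emeasure (PiM I M) H)"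
    by (intro mult_left_mono mean) auto
  also have "\<dots> = ennreal (prob H / 2)"
    using \<open>0 < \<eta>\<close> by (simp add: emeasure_eq_measure ennreal_mult'[symmetric])
  finally have "ennreal (prob H) \<le> ennreal (prob {x \<in> H. S x < ennreal \<eta>} + prob H / 2)"
    by (simp add: emeasure_eq_measure ennreal_plus add.commute)
  then have "prob H \<le> prob {x \<in> H. S x < ennreal \<eta>} + prob H / 2"
    by (subst (asm) ennreal_le_iff) auto
  then show "prob H / 2 \<le> prob {x \<in> H. (\<Sum>j. g j (x (\<kappa> j))) < ennreal \<eta>}" by (simp add: S_def)
qed

lemma ellipsoid_iff_ennreal:
  assumes "0 < R"
  shows "\<theta> \<in> sobolev_ellipsoid p R \<longleftrightarrow> (\<Sum>j. ennreal ((\<theta> j)\<^sup>2)) < top \<and>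
    (\<Sum>j. ennreal (real (freq j) ^ (2 * p) * (\<theta> j)\<^sup>2)) < ennreal R"
proof -
  have eq: "(\<Sum>j. ennreal (f j)) = ennreal (suminf f)" if "summable f" "\<And>j. 0 \<le> f j" for f :: "nat \<Rightarrow> real"
    using that by (intro suminf_ennreal2) auto
  have sum: "summable f" if "(\<Sum>j. ennreal (f j)) < top" "\<And>j. 0 \<le> f j" for f :: "nat \<Rightarrow> real"
    using that by (intro summable_suminf_not_top) auto
  show ?thesis
  proof
    assume \<theta>: "\<theta> \<in> sobolev_ellipsoid p R"
    show "(\<Sum>j. ennreal ((\<theta> j)\<^sup>2)) < top \<and> (\<Sum>j. ennreal (real (freq j) ^ (2 * p) * (\<theta> j)\<^sup>2)) < ennreal R"
      using ellipsoidD[OF \<theta>] assms by (simp add: eq ennreal_lessI)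
  next
    assume *: "(\<Sum>j. ennreal ((\<theta> j)\<^sup>2)) < top \<and> (\<Sum>j. ennreal (real (freq j) ^ (2 * p) * (\<theta> j)\<^sup>2)) < ennreal R"
    have s: "summable (\<lambda>j. (\<theta> j)\<^sup>2)" "summable (\<lambda>j. real (freq j) ^ (2 * p) * (\<theta> j)\<^sup>2)"
      using * by (auto intro!: sum intro: less_trans[OF _ ennreal_less_top])
    then have "ennreal (\<Sum>j. real (freq j) ^ (2 * p) * (\<theta> j)\<^sup>2) < ennreal R"
      using * by (simp add: eq)
    then have "(\<Sum>j. real (freq j) ^ (2 * p) * (\<theta> j)\<^sup>2) < R"
      using s by (subst (asm) ennreal_less_iff) (auto intro: suminf_nonneg)
    then show "\<theta> \<in> sobolev_ellipsoid p R" using s by (simp add: sobolev_ellipsoid_def)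
  qed
qed

lemma sobolev_ellipsoid_measurable:
  assumes sets: "\<And>j. sets (M j) = sets (borel :: real measure)" and "0 < R"
  shows "sobolev_ellipsoid p R \<in> sets (PiM UNIV M)"
proof -
  have sp: "space (PiM UNIV M) = UNIV"
    using sets_eq_imp_space_eq[OF sets] by (simp add: space_PiM PiE_UNIV_domain)
  have [measurable]: "(\<lambda>\<theta>. \<theta> j) \<in> borel_measurable (PiM UNIV M)" for j
    using measurable_component_singleton[of j UNIV M] by (simp add: measurable_cong_sets[OF refl sets])
  have "{\<theta> \<in> space (PiM UNIV M). (\<Sum>j. ennreal ((\<theta> j)\<^sup>2)) < top \<and>
    (\<Sum>j. ennreal (real (freq j) ^ (2 * p) * (\<theta> j)\<^sup>2)) < ennreal R} \<in> sets (PiM UNIV M)"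
    by measurable
  also have "{\<theta> \<in> space (PiM UNIV M). (\<Sum>j. ennreal ((\<theta> j)\<^sup>2)) < top \<and>
    (\<Sum>j. ennreal (real (freq j) ^ (2 * p) * (\<theta> j)\<^sup>2)) < ennreal R} = sobolev_ellipsoid p R"
    using ellipsoid_iff_ennreal[OF \<open>0 < R\<close>] by (auto simp: sp)
  finally show ?thesis .
qed

lemma sets_coord_prior: "sets (coord_prior p Q \<alpha> s n j) = sets borel"
  by (simp add: coord_prior_def)

lemma prob_space_coord_prior: "0 < s \<Longrightarrow> prob_space (coord_prior p Q \<alpha> s n j)"
  unfolding coord_prior_def using freq_bounds(1)[of j]
  by (auto intro!: prob_space_gaussian prob_space_return)

lemma square_add_le_weighted:
  fixes x d t :: real
  assumes "0 < t"
  shows "(x + d)\<^sup>2 \<le> (1 + t) * x\<^sup>2 + (1 + 1 / t) * d\<^sup>2"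
proof -
  have "0 \<le> (t * x - d)\<^sup>2 / t" using assms by simp
  also have "\<dots> = t * x\<^sup>2 - 2 * x * d + d\<^sup>2 / t"
    using assms by (simp add: power2_eq_square field_simps)
  finally show ?thesis by (simp add: power2_sum algebra_simps)
qed

text \<open>The right-hand side is the bound of \<open>gaussian_interval_ge\<close> for one coordinate. Since \<open>\<delta>\<^sup>2 / v\<close> is of the order
  \<open>(i / N) ^ (2 * p + 1)\<close>, the length of the interval costs a power of \<open>i / N\<close> and the shift by \<open>\<theta>\<close> costs a multiple of \<open>N\<close> times the share of the coordinate in the Sobolev norm.\<close>

lemma box_factor_ge:
  fixes s a \<theta> f :: real and p N i :: nat
  assumes "0 < s" "0 < a" and N: "1 \<le> N" and i: "1 \<le> i" "i \<le> N" and f: "real i \<le> f" "f \<le> 2 * real N"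
  defines "v \<equiv> s / f ^ (2 * p + 1)" and "\<delta> \<equiv> a * mesh p N"
  shows "2 * a / sqrt (2 * pi * s) * (real i / real N) ^ (p + 1) *
      exp (- (2 * real N / s * (f ^ (2 * p) * \<theta>\<^sup>2) + 2 * a\<^sup>2 * 4 ^ p / s))
    \<le> 2 * \<delta> / sqrt (2 * pi * v) * exp (- ((\<theta>\<^sup>2 + \<delta>\<^sup>2) / v))"
proof (rule mult_mono)
  have f0: "0 < f" using i f by linarith
  have N0: "0 < real N" using N by simp
  have "2 * \<delta> / sqrt (2 * pi * v) = 2 * a / sqrt (2 * pi * s) * ((f / real N) ^ p * sqrt (f / real N))"
  proof -
    have "sqrt (2 * pi * v) = sqrt (2 * pi * s) / sqrt (f ^ (2 * p + 1))"
      unfolding v_def by (simp add: real_sqrt_divide[symmetric])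
    also have "sqrt (f ^ (2 * p + 1)) = f ^ p * sqrt f"
      using f0 by (intro real_sqrt_unique)
        (simp_all add: power_mult_distrib power_mult[symmetric] mult.commute[of p] less_imp_le)
    finally show ?thesis
      using assms(1) N0 f0 by (simp add: \<delta>_def mesh_def power_divide real_sqrt_divide)
  qed
  moreover have "(real i / real N) ^ (p + 1) \<le> (f / real N) ^ p * sqrt (f / real N)"
  proof -
    have r: "0 \<le> real i / real N" "real i / real N \<le> 1" using i N0 by auto
    have "(real i / real N)\<^sup>2 \<le> (real i / real N) * 1" unfolding power2_eq_square using r by (intro mult_left_mono) auto
    also have "\<dots> \<le> f / real N" using f N0 by (simp add: divide_right_mono)
    finally have "real i / real N \<le> sqrt (f / real N)" by (rule real_le_rsqrt)
    moreover have "(real i / real N) ^ p \<le> (f / real N) ^ p"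
      using f N0 r by (intro power_mono divide_right_mono) auto
    ultimately have "(real i / real N) ^ p * (real i / real N) \<le> (f / real N) ^ p * sqrt (f / real N)"
      using r f0 by (intro mult_mono) auto
    then show ?thesis by (simp add: mult.commute)
  qed
  ultimately show "2 * a / sqrt (2 * pi * s) * (real i / real N) ^ (p + 1) \<le> 2 * \<delta> / sqrt (2 * pi * v)"
    using assms(1,2) by (metis divide_nonneg_nonneg less_imp_le mult_left_mono mult_nonneg_nonneg pi_ge_zero real_sqrt_ge_zero zero_le_numeral)
  have "(\<theta>\<^sup>2 + \<delta>\<^sup>2) / v = f * (f ^ (2 * p) * \<theta>\<^sup>2) / s + a\<^sup>2 * (f * f ^ (2 * p) * (mesh p N)\<^sup>2) / s"
    by (simp add: v_def \<delta>_def power_mult_distrib add_divide_distrib[symmetric] algebra_simps)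
  also have "f * (f ^ (2 * p) * \<theta>\<^sup>2) / s \<le> 2 * real N * (f ^ (2 * p) * \<theta>\<^sup>2) / s"
    using f f0 assms(1) by (intro divide_right_mono mult_right_mono) auto
  also have "a\<^sup>2 * (f * f ^ (2 * p) * (mesh p N)\<^sup>2) / s \<le> a\<^sup>2 * (2 * 4 ^ p) / s"
  proof (intro divide_right_mono mult_left_mono)
    have "f * f ^ (2 * p) * (mesh p N)\<^sup>2 = (f / real N) * (f / real N) ^ (2 * p)"
      using N by (simp add: mesh_square power_divide)
    also have "\<dots> \<le> 2 * 2 ^ (2 * p)"
      using f f0 N0 by (intro mult_mono power_mono) (auto simp: divide_le_eq)
    finally show "f * f ^ (2 * p) * (mesh p N)\<^sup>2 \<le> 2 * 4 ^ p" by (simp add: power_mult)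
  qed (use assms(1) in auto)
  finally have "(\<theta>\<^sup>2 + \<delta>\<^sup>2) / v \<le> 2 * real N / s * (f ^ (2 * p) * \<theta>\<^sup>2) + 2 * a\<^sup>2 * 4 ^ p / s"
    by (simp add: mult_ac)
  then show "exp (- (2 * real N / s * (f ^ (2 * p) * \<theta>\<^sup>2) + 2 * a\<^sup>2 * 4 ^ p / s)) \<le> exp (- ((\<theta>\<^sup>2 + \<delta>\<^sup>2) / v))"
    by simp
  show "0 \<le> 2 * \<delta> / sqrt (2 * pi * v)" using assms(1,2) f0 N0 by (simp add: v_def \<delta>_def mesh_def)
qed simp

text \<open>The set \<open>B\<close> consists of the parameters with the first \<open>N\<close> coordinates in a box of radius \<open>a * mesh p N\<close> around \<open>\<theta>0\<close> and the tail
  small in Sobolev norm. The factors \<open>(i / N) ^ (p + 1)\<close> of \<open>box_factor_ge\<close> multiply to a power of \<open>N! / N ^ N\<close>, so the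
  mass of the box is at least the exponential of a multiple of \<open>- N\<close>, and the small variances beyond the cutoff make the tail
  small with probability at least 1/2. The gap between \<open>Q'\<close> and \<open>Q\<close> leaves room for the radius
  of the box and for the tail, which keeps \<open>B\<close> inside the larger ellipsoid.\<close>

lemma prior_mass:
  fixes p :: nat and Q Q' \<alpha> s :: real
  assumes p: "p \<ge> 1" and "\<alpha> > 1 / 2" and s: "s > 0" and Q': "0 < Q'" "Q' < Q"
  shows "\<exists>K D N0. 0 \<le> K \<and> 0 \<le> D \<and> (\<forall>n \<theta>0. N0 \<le> cutoff p Q n \<longrightarrow> \<theta>0 \<in> sobolev_ellipsoid p Q' \<longrightarrow>
    (\<exists>B \<in> sets (unrestricted_prior p Q \<alpha> s n). B \<subseteq> sobolev_ellipsoid p Q \<and>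
      (\<forall>\<theta>\<in>B. (\<Sum>j. (\<theta>0 (Suc j) - \<theta> (Suc j))\<^sup>2) \<le> D / real (cutoff p Q n) ^ (2 * p)) \<and>
      exp (- K * real (cutoff p Q n)) \<le> measure (unrestricted_prior p Q \<alpha> s n) B))"
proof -
  \<comment> \<open>Of the gap \<open>Q - Q'\<close>, one third is spent on the cross term (\<open>t\<close>), one sixth on the box (\<open>a\<close>) and one third on
    the tail (\<open>\<eta>\<close>).\<close>
  define t where "t = (Q - Q') / (3 * Q')"
  define \<eta> where "\<eta> = (Q - Q') / 3"
  define a where "a = sqrt ((Q - Q') / (6 * 4 ^ p * (1 + 1 / t)))"
  define c where "c = 2 * a / sqrt (2 * pi * s)"
  define K where "K = 1 + (real p + 1) + \<bar>ln c\<bar> + 2 * Q' / s + 2 * a\<^sup>2 * 4 ^ p / s"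
  define D where "D = a\<^sup>2 + 4 * Q"
  have t0: "0 < t" and \<eta>0: "0 < \<eta>" using Q' by (auto simp: t_def \<eta>_def)
  have a0: "0 < a" using Q' t0 by (simp add: a_def add_pos_pos)
  have a2: "(1 + 1 / t) * (a\<^sup>2 * 4 ^ p) = (Q - Q') / 6"
  proof -
    have "z \<noteq> 0 \<Longrightarrow> y = x / (6 * w * z) \<Longrightarrow> w \<noteq> 0 \<Longrightarrow> z * (y * w) = x / 6" for x y z w :: real
      by simp
    moreover have "1 + 1 / t \<noteq> 0" using t0 by (simp add: add_pos_pos add_nonneg_eq_0_iff)
    moreover have "a\<^sup>2 = (Q - Q') / (6 * 4 ^ p * (1 + 1 / t))"
      unfolding a_def using Q' t0 by (intro real_sqrt_pow2 divide_nonneg_nonneg) (auto simp: add_nonneg_nonneg)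
    moreover have "(4::real) ^ p \<noteq> 0" by simp
    ultimately show ?thesis by blast
  qed
  have c0: "0 < c" using a0 s by (simp add: c_def)
  define b where "b k = s * (1 / real k ^ 2)" for k :: nat
  have bs: "summable b" unfolding b_def using inverse_power_summable[of 2, where ?'a = real]
    by (intro summable_mult) (simp add: divide_inverse)
  obtain N1 where N1: "\<And>m. N1 \<le> m \<Longrightarrow> norm (\<Sum>j. b (j + m)) < \<eta> / 2"
    using suminf_exist_split[of "\<eta> / 2" b] \<eta>0 bs by auto
  have K0: "0 \<le> K" using s Q' by (simp add: K_def)
  have D0: "0 \<le> D" using Q' by (simp add: D_def)
  have "\<exists>B \<in> sets (unrestricted_prior p Q \<alpha> s n). B \<subseteq> sobolev_ellipsoid p Q \<and>
      (\<forall>\<theta>\<in>B. (\<Sum>j. (\<theta>0 (Suc j) - \<theta> (Suc j))\<^sup>2) \<le> D / real (cutoff p Q n) ^ (2 * p)) \<and>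
      exp (- K * real (cutoff p Q n)) \<le> measure (unrestricted_prior p Q \<alpha> s n) B"
    if N0: "max 1 N1 \<le> cutoff p Q n" and \<theta>0: "\<theta>0 \<in> sobolev_ellipsoid p Q'" for n \<theta>0
  proof -
    define N where "N = cutoff p Q n"
    have N: "1 \<le> N" "N1 \<le> N" using N0 by (auto simp: N_def)
    define M where "M = coord_prior p Q \<alpha> s n"
    have sM: "sets (M j) = sets borel" for j by (simp add: M_def sets_coord_prior)
    interpret M: product_prob_space M UNIV
      by (auto simp: product_prob_space_def product_prob_space_axioms_def product_sigma_finite_def M_def
          intro: prob_space_coord_prior[OF s] prob_space_imp_sigma_finite)
    define A where "A j = {\<theta>0 j - a * mesh p N..\<theta>0 j + a * mesh p N}" for j
    define g where "g j = (\<lambda>y. ennreal (real (freq (Suc (j + N))) ^ (2 * p) * y\<^sup>2))" for j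
    have gm: "g j \<in> borel_measurable (M (Suc (j + N)))" for j
      unfolding g_def measurable_cong_sets[OF sM refl] by measurable

    have tail: "(\<Sum>j. \<integral>\<^sup>+y. g j y \<partial>M (Suc (j + N))) \<le> ennreal (\<eta> / 2)"
    proof -
      have "(\<integral>\<^sup>+y. g j y \<partial>M (Suc (j + N))) \<le> ennreal (b (j + Suc N))" for j
      proof -
        define f where "f = real (freq (Suc (j + N)))"
        define v where "v = s * f powr (- 2 * (2 * real p + \<alpha>))"
        have f: "real (Suc (j + N)) \<le> f" "1 \<le> f" using freq_bounds(1)[of "Suc (j + N)"] by (auto simp: f_def)
        have v0: "0 < v" using s f by (simp add: v_def)
        have M_eq: "M (Suc (j + N)) = gaussian 0 v"
          by (simp add: M_def coord_prior_def N_def v_def f_def)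
        have "(\<integral>\<^sup>+y. g j y \<partial>M (Suc (j + N))) = (\<integral>\<^sup>+y. ennreal (f ^ (2 * p)) * ennreal (y\<^sup>2) \<partial>gaussian 0 v)"
          unfolding M_eq by (simp add: g_def f_def ennreal_mult')
        also have "\<dots> = ennreal (f ^ (2 * p)) * ennreal v"
          by (subst nn_integral_cmult) (auto simp: gaussian_second_moment[OF v0])
        also have "\<dots> = ennreal (f ^ (2 * p) * v)" using f by (simp add: ennreal_mult')
        also have "f ^ (2 * p) * v = s * f powr (2 * real p - 2 * (2 * real p + \<alpha>))"
        proof -
          have "f ^ (2 * p) = f powr (2 * real p)" using f by (simp flip: powr_realpow)
          then show ?thesis by (simp add: v_def flip: powr_add)
        qed
        also have "\<dots> \<le> s * f powr (- 2)"
          using s f p \<open>\<alpha> > 1 / 2\<close> by (intro mult_left_mono powr_mono) auto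
        also have "f powr (- 2) = 1 / f ^ 2" using f by (simp add: powr_minus_divide)
        also have "s * (1 / f ^ 2) \<le> s * (1 / real (Suc (j + N)) ^ 2)"
          using s f by (intro mult_left_mono divide_left_mono power_mono) auto
        finally show ?thesis by (simp add: b_def ennreal_leI)
      qed
      then have "(\<Sum>j. \<integral>\<^sup>+y. g j y \<partial>M (Suc (j + N))) \<le> (\<Sum>j. ennreal (b (j + Suc N)))"
        by (intro suminf_le) auto
      also have "\<dots> = ennreal (\<Sum>j. b (j + Suc N))"
        using summable_ignore_initial_segment[OF bs, of "Suc N"] s by (intro suminf_ennreal2) (auto simp: b_def)
      also have "\<dots> \<le> ennreal (\<eta> / 2)"
        using N1[of "Suc N"] N by (intro ennreal_leI) auto
      finally show ?thesis .
    qed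
    let ?P = "PiM UNIV M"
    define H where "H = {x \<in> space ?P. \<forall>j\<in>Suc ` {..<N}. x j \<in> A j}"
    define B where "B = {x \<in> H. (\<Sum>j. g j (x (Suc (j + N)))) < ennreal \<eta>}"
    note rect = M.rectangle_and_small_series[of "Suc ` {..<N}" "\<lambda>j. Suc (j + N)" A g \<eta>,
        OF _ _ _ _ gm tail \<eta>0, folded H_def, folded B_def]
    have rect: "B \<in> sets ?P" "M.prob H = (\<Prod>j\<in>Suc ` {..<N}. measure (M j) (A j))" "M.prob H / 2 \<le> M.prob B"
      by (rule rect; auto simp: sM A_def)+

    have B_close: "\<bar>x (Suc j) - \<theta>0 (Suc j)\<bar> \<le> a * mesh p N" if "x \<in> B" "j < N" for x j
    proof -
      have "x (Suc j) \<in> A (Suc j)" using that by (auto simp: B_def H_def)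
      then show ?thesis by (auto simp: A_def)
    qed
    have B_sub: "B \<subseteq> sobolev_ellipsoid p Q"
    proof
      fix x assume x: "x \<in> B"
      define h where "h j = real (freq j) ^ (2 * p) * (x j)\<^sup>2" for j
      have h0: "0 \<le> h j" for j by (simp add: h_def)
      have tl: "(\<Sum>j. ennreal (h (Suc (j + N)))) < ennreal \<eta>" using x by (simp add: B_def g_def h_def)
      have st: "summable (\<lambda>j. h (Suc (j + N)))"
        using tl h0 by (intro summable_suminf_not_top) auto
      then have "(\<Sum>j. ennreal (h (Suc (j + N)))) = ennreal (\<Sum>j. h (Suc (j + N)))"
        using h0 by (intro suminf_ennreal2) auto
      then have tl': "(\<Sum>j. h (Suc (j + N))) < \<eta>"
        using tl by (simp add: ennreal_less_iff suminf_nonneg[OF st h0])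
      have sS: "summable (\<lambda>j. h (Suc j))"
        using st summable_iff_shift[of "\<lambda>j. h (Suc j)" N] by simp
      have sh: "summable h" using sS summable_Suc_iff by blast
      have "(\<Sum>j<N. h (Suc j)) \<le> (\<Sum>j<N. (1 + t) * (real (freq (Suc j)) ^ (2 * p) * (\<theta>0 (Suc j))\<^sup>2) + (1 + 1 / t) * (a\<^sup>2 * 4 ^ p / real N))"
      proof (rule sum_mono)
        fix j assume j: "j \<in> {..<N}"
        define f where "f = real (freq (Suc j))"
        have f: "0 \<le> f" "f \<le> 2 * real N" using freq_bounds(2)[of "Suc j"] j by (auto simp: f_def)
        define d where "d = x (Suc j) - \<theta>0 (Suc j)"
        have "\<bar>d\<bar> \<le> a * mesh p N" unfolding d_def using B_close[OF x] j by simp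
        from power_mono[OF this, of 2] have d: "d\<^sup>2 \<le> a\<^sup>2 * (mesh p N)\<^sup>2" by (simp add: power_mult_distrib)
        have "f ^ (2 * p) * d\<^sup>2 \<le> f ^ (2 * p) * (a\<^sup>2 * (mesh p N)\<^sup>2)" using d f by (intro mult_left_mono) auto
        also have "\<dots> = a\<^sup>2 * (f / real N) ^ (2 * p) / real N" using N by (simp add: mesh_square power_divide)
        also have "\<dots> \<le> a\<^sup>2 * 2 ^ (2 * p) / real N"
          using f N by (intro divide_right_mono mult_left_mono power_mono) (auto simp: divide_le_eq)
        finally have fd: "f ^ (2 * p) * d\<^sup>2 \<le> a\<^sup>2 * 4 ^ p / real N" by (simp add: power_mult)
        have "h (Suc j) = f ^ (2 * p) * (\<theta>0 (Suc j) + d)\<^sup>2" by (simp add: h_def f_def d_def)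
        also have "\<dots> \<le> f ^ (2 * p) * ((1 + t) * (\<theta>0 (Suc j))\<^sup>2 + (1 + 1 / t) * d\<^sup>2)"
          using f by (intro mult_left_mono square_add_le_weighted[OF t0]) auto
        also have "\<dots> = (1 + t) * (f ^ (2 * p) * (\<theta>0 (Suc j))\<^sup>2) + (1 + 1 / t) * (f ^ (2 * p) * d\<^sup>2)"
          by (simp add: algebra_simps)
        also have "(1 + 1 / t) * (f ^ (2 * p) * d\<^sup>2) \<le> (1 + 1 / t) * (a\<^sup>2 * 4 ^ p / real N)"
          using t0 by (intro mult_left_mono fd) (auto simp: add_nonneg_nonneg)
        finally show "h (Suc j) \<le> (1 + t) * (real (freq (Suc j)) ^ (2 * p) * (\<theta>0 (Suc j))\<^sup>2) + (1 + 1 / t) * (a\<^sup>2 * 4 ^ p / real N)"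
          by (simp add: f_def)
      qed
      also have "\<dots> = (1 + t) * (\<Sum>j<N. real (freq (Suc j)) ^ (2 * p) * (\<theta>0 (Suc j))\<^sup>2) + (1 + 1 / t) * (a\<^sup>2 * 4 ^ p)"
        using N by (simp add: sum.distrib sum_distrib_left)
      also have "\<dots> \<le> (1 + t) * Q' + (Q - Q') / 6"
        unfolding a2 using t0 by (intro add_right_mono mult_left_mono ellipsoid_partial_sum_le[OF \<theta>0]) auto
      also have "(1 + t) * Q' = Q' + (Q - Q') / 3" using Q' by (simp add: t_def field_simps)
      finally have hd: "(\<Sum>j<N. h (Suc j)) \<le> Q' + (Q - Q') / 3 + (Q - Q') / 6" .
      have "suminf h = h 0 + (\<Sum>j. h (Suc j))" using suminf_split_head[OF sh] by simp
      also have "h 0 = 0" using p by (simp add: h_def freq_0)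
      also have "(\<Sum>j. h (Suc j)) = (\<Sum>j. h (Suc (j + N))) + (\<Sum>j<N. h (Suc j))"
        using suminf_split_initial_segment[OF sS, of N] by simp
      finally have "suminf h < Q" using hd tl' Q' by (simp add: \<eta>_def field_simps)
      moreover have "summable (\<lambda>j. (x j)\<^sup>2)"
        using sobolev_tail_le(1)[of p x _ N] sS N(1) summable_Suc_iff[of "\<lambda>j. (x j)\<^sup>2"] by (auto simp: h_def)
      ultimately show "x \<in> sobolev_ellipsoid p Q" using sh unfolding sobolev_ellipsoid_def h_def by simp
    qed
    have B_dist: "(\<Sum>j. (\<theta>0 (Suc j) - x (Suc j))\<^sup>2) \<le> D / real N ^ (2 * p)" if x: "x \<in> B" for x
      unfolding D_def
    proof (rule ellipsoid_dist_le)
      show "\<theta>0 \<in> sobolev_ellipsoid p Q" using ellipsoid_mono[of Q' Q p] \<theta>0 Q' by auto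
      show "x \<in> sobolev_ellipsoid p Q" using B_sub x by auto
      show "1 \<le> N" by fact
      show "\<bar>\<theta>0 (Suc j) - x (Suc j)\<bar> \<le> a * mesh p N" if "j < N" for j
        using B_close[OF x that] by (simp add: abs_minus_commute)
    qed

    have "exp (- K * real N) \<le> M.prob B"
    proof -
      define e where "e j = 2 * real N / s * (real (freq (Suc j)) ^ (2 * p) * (\<theta>0 (Suc j))\<^sup>2) + 2 * a\<^sup>2 * 4 ^ p / s" for j
      have fac: "c * (real (Suc j) / real N) ^ (p + 1) * exp (- e j) \<le> measure (M (Suc j)) (A (Suc j))" if j: "j < N" for j
      proof -
        define f where "f = real (freq (Suc j))"
        define v where "v = s / f ^ (2 * p + 1)"
        have f: "real (Suc j) \<le> f" "f \<le> 2 * real N" using freq_bounds[of "Suc j"] j by (auto simp: f_def)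
        have f0: "0 < f" using f by simp
        have v0: "0 < v" using s f0 by (simp add: v_def)
        have "f powr (- (2 * real p + 1)) = 1 / f ^ (2 * p + 1)"
        proof -
          have "f powr (2 * real p + 1) = f powr real (2 * p + 1)" by (simp add: add.commute)
          also have "\<dots> = f ^ (2 * p + 1)" using f0 by (rule powr_realpow)
          finally show ?thesis unfolding powr_minus_divide by simp
        qed
        then have M_eq: "M (Suc j) = gaussian 0 v"
          using j by (simp add: M_def coord_prior_def N_def v_def f_def)
        interpret G: prob_space "gaussian 0 v" by (rule prob_space_gaussian[OF v0])
        have le: "c * (real (Suc j) / real N) ^ (p + 1) * exp (- e j) \<le>
            2 * (a * mesh p N) / sqrt (2 * pi * v) * exp (- (((\<theta>0 (Suc j))\<^sup>2 + (a * mesh p N)\<^sup>2) / v))"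
          unfolding c_def e_def v_def f_def[symmetric]
          using s a0 N(1) j f by (intro box_factor_ge) auto
        have "ennreal (2 * (a * mesh p N) / sqrt (2 * pi * v) * exp (- (((\<theta>0 (Suc j))\<^sup>2 + (a * mesh p N)\<^sup>2) / v)))
            \<le> ennreal (G.prob (A (Suc j)))"
          unfolding A_def G.emeasure_eq_measure[symmetric]
          using v0 a0 mesh_pos[OF N(1), of p] by (intro gaussian_interval_ge) auto
        then show ?thesis unfolding M_eq using le by (subst (asm) ennreal_le_iff) auto
      qed
      have "exp (- (real p + 1 + \<bar>ln c\<bar> + 2 * Q' / s + 2 * a\<^sup>2 * 4 ^ p / s) * real N) \<le>
          c ^ N * exp (- real N) ^ (p + 1) * exp (- (2 * real N / s * Q' + real N * (2 * a\<^sup>2 * 4 ^ p / s)))"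
      proof -
        have "c ^ N = exp (real N * ln c)" using c0 by (simp add: exp_of_nat_mult)
        then have "c ^ N * exp (- real N) ^ (p + 1) * exp (- (2 * real N / s * Q' + real N * (2 * a\<^sup>2 * 4 ^ p / s)))
          = exp (real N * ln c + real (p + 1) * (- real N) + - (2 * real N / s * Q' + real N * (2 * a\<^sup>2 * 4 ^ p / s)))"
          unfolding exp_of_nat_mult[symmetric] exp_add by simp
        moreover have "- (real p + 1 + \<bar>ln c\<bar> + 2 * Q' / s + 2 * a\<^sup>2 * 4 ^ p / s) * real N \<le>
            real N * ln c + real (p + 1) * (- real N) + - (2 * real N / s * Q' + real N * (2 * a\<^sup>2 * 4 ^ p / s))"
        proof -
          have "real N * (- \<bar>ln c\<bar>) \<le> real N * ln c" by (intro mult_left_mono) auto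
          then show ?thesis by (simp add: algebra_simps)
        qed
        ultimately show ?thesis by simp
      qed
      also have "\<dots> \<le> c ^ N * (\<Prod>j<N. real (Suc j) / real N) ^ (p + 1) * exp (- (\<Sum>j<N. e j))"
      proof (intro mult_mono mult_left_mono power_mono)
        have "inverse (exp (real N)) \<le> inverse (\<Prod>j<N. real N / real (Suc j))"
          using N by (intro le_imp_inverse_le prod_inverse_ratio_le prod_pos) auto
        also have "\<dots> = (\<Prod>j<N. real (Suc j) / real N)"
          unfolding prod_inversef[symmetric] by (simp add: field_simps comp_def)
        finally show "exp (- real N) \<le> (\<Prod>j<N. real (Suc j) / real N)" by (simp add: exp_minus)
        have "(\<Sum>j<N. e j) = 2 * real N / s * (\<Sum>j<N. real (freq (Suc j)) ^ (2 * p) * (\<theta>0 (Suc j))\<^sup>2) + real N * (2 * a\<^sup>2 * 4 ^ p / s)"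
          by (simp add: e_def sum.distrib sum_distrib_left)
        also have "\<dots> \<le> 2 * real N / s * Q' + real N * (2 * a\<^sup>2 * 4 ^ p / s)"
          using s by (intro add_right_mono mult_left_mono ellipsoid_partial_sum_le[OF \<theta>0]) auto
        finally show "exp (- (2 * real N / s * Q' + real N * (2 * a\<^sup>2 * 4 ^ p / s))) \<le> exp (- (\<Sum>j<N. e j))" by simp
      qed (use c0 in \<open>auto intro!: mult_nonneg_nonneg prod_nonneg zero_le_power\<close>)
      also have "\<dots> = (\<Prod>j<N. c * (real (Suc j) / real N) ^ (p + 1) * exp (- e j))"
        by (simp only: prod.distrib prod_power_distrib exp_sum finite_lessThan sum_negf[symmetric] prod_constant card_lessThan)
      also have "\<dots> \<le> (\<Prod>j<N. measure (M (Suc j)) (A (Suc j)))"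
        using c0 fac by (intro prod_mono) auto
      also have "\<dots> = M.prob H" unfolding rect(2) by (simp add: prod.reindex)
      finally have H: "exp (- (real p + 1 + \<bar>ln c\<bar> + 2 * Q' / s + 2 * a\<^sup>2 * 4 ^ p / s) * real N) \<le> M.prob H" .
      have "exp (- 1) \<le> 1 / (2::real)" using exp_ge_add_one_self[of 1] by (simp add: exp_minus field_simps)
      moreover have "exp (- real N) \<le> exp (- 1)" using N by simp
      ultimately have half: "exp (- real N) \<le> 1 / 2" by linarith
      have "- K * real N = - real N + - (real p + 1 + \<bar>ln c\<bar> + 2 * Q' / s + 2 * a\<^sup>2 * 4 ^ p / s) * real N"
        by (simp add: K_def algebra_simps)
      then have "exp (- K * real N) = exp (- real N) * exp (- (real p + 1 + \<bar>ln c\<bar> + 2 * Q' / s + 2 * a\<^sup>2 * 4 ^ p / s) * real N)"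
        by (simp only: exp_add)
      also have "\<dots> \<le> 1 / 2 * M.prob H" using half H by (intro mult_mono) auto
      also have "\<dots> \<le> M.prob B" using rect(3) by simp
      finally show ?thesis .
    qed
    then show ?thesis
      using rect(1) B_sub B_dist unfolding unrestricted_prior_def M_def[symmetric] N_def[symmetric]
      by (intro bexI[of _ B]) (auto simp: M_def[symmetric])
  qed
  then show ?thesis
    using K0 D0 by (intro exI[of _ K] exI[of _ D] exI[of _ "max 1 N1"]) simp
qed

section \<open>The prior as a family of densities\<close>

text \<open>Outside of the ellipsoid the exponent is replaced by zero, so that the bounds on the densities hold for
  every parameter. The prior does not charge that set.\<close>

definition restricted_dens :: "nat \<Rightarrow> real \<Rightarrow> (nat \<Rightarrow> real) \<Rightarrow> real \<Rightarrow> real" where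
  "restricted_dens p Q \<theta> = unif.gibbs (\<lambda>x. if \<theta> \<in> sobolev_ellipsoid p Q then log_dens \<theta> x else 0)"

lemma restricted_dens_eq: "\<theta> \<in> sobolev_ellipsoid p Q \<Longrightarrow> restricted_dens p Q \<theta> = dens \<theta>"
  by (simp add: restricted_dens_def dens_eq_gibbs)

lemma zero_in_ellipsoid: "0 < R \<Longrightarrow> (\<lambda>_. 0) \<in> sobolev_ellipsoid p R"
  by (simp add: sobolev_ellipsoid_def)

lemma log_bound_nonneg: "p \<ge> 1 \<Longrightarrow> 0 < R \<Longrightarrow> 0 \<le> log_bound p R"
  using abs_log_dens_le[OF _ zero_in_ellipsoid, of p R 0] by linarith

lemma sets_prior: "sets (prior p Q \<alpha> s n) = sets (PiM UNIV (\<lambda>_. borel))"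
proof -
  have "sets (prior p Q \<alpha> s n) = sets (PiM UNIV (coord_prior p Q \<alpha> s n))"
    by (simp add: prior_def unrestricted_prior_def)
  also have "\<dots> = sets (PiM UNIV (\<lambda>_. borel))"
    by (rule sets_PiM_cong) (simp_all add: sets_coord_prior)
  finally show ?thesis .
qed

lemma coordinate_measurable[measurable]: "(\<lambda>\<theta>. \<theta> j) \<in> borel_measurable (prior p Q \<alpha> s n)"
  using measurable_component_singleton[of j UNIV "\<lambda>_. borel"]
  by (simp add: measurable_cong_sets[OF sets_prior refl])

lemma ellipsoid_in_prior[measurable]: "0 < Q \<Longrightarrow> sobolev_ellipsoid p Q \<in> sets (prior p Q \<alpha> s n)"
  unfolding sets_prior by (rule sobolev_ellipsoid_measurable) auto

lemma restricted_dens_bdens: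
  assumes "p \<ge> 1" "0 < Q"
  defines "b \<equiv> log_bound p Q"
  shows "bounded_densities.bdens unif (exp (- 2 * b)) (exp (2 * b)) (restricted_dens p Q \<theta>)"
  unfolding restricted_dens_def
proof (rule unif.gibbs_bdens)
  show "(\<lambda>x. if \<theta> \<in> sobolev_ellipsoid p Q then log_dens \<theta> x else 0) \<in> borel_measurable unif"
    by (cases "\<theta> \<in> sobolev_ellipsoid p Q") (auto intro: borel_measurable_unif)
  show "\<bar>if \<theta> \<in> sobolev_ellipsoid p Q then log_dens \<theta> x else 0\<bar> \<le> b" for x
    unfolding b_def using abs_log_dens_le[OF assms(1)] log_bound_nonneg[OF assms(1,2)] by auto
qed

lemma restricted_dens_measurable:
  assumes "0 < Q"
  shows "case_prod (restricted_dens p Q) \<in> borel_measurable (prior p Q \<alpha> s n \<Otimes>\<^sub>M unif)"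
    and "(\<lambda>\<theta>. restricted_dens p Q \<theta> x) \<in> borel_measurable (prior p Q \<alpha> s n)"
    and "(\<lambda>\<theta>. dens \<theta> x) \<in> borel_measurable (prior p Q \<alpha> s n)"
proof -
  note [measurable] = ellipsoid_in_prior[OF assms]
  have [measurable]: "trig j \<in> borel_measurable unif" for j by (intro borel_measurable_unif) measurable
  have [measurable]: "(\<lambda>z. log_dens (fst z) (snd z)) \<in> borel_measurable (prior p Q \<alpha> s n \<Otimes>\<^sub>M unif)"
    unfolding log_dens_def by measurable
  have [measurable]: "(\<lambda>\<theta>. log_dens \<theta> y) \<in> borel_measurable (prior p Q \<alpha> s n)" for y
    unfolding log_dens_def by measurable
  have [measurable]: "(\<lambda>\<theta>. \<integral>y. exp (if \<theta> \<in> sobolev_ellipsoid p Q then log_dens \<theta> y else 0) \<partial>unif) \<in> borel_measurable (prior p Q \<alpha> s n)"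
    "(\<lambda>\<theta>. \<integral>y. exp (log_dens \<theta> y) \<partial>unif) \<in> borel_measurable (prior p Q \<alpha> s n)"
    by (intro unif.borel_measurable_lebesgue_integral; unfold case_prod_beta; measurable)+
  show "case_prod (restricted_dens p Q) \<in> borel_measurable (prior p Q \<alpha> s n \<Otimes>\<^sub>M unif)"
    unfolding restricted_dens_def unif.gibbs_def case_prod_beta by measurable
  show "(\<lambda>\<theta>. restricted_dens p Q \<theta> x) \<in> borel_measurable (prior p Q \<alpha> s n)"
    unfolding restricted_dens_def unif.gibbs_def by measurable
  show "(\<lambda>\<theta>. dens \<theta> x) \<in> borel_measurable (prior p Q \<alpha> s n)"
    unfolding dens_eq_gibbs unif.gibbs_def by measurable
qed

lemma prob_space_unrestricted: "0 < s \<Longrightarrow> prob_space (unrestricted_prior p Q \<alpha> s n)"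
  unfolding unrestricted_prior_def by (intro prob_space_PiM prob_space_coord_prior)

lemma prior_density_family:
  assumes "p \<ge> 1" "0 < Q" "0 < s" and E: "0 < measure (unrestricted_prior p Q \<alpha> s n) (sobolev_ellipsoid p Q)"
  defines "b \<equiv> log_bound p Q"
  shows "density_family unif (exp (- 2 * b)) (exp (2 * b)) (prior p Q \<alpha> s n) (restricted_dens p Q)"
proof -
  interpret \<mu>: prob_space "unrestricted_prior p Q \<alpha> s n" by (rule prob_space_unrestricted) fact
  interpret bounded_densities unif "exp (- 2 * b)" "exp (2 * b)" by unfold_locales simp
  interpret prior: prob_space "prior p Q \<alpha> s n"
    unfolding prior_def using E by (intro prob_space_uniform_measure) (auto simp: \<mu>.emeasure_eq_measure)
  show ?thesis
    using restricted_dens_measurable(1)[OF assms(2)] restricted_dens_bdens[OF assms(1,2)]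
    by unfold_locales (auto simp: b_def)
qed

lemma hellinger_square: "(hellinger f g)\<^sup>2 = (\<integral>x. (sqrt (f x) - sqrt (g x))\<^sup>2 \<partial>unif)"
  unfolding hellinger_def integral_unif[symmetric] by (simp add: Bochner_Integration.integral_nonneg)

context density_family
begin

lemma post_mean_bounds:
  assumes X: "X \<in> space (PiM I (\<lambda>_. U))" and x: "x \<in> space U"
  shows "0 \<le> post_mean I X x" "post_mean I X x \<le> hi"
proof -
  have fx: "(\<lambda>\<theta>. f \<theta> x) \<in> borel_measurable \<nu>" using measurable_Pair1[OF f_meas x] by simp
  note L = likelihood_integrable[OF X] evidence_pos[OF X]
  have le: "0 \<le> f \<theta> x * likelihood I X \<theta>" "f \<theta> x * likelihood I X \<theta> \<le> hi * likelihood I X \<theta>" for \<theta>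
    using f_pos[of \<theta> x] likelihood_bounds(3)[of I X \<theta>] bdens_hi[OF f_bdens, of \<theta> x]
    by (auto intro: mult_right_mono simp: less_imp_le)
  show "0 \<le> post_mean I X x"
    unfolding post_mean_def using L(2) le by (intro divide_nonneg_pos Bochner_Integration.integral_nonneg) auto
  have "(\<integral>\<theta>. f \<theta> x * likelihood I X \<theta> \<partial>\<nu>) \<le> (\<integral>\<theta>. hi * likelihood I X \<theta> \<partial>\<nu>)"
    using L(1) le hi_pos[OF f_bdens] likelihood_bounds(3)[of I X]
    by (intro integral_mono') (auto simp: less_imp_le)
  then show "post_mean I X x \<le> hi"
    unfolding post_mean_def using L(2) by (simp add: divide_le_eq mult.commute)
qed

end

lemma bayes_estimator_eq:
  assumes "p \<ge> 1" "0 < Q" "0 < s" and E: "0 < measure (unrestricted_prior p Q \<alpha> s n) (sobolev_ellipsoid p Q)"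
  defines "b \<equiv> log_bound p Q"
  shows "bayes_estimator (prior p Q \<alpha> s n) m X =
    density_family.post_mean (prior p Q \<alpha> s n) (restricted_dens p Q) {1..m} X"
proof
  interpret density_family unif "exp (- 2 * b)" "exp (2 * b)" "prior p Q \<alpha> s n" "restricted_dens p Q"
    unfolding b_def by (rule prior_density_family) fact+
  note [measurable] = restricted_dens_measurable(2,3)[OF assms(2)]
  fix x
  have AE: "AE \<theta> in prior p Q \<alpha> s n. \<theta> \<in> sobolev_ellipsoid p Q"
    unfolding prior_def
    using sobolev_ellipsoid_measurable[of "coord_prior p Q \<alpha> s n", OF sets_coord_prior assms(2)]
    by (intro AE_uniform_measureI) (auto simp: unrestricted_prior_def)
  show "bayes_estimator (prior p Q \<alpha> s n) m X x = post_mean {1..m} X x"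
    unfolding bayes_estimator_def post_mean_def likelihood_def
  proof (intro arg_cong2[where f = "(/)"] integral_cong_AE)
    show "AE \<theta> in prior p Q \<alpha> s n. dens \<theta> x * (\<Prod>i = 1..m. dens \<theta> (X i)) = restricted_dens p Q \<theta> x * (\<Prod>i\<in>{1..m}. restricted_dens p Q \<theta> (X i))"
      "AE \<theta> in prior p Q \<alpha> s n. (\<Prod>i = 1..m. dens \<theta> (X i)) = (\<Prod>i\<in>{1..m}. restricted_dens p Q \<theta> (X i))"
      using AE by (eventually_elim, simp add: restricted_dens_eq)+
  qed measurable
qed

lemma risk_eq:
  assumes "p \<ge> 1" "0 < Q" "0 < s" and E: "0 < measure (unrestricted_prior p Q \<alpha> s n) (sobolev_ellipsoid p Q)"
    and \<theta>0: "\<theta>0 \<in> sobolev_ellipsoid p Q"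
  shows "(\<integral>X. (hellinger (dens \<theta>0) (bayes_estimator (prior p Q \<alpha> s n) n X))\<^sup>2 \<partial>sample \<theta>0 n) =
    (\<integral>X. (\<Prod>i\<in>{1..n}. dens \<theta>0 (X i)) * bounded_densities.hell2 unif (dens \<theta>0)
      (density_family.post_mean (prior p Q \<alpha> s n) (restricted_dens p Q) {1..n} X) \<partial>PiM {1..n} (\<lambda>_. unif))"
proof -
  define b where "b = log_bound p Q"
  interpret density_family unif "exp (- 2 * b)" "exp (2 * b)" "prior p Q \<alpha> s n" "restricted_dens p Q"
    unfolding b_def by (rule prior_density_family) fact+
  have f0: "bdens (dens \<theta>0)"
    using f_bdens[of \<theta>0] restricted_dens_eq[OF \<theta>0] by simp
  note [measurable] = bdens_meas[OF f0] and pos = bdens_pos[OF f0]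
  have dp: "prob_space (density unif (\<lambda>x. ennreal (dens \<theta>0 x)))"
  proof (rule prob_spaceI)
    have "emeasure (density unif (\<lambda>x. ennreal (dens \<theta>0 x))) (space (density unif (\<lambda>x. ennreal (dens \<theta>0 x)))) = (\<integral>\<^sup>+x. ennreal (dens \<theta>0 x) \<partial>unif)"
    proof -
      have "emeasure (density unif (\<lambda>x. ennreal (dens \<theta>0 x))) (space unif) = (\<integral>\<^sup>+x. ennreal (dens \<theta>0 x) * indicator (space unif) x \<partial>unif)"
        by (rule emeasure_density) measurable
      also have "\<dots> = (\<integral>\<^sup>+x. ennreal (dens \<theta>0 x) \<partial>unif)" by (rule nn_integral_cong) simp
      finally show ?thesis by (simp only: space_density)
    qed
    also have "\<dots> = ennreal (\<integral>x. dens \<theta>0 x \<partial>unif)"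
      using bdens_integrable[OF f0] pos by (intro nn_integral_eq_integral) (auto simp: less_imp_le)
    finally show "emeasure (density unif (\<lambda>x. ennreal (dens \<theta>0 x))) (space (density unif (\<lambda>x. ennreal (dens \<theta>0 x)))) = 1"
      using bdens_int[OF f0] by simp
  qed
  have sample: "sample \<theta>0 n = density (PiM {1..n} (\<lambda>_. unif)) (\<lambda>X. ennreal (\<Prod>i\<in>{1..n}. dens \<theta>0 (X i)))"
    unfolding sample_def model_def
    using pos by (intro PiM_density_real dp unif.prob_space_axioms) (auto simp: less_imp_le)
  have hm: "(\<lambda>X. hell2 (dens \<theta>0) (post_mean {1..n} X)) \<in> borel_measurable (PiM {1..n} (\<lambda>_. unif))"
    unfolding hell2_def by measurable
  have nn: "0 \<le> (\<Prod>i\<in>{1..n}. dens \<theta>0 (X i))" for X using pos by (intro prod_nonneg) (simp add: less_imp_le)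
  have "(\<integral>X. (hellinger (dens \<theta>0) (bayes_estimator (prior p Q \<alpha> s n) n X))\<^sup>2 \<partial>sample \<theta>0 n)
    = (\<integral>X. hell2 (dens \<theta>0) (post_mean {1..n} X) \<partial>sample \<theta>0 n)"
    unfolding hellinger_square hell2_def bayes_estimator_eq[OF assms(1-4)] ..
  also have "\<dots> = (\<integral>X. (\<Prod>i\<in>{1..n}. dens \<theta>0 (X i)) * hell2 (dens \<theta>0) (post_mean {1..n} X) \<partial>PiM {1..n} (\<lambda>_. unif))"
    unfolding sample using hm nn by (subst integral_density) auto
  finally show ?thesis .
qed

section \<open>The cutoff frequency and the rate\<close>

definition scale :: "nat \<Rightarrow> nat \<Rightarrow> real" where
  "scale p n = real n powr (1 / (2 * real p + 1))"

lemma scale_ge_1: "1 \<le> n \<Longrightarrow> 1 \<le> scale p n"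
  unfolding scale_def by (intro ge_one_powr_ge_zero) auto

lemma scale_power: "1 \<le> n \<Longrightarrow> scale p n ^ (2 * p + 1) = real n"
proof -
  assume n: "1 \<le> n"
  have "scale p n ^ (2 * p + 1) = scale p n powr real (2 * p + 1)"
    using scale_ge_1[OF n, of p] by (intro powr_realpow[symmetric]) auto
  also have "\<dots> = real n powr (1 / (2 * real p + 1) * real (2 * p + 1))"
    unfolding scale_def by (rule powr_powr)
  also have "1 / (2 * real p + 1) * real (2 * p + 1) = 1" by (simp add: add_nonneg_eq_0_iff)
  finally show ?thesis using n by simp
qed

lemma rate_eq: "1 \<le> n \<Longrightarrow> real n powr (- (2 * real p / (2 * real p + 1))) = 1 / scale p n ^ (2 * p)"
proof -
  assume n: "1 \<le> n"
  have "scale p n ^ (2 * p) = scale p n powr real (2 * p)"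
    using scale_ge_1[OF n, of p] by (intro powr_realpow[symmetric]) auto
  also have "\<dots> = real n powr (1 / (2 * real p + 1) * real (2 * p))"
    unfolding scale_def by (rule powr_powr)
  finally show ?thesis by (simp add: powr_minus_divide)
qed

lemma cutoff_scale:
  assumes "p \<ge> 1" "0 < Q"
  shows "\<exists>\<kappa>>0. \<forall>n\<ge>1. \<kappa> * scale p n \<le> real (cutoff p Q n) \<and> real (cutoff p Q n) \<le> (\<kappa> + 1) * scale p n"
proof (intro exI conjI allI impI)
  define q where "q = 8 * Q / B1_sq p Q"
  have q: "0 < q" using assms by (simp add: q_def B1_sq_def)
  show "0 < q powr (1 / (2 * real p))" using q by simp
  fix n :: nat assume n: "1 \<le> n"
  have "8 * Q / (B1_sq p Q * (eps p n)\<^sup>2) = q * real n powr (2 * (real p / (2 * real p + 1)))"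
  proof -
    have "(eps p n)\<^sup>2 = real n powr (- (2 * (real p / (2 * real p + 1))))"
      unfolding eps_def power2_eq_square powr_add[symmetric] by simp
    then show ?thesis by (simp add: q_def powr_minus_divide)
  qed
  then have "(8 * Q / (B1_sq p Q * (eps p n)\<^sup>2)) powr (1 / (2 * real p)) =
      q powr (1 / (2 * real p)) * (real n powr (2 * (real p / (2 * real p + 1)))) powr (1 / (2 * real p))"
    using q by (simp add: powr_mult)
  also have "(real n powr (2 * (real p / (2 * real p + 1)))) powr (1 / (2 * real p)) = scale p n"
    unfolding powr_powr scale_def using assms(1) by simp
  finally have c: "cutoff p Q n = nat \<lceil>q powr (1 / (2 * real p)) * scale p n\<rceil>" by (simp add: cutoff_def)
  have y: "0 \<le> q powr (1 / (2 * real p)) * scale p n" using scale_ge_1[OF n, of p] by simp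
  then have r: "real (cutoff p Q n) = of_int \<lceil>q powr (1 / (2 * real p)) * scale p n\<rceil>"
    unfolding c by (simp add: of_nat_nat ceiling_mono)
  show "q powr (1 / (2 * real p)) * scale p n \<le> real (cutoff p Q n)" unfolding r by (rule le_of_int_ceiling)
  have "real (cutoff p Q n) \<le> q powr (1 / (2 * real p)) * scale p n + 1" unfolding r by linarith
  also have "\<dots> \<le> (q powr (1 / (2 * real p)) + 1) * scale p n"
    using scale_ge_1[OF n, of p] by (simp add: distrib_right)
  finally show "real (cutoff p Q n) \<le> (q powr (1 / (2 * real p)) + 1) * scale p n" .
qed

lemma sample_size_cutoff:
  assumes "p \<ge> 1" "0 < Q"
  shows "\<exists>c1>0. \<exists>c2>0. \<forall>n\<ge>1. 1 \<le> cutoff p Q n \<and>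
    c1 * real (cutoff p Q n) ^ (2 * p + 1) \<le> real n \<and> real n \<le> c2 * real (cutoff p Q n) ^ (2 * p + 1)"
proof -
  obtain \<kappa> where \<kappa>: "0 < \<kappa>" "\<And>n. 1 \<le> n \<Longrightarrow> \<kappa> * scale p n \<le> real (cutoff p Q n)"
      "\<And>n. 1 \<le> n \<Longrightarrow> real (cutoff p Q n) \<le> (\<kappa> + 1) * scale p n"
    using cutoff_scale[OF assms] by blast
  define c1 c2 where "c1 = 1 / (\<kappa> + 1) ^ (2 * p + 1)" and "c2 = 1 / \<kappa> ^ (2 * p + 1)"
  have "1 \<le> N \<and> c1 * real N ^ (2 * p + 1) \<le> real n \<and> real n \<le> c2 * real N ^ (2 * p + 1)"
    if n: "1 \<le> n" and N: "N = cutoff p Q n" for n N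
  proof (intro conjI)
    have "0 < real N" using \<kappa>(1) \<kappa>(2)[OF n] scale_ge_1[OF n, of p]
      by (metis N less_le_trans mult_pos_pos zero_less_one)
    then show "1 \<le> N" by simp
    have "real N ^ (2 * p + 1) \<le> ((\<kappa> + 1) * scale p n) ^ (2 * p + 1)"
      unfolding N using \<kappa>(3)[OF n] by (intro power_mono) auto
    also have "\<dots> = (\<kappa> + 1) ^ (2 * p + 1) * real n" unfolding power_mult_distrib scale_power[OF n] ..
    finally show "c1 * real N ^ (2 * p + 1) \<le> real n"
      using \<kappa>(1) unfolding c1_def by (simp only: times_divide_eq_left mult_1_left) (subst divide_le_eq, simp add: mult.commute)
    have "\<kappa> ^ (2 * p + 1) * real n = (\<kappa> * scale p n) ^ (2 * p + 1)" unfolding power_mult_distrib scale_power[OF n] ..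
    also have "\<dots> \<le> real N ^ (2 * p + 1)"
      unfolding N using \<kappa>(1) \<kappa>(2)[OF n] scale_ge_1[OF n, of p] by (intro power_mono) auto
    finally show "real n \<le> c2 * real N ^ (2 * p + 1)"
      using \<kappa>(1) unfolding c2_def by (simp only: times_divide_eq_left mult_1_left) (subst le_divide_eq, simp add: mult.commute)
  qed
  moreover have "0 < c1" "0 < c2" using \<kappa>(1) by (simp_all add: c1_def c2_def)
  ultimately show ?thesis by blast
qed

lemma eventually_cutoff_ge:
  assumes "p \<ge> 1" "0 < Q"
  shows "\<forall>\<^sub>F n in sequentially. N0 \<le> cutoff p Q n"
proof -
  obtain \<kappa> where \<kappa>: "0 < \<kappa>" "\<And>n. 1 \<le> n \<Longrightarrow> \<kappa> * scale p n \<le> real (cutoff p Q n)"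
    using cutoff_scale[OF assms] by blast
  define z where "z = real N0 / \<kappa>"
  have z: "0 \<le> z" using \<kappa>(1) by (simp add: z_def)
  show ?thesis
  proof (rule eventually_sequentiallyI)
    fix n assume n: "max 1 (nat \<lceil>z ^ (2 * p + 1)\<rceil>) \<le> n"
    have n1: "1 \<le> n" using n by simp
    have "z ^ (2 * p + 1) \<le> real (nat \<lceil>z ^ (2 * p + 1)\<rceil>)" by (rule real_nat_ceiling_ge)
    also have "\<dots> \<le> real n" using n by simp
    also have "\<dots> = scale p n ^ (2 * p + 1)" using scale_power[OF n1] by simp
    finally have "z \<le> scale p n"
      using scale_ge_1[OF n1, of p] by (metis (no_types) Suc_eq_plus1 order_trans power_le_imp_le_base zero_le_one)
    then have "\<kappa> * z \<le> \<kappa> * scale p n" using \<kappa>(1) by (intro mult_left_mono) auto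
    then have "real N0 \<le> real (cutoff p Q n)" using \<kappa>(2)[OF n1] \<kappa>(1) by (simp add: z_def)
    then show "N0 \<le> cutoff p Q n" by simp
  qed
qed

section \<open>Upper and lower bounds in terms of the cutoff\<close>

abbreviation bayes_risk :: "nat \<Rightarrow> real \<Rightarrow> real \<Rightarrow> real \<Rightarrow> nat \<Rightarrow> (nat \<Rightarrow> real) \<Rightarrow> real" where
  "bayes_risk p Q \<alpha> s n \<theta>0 \<equiv>
    (\<integral>X. (hellinger (dens \<theta>0) (bayes_estimator (prior p Q \<alpha> s n) n X))\<^sup>2 \<partial>sample \<theta>0 n)"

text \<open>All exponents in \<open>post_mean_risk\<close> are of the order \<open>N\<close>, and every constant but the separation of the tests is
  given by the entropy and the prior mass. Taking the separation large enough leaves \<open>exp (- N)\<close>, which is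
  of smaller order than the rate.\<close>

lemma risk_upper_bound:
  assumes p: "p \<ge> 1" and \<alpha>: "\<alpha> > 1 / 2" and s: "s > 0" and Q': "0 < Q'" "Q' < Q"
  shows "\<exists>C N0. 0 \<le> C \<and> (\<forall>n\<ge>1. N0 \<le> cutoff p Q n \<longrightarrow>
    0 < measure (unrestricted_prior p Q \<alpha> s n) (sobolev_ellipsoid p Q) \<and>
    (\<forall>\<theta>0\<in>sobolev_ellipsoid p Q'. bayes_risk p Q \<alpha> s n \<theta>0 \<le> C / real (cutoff p Q n) ^ (2 * p)))"
proof -
  have Q: "0 < Q" using Q' by simp
  obtain K D N0 where KD: "0 \<le> K" "0 \<le> D" and mass: "\<And>n \<theta>0. N0 \<le> cutoff p Q n \<Longrightarrow> \<theta>0 \<in> sobolev_ellipsoid p Q' \<Longrightarrow>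
    (\<exists>B \<in> sets (unrestricted_prior p Q \<alpha> s n). B \<subseteq> sobolev_ellipsoid p Q \<and>
      (\<forall>\<theta>\<in>B. (\<Sum>j. (\<theta>0 (Suc j) - \<theta> (Suc j))\<^sup>2) \<le> D / real (cutoff p Q n) ^ (2 * p)) \<and>
      exp (- K * real (cutoff p Q n)) \<le> measure (unrestricted_prior p Q \<alpha> s n) B)"
    using prior_mass[OF p \<alpha> s Q'] by blast
  obtain c1 c2 where c1: "0 < c1" and c2: "0 < c2" and cutoff: "\<And>n. 1 \<le> n \<Longrightarrow> 1 \<le> cutoff p Q n"
      "\<And>n. 1 \<le> n \<Longrightarrow> c1 * real (cutoff p Q n) ^ (2 * p + 1) \<le> real n"
      "\<And>n. 1 \<le> n \<Longrightarrow> real n \<le> c2 * real (cutoff p Q n) ^ (2 * p + 1)"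
    using sample_size_cutoff[OF p Q] by blast
  define b where "b = log_bound p Q"
  define lo where "lo = exp (- 2 * b)"
  have lo: "0 < lo" by (simp add: lo_def)
  define \<delta>0 where "\<delta>0 = 4 * exp (8 * b) * (1 + 4 * Q + D)"
  have \<delta>0: "0 \<le> \<delta>0" using Q KD by (simp add: \<delta>0_def)
  \<comment> \<open>There are at most \<open>exp (K1 * N)\<close> cells, and the normalised evidence has inverse mean at most \<open>exp (K2 * N)\<close>. The
    threshold for the evidence is \<open>exp (- 2 * K3 * N)\<close>, and \<open>r0\<close> makes the tests good enough to beat the
    number of cells and the threshold.\<close>
  define K1 where "K1 = entropy_const p Q + 1"
  define K2 where "K2 = c2 * \<delta>0 / lo + K"
  define K3 where "K3 = K1 + K2 + 1"
  define r0 where "r0 = 8 * \<delta>0 / lo + 8 * (K1 + K3 + 1) / c1"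
  define C where "C = 3 * r0 + 4 * fact (2 * p)"
  have K1: "0 \<le> K1" using Q by (simp add: K1_def entropy_const_def add_nonneg_nonneg)
  have K2: "0 \<le> K2" using KD \<delta>0 lo c2 by (simp add: K2_def)
  have r0: "0 \<le> r0" using \<delta>0 lo c1 K1 K2 by (simp add: r0_def K3_def add_nonneg_nonneg)
  have C: "0 \<le> C" using r0 by (simp add: C_def)
  have main: "0 < measure (unrestricted_prior p Q \<alpha> s n) (sobolev_ellipsoid p Q) \<and>
    (\<forall>\<theta>0\<in>sobolev_ellipsoid p Q'. bayes_risk p Q \<alpha> s n \<theta>0 \<le> C / real (cutoff p Q n) ^ (2 * p))"
    if n: "1 \<le> n" and N0: "N0 \<le> cutoff p Q n" for n
  proof -
    define N where "N = cutoff p Q n"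
    have N: "1 \<le> N" and nN: "c1 * real N ^ (2 * p + 1) \<le> real n" "real n \<le> c2 * real N ^ (2 * p + 1)"
      using cutoff n by (auto simp: N_def)
    then have Nreal: "0 < real N" by simp
    let ?\<mu> = "unrestricted_prior p Q \<alpha> s n" and ?\<nu> = "prior p Q \<alpha> s n" and ?E = "sobolev_ellipsoid p Q"
    interpret \<mu>: prob_space ?\<mu> by (rule prob_space_unrestricted[OF s])
    have Em: "?E \<in> sets ?\<mu>" unfolding unrestricted_prior_def
      by (rule sobolev_ellipsoid_measurable[OF sets_coord_prior Q])
    have Epos: "0 < measure ?\<mu> ?E"
    proof -
      obtain B where "B \<in> sets ?\<mu>" "B \<subseteq> ?E" "exp (- K * real (cutoff p Q n)) \<le> measure ?\<mu> B"
        using mass[OF N0 zero_in_ellipsoid[OF Q'(1)]] by blast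
      then have "exp (- K * real (cutoff p Q n)) \<le> measure ?\<mu> ?E"
        using \<mu>.finite_measure_mono[OF _ Em] by (meson order_trans)
      then show ?thesis by (rule less_le_trans[OF exp_gt_zero])
    qed
    interpret density_family unif "exp (- 2 * b)" "exp (2 * b)" ?\<nu> "restricted_dens p Q"
      unfolding b_def by (rule prior_density_family[OF p Q s Epos])
    have sp: "space ?\<nu> = UNIV" using sets_eq_imp_space_eq[OF sets_prior] by (simp add: space_PiM PiE_UNIV_domain)
    define \<delta> where "\<delta> = \<delta>0 / real N ^ (2 * p)"
    have \<delta>: "0 \<le> \<delta>" using \<delta>0 by (simp add: \<delta>_def)
    define r where "r = r0 / real N ^ (2 * p)"
    have dist: "dist2 (restricted_dens p Q \<theta>) (restricted_dens p Q \<theta>') \<le> \<delta>"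
      if "\<theta> \<in> ?E" "\<theta>' \<in> ?E" "(\<Sum>j. (\<theta> (Suc j) - \<theta>' (Suc j))\<^sup>2) \<le> y / real N ^ (2 * p)" "y \<le> 1 + 4 * Q + D" for \<theta> \<theta>' y
    proof -
      have "dist2 (restricted_dens p Q \<theta>) (restricted_dens p Q \<theta>') \<le> 4 * exp (8 * b) * (\<Sum>j. (\<theta> (Suc j) - \<theta>' (Suc j))\<^sup>2)"
        unfolding dist2_def restricted_dens_eq[OF that(1)] restricted_dens_eq[OF that(2)] b_def
        by (rule dens_dist2_le[OF p that(1,2)])
      also have "\<dots> \<le> 4 * exp (8 * b) * (y / real N ^ (2 * p))" using that(3) by (intro mult_left_mono) auto
      also have "\<dots> \<le> 4 * exp (8 * b) * ((1 + 4 * Q + D) / real N ^ (2 * p))"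
        using that(4) by (intro mult_left_mono divide_right_mono) auto
      finally show ?thesis by (simp add: \<delta>_def \<delta>0_def)
    qed
    define c where "c \<theta> = (if \<theta> \<in> ?E then Some (cell p N \<theta>) else None)" for \<theta>
    note cc = cell_count[OF N, of p Q]
    have c_sub: "c ` space ?\<nu> \<subseteq> insert None (Some ` cell p N ` ?E)" by (auto simp: c_def)
    have fin: "finite (insert None (Some ` cell p N ` ?E))" using cc(1) by auto
    have card: "real (card (c ` space ?\<nu>)) \<le> exp (K1 * real N)"
    proof -
      have "card (c ` space ?\<nu>) \<le> card (insert None (Some ` cell p N ` ?E))" by (rule card_mono[OF fin c_sub])
      also have "\<dots> \<le> Suc (card (Some ` cell p N ` ?E))" using cc(1) by (simp add: card_insert_if)
      also have "\<dots> \<le> Suc (card (cell p N ` ?E))" using card_image_le[OF cc(1), of Some] by simp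
      finally have "real (card (c ` space ?\<nu>)) \<le> 1 + real (card (cell p N ` ?E))" by linarith
      also have "\<dots> \<le> 1 + exp (entropy_const p Q * real N)" using cc(2) by simp
      also have "\<dots> \<le> exp (entropy_const p Q * real N) * (1 + 1)"
        using Q by (simp add: entropy_const_def add_nonneg_nonneg)
      also have "\<dots> \<le> exp (entropy_const p Q * real N) * exp (real N)"
      proof (intro mult_left_mono)
        have "(1::real) + 1 \<le> exp 1" by (rule exp_ge_add_one_self)
        also have "\<dots> \<le> exp (real N)" using N by simp
        finally show "1 + 1 \<le> exp (real N)" .
      qed simp
      also have "\<dots> = exp (K1 * real N)" unfolding exp_add[symmetric] K1_def by (simp add: distrib_right)
      finally show ?thesis .
    qed
    have c_meas: "{\<theta> \<in> space ?\<nu>. c \<theta> = k} \<in> sets ?\<nu>" for k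
    proof (cases k)
      case None
      have "{\<theta> \<in> space ?\<nu>. c \<theta> = k} = space ?\<nu> - ?E" by (auto simp: c_def None)
      then show ?thesis using ellipsoid_in_prior[OF Q] by auto
    next
      case (Some k')
      have coord: "{\<theta> \<in> space ?\<nu>. \<lfloor>\<theta> (Suc j) / mesh p N\<rfloor> = k' j} \<in> sets ?\<nu>" for j
      proof -
        have "(\<lambda>\<theta>. \<lfloor>\<theta> (Suc j) / mesh p N\<rfloor>) \<in> ?\<nu> \<rightarrow>\<^sub>M count_space UNIV" by measurable
        then show ?thesis by measurable
      qed
      have "{\<theta> \<in> space ?\<nu>. \<forall>j\<in>{..<N}. \<lfloor>\<theta> (Suc j) / mesh p N\<rfloor> = k' j} \<in> sets ?\<nu>"
        by (intro sets.sets_Collect_finite_All coord) auto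
      moreover have "{\<theta> \<in> space ?\<nu>. c \<theta> = k} = (if k' \<in> extensional {..<N} then
          ?E \<inter> {\<theta> \<in> space ?\<nu>. \<forall>j\<in>{..<N}. \<lfloor>\<theta> (Suc j) / mesh p N\<rfloor> = k' j} else {})"
      proof -
        have "cell p N \<theta> = k' \<longleftrightarrow> k' \<in> extensional {..<N} \<and> (\<forall>j\<in>{..<N}. \<lfloor>\<theta> (Suc j) / mesh p N\<rfloor> = k' j)" for \<theta>
        proof
          assume "cell p N \<theta> = k'"
          then show "k' \<in> extensional {..<N} \<and> (\<forall>j\<in>{..<N}. \<lfloor>\<theta> (Suc j) / mesh p N\<rfloor> = k' j)"
            by (auto simp: cell_def)
        next
          assume *: "k' \<in> extensional {..<N} \<and> (\<forall>j\<in>{..<N}. \<lfloor>\<theta> (Suc j) / mesh p N\<rfloor> = k' j)"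
          show "cell p N \<theta> = k'"
            by (rule extensionalityI[of _ "{..<N}"]) (use * in \<open>auto simp: cell_def\<close>)
        qed
        then show ?thesis by (auto simp: c_def Some sp split: if_splits)
      qed
      ultimately show ?thesis using ellipsoid_in_prior[OF Q] by (simp only: split: if_split) auto
    qed
    have cells: "dist2 (restricted_dens p Q \<theta>) (restricted_dens p Q \<theta>') \<le> \<delta>" if eq: "c \<theta> = c \<theta>'" for \<theta> \<theta>'
    proof (cases "\<theta> \<in> ?E")
      case True
      then have E': "\<theta>' \<in> ?E" "cell p N \<theta> = cell p N \<theta>'" using eq by (auto simp: c_def split: if_splits)
      show ?thesis
        by (rule dist[OF True E'(1) cell_diameter[OF True E'(1) N E'(2)]]) (use KD in simp)
    next
      case False
      then have "\<theta>' \<notin> ?E" using eq by (auto simp: c_def split: if_splits)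
      then have "restricted_dens p Q \<theta> = restricted_dens p Q \<theta>'" using False by (simp add: restricted_dens_def)
      then show ?thesis using \<delta> by (simp add: dist2_def)
    qed
    have "bayes_risk p Q \<alpha> s n \<theta>0 \<le> C / real N ^ (2 * p)" if \<theta>0: "\<theta>0 \<in> sobolev_ellipsoid p Q'" for \<theta>0
    proof -
      have \<theta>0E: "\<theta>0 \<in> ?E" using ellipsoid_mono[of Q' Q p] \<theta>0 Q' by auto
      have f0: "bdens (dens \<theta>0)" using f_bdens[of \<theta>0] by (simp add: restricted_dens_eq[OF \<theta>0E])
      obtain B where B: "B \<in> sets ?\<mu>" "B \<subseteq> ?E" "\<And>\<theta>. \<theta> \<in> B \<Longrightarrow> (\<Sum>j. (\<theta>0 (Suc j) - \<theta> (Suc j))\<^sup>2) \<le> D / real N ^ (2 * p)"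
          "exp (- K * real N) \<le> measure ?\<mu> B"
        using mass[OF N0 \<theta>0] unfolding N_def by blast
      have Bs: "B \<in> sets ?\<nu>" using B(1) by (simp add: prior_def)
      have Bmass: "exp (- K * real N) \<le> prior.prob B"
      proof -
        have "prior.prob B = measure ?\<mu> B / measure ?\<mu> ?E"
          unfolding prior_def using Epos B(1,2) \<mu>.emeasure_eq_measure
          by (subst measure_uniform_measure) (auto simp: Int_absorb1)
        also have "\<dots> \<ge> measure ?\<mu> B / 1"
          using Epos by (intro divide_left_mono) auto
        finally show ?thesis using B(4) by simp
      qed
      have Bpos: "0 < prior.prob B" by (rule less_le_trans[OF exp_gt_zero Bmass])
      have Bd: "dist2 (dens \<theta>0) (restricted_dens p Q \<theta>) \<le> \<delta>" if "\<theta> \<in> B" for \<theta>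
        using dist[OF \<theta>0E _ B(3)[OF that]] B(2) that Q KD by (auto simp: restricted_dens_eq[OF \<theta>0E])
      have rd: "8 * \<delta> / exp (- 2 * b) \<le> r"
      proof -
        have "8 * \<delta> / exp (- 2 * b) = (8 * \<delta>0 / lo) / real N ^ (2 * p)" by (simp add: \<delta>_def lo_def)
        also have "\<dots> \<le> r" unfolding r_def r0_def using c1 K1 K2
          by (intro divide_right_mono) (auto simp: K3_def)
        finally show ?thesis .
      qed
      define \<mu>0 where "\<mu>0 = exp (- (2 * K3 * real N))"
      have sqrt_\<mu>0: "sqrt \<mu>0 = exp (- (K3 * real N))"
        unfolding \<mu>0_def by (rule real_sqrt_unique) (simp_all flip: exp_double)
      have "bayes_risk p Q \<alpha> s n \<theta>0 \<le> 3 * r + 2 * exp (K1 * real N) *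
          (exp (- (card {1..n} * r / 8)) / sqrt \<mu>0 + \<mu>0 * (exp (card {1..n} * \<delta> / exp (- 2 * b)) / prior.prob B))"
        unfolding risk_eq[OF p Q s Epos \<theta>0E]
        by (rule post_mean_risk[OF f0 _ finite_subset[OF c_sub fin] card c_meas cells Bs Bpos Bd rd])
          (auto simp: \<mu>0_def)
      also have "\<dots> \<le> 3 * r + 4 * exp (- real N)"
      proof -
        have t1: "exp (- (card {1..n} * r / 8)) / sqrt \<mu>0 \<le> exp (- (K1 * real N) - real N)"
        proof -
          have "real n * r / 8 \<ge> c1 * real N ^ (2 * p + 1) * r / 8"
            using nN(1) r0 by (intro divide_right_mono mult_right_mono) (auto simp: r_def)
          also have "c1 * real N ^ (2 * p + 1) * r / 8 = c1 * r0 / 8 * real N"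
            unfolding r_def using Nreal by simp
          also have "\<dots> \<ge> (K1 + K3 + 1) * real N"
          proof (intro mult_right_mono)
            have "c1 * (8 * (K1 + K3 + 1) / c1) \<le> c1 * r0"
              unfolding r0_def using c1 \<delta>0 lo by (intro mult_left_mono) auto
            then show "K1 + K3 + 1 \<le> c1 * r0 / 8" using c1 by simp
          qed simp
          finally have "(K1 + K3 + 1) * real N \<le> real n * r / 8" .
          then have "- (real n * r / 8) + K3 * real N \<le> - (K1 * real N) - real N"
            by (simp add: distrib_right)
          then have "exp (- (real n * r / 8) + K3 * real N) \<le> exp (- (K1 * real N) - real N)" by simp
          then show ?thesis unfolding sqrt_\<mu>0 exp_diff[symmetric] by simp
        qed
        have t2: "\<mu>0 * (exp (card {1..n} * \<delta> / exp (- 2 * b)) / prior.prob B) \<le> exp (- (K1 * real N) - real N)"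
        proof -
          have "real n * \<delta> / lo \<le> c2 * real N ^ (2 * p + 1) * \<delta> / lo"
            using nN(2) \<delta> lo by (intro divide_right_mono mult_right_mono) auto
          also have "\<dots> = c2 * \<delta>0 / lo * real N" unfolding \<delta>_def using Nreal by simp
          finally have e1: "exp (card {1..n} * \<delta> / exp (- 2 * b)) \<le> exp (c2 * \<delta>0 / lo * real N)"
            by (simp add: lo_def)
          have "exp (card {1..n} * \<delta> / exp (- 2 * b)) / prior.prob B \<le> exp (c2 * \<delta>0 / lo * real N) / exp (- K * real N)"
            using e1 Bmass by (intro frac_le) auto
          also have "\<dots> = exp (K2 * real N)" unfolding exp_diff[symmetric] K2_def by (simp add: distrib_right)
          finally have "\<mu>0 * (exp (card {1..n} * \<delta> / exp (- 2 * b)) / prior.prob B) \<le> \<mu>0 * exp (K2 * real N)"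
            by (intro mult_left_mono) (auto simp: \<mu>0_def)
          also have "\<dots> = exp (- (2 * K3 * real N) + K2 * real N)" unfolding \<mu>0_def exp_add ..
          also have "\<dots> \<le> exp (- (K1 * real N) - real N)"
          proof -
            have "(K1 + K2 + 1) * real N \<le> 2 * K3 * real N"
              using K1 K2 by (intro mult_right_mono) (auto simp: K3_def)
            then have "- (2 * K3 * real N) + K2 * real N \<le> - (K1 * real N) - real N" by (simp add: distrib_right)
            then show ?thesis by simp
          qed
          finally show ?thesis .
        qed
        have "2 * exp (K1 * real N) *
          (exp (- (card {1..n} * r / 8)) / sqrt \<mu>0 + \<mu>0 * (exp (card {1..n} * \<delta> / exp (- 2 * b)) / prior.prob B))
          \<le> 2 * exp (K1 * real N) * (exp (- (K1 * real N) - real N) + exp (- (K1 * real N) - real N))"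
          by (intro mult_left_mono add_mono t1 t2) auto
        also have "\<dots> = 4 * (exp (K1 * real N) * exp (- (K1 * real N) - real N))" by simp
        also have "\<dots> = 4 * exp (- real N)" unfolding exp_add[symmetric] by simp
        finally show ?thesis by simp
      qed
      also have "\<dots> \<le> C / real N ^ (2 * p)"
      proof -
        have "1 / exp (real N) \<le> fact (2 * p) / real N ^ (2 * p)"
          using power_le_fact_exp[of "real N" "2 * p"] Nreal by (simp add: divide_simps mult.commute)
        then have "exp (- real N) \<le> fact (2 * p) / real N ^ (2 * p)" by (simp add: exp_minus inverse_eq_divide)
        then have "3 * r + 4 * exp (- real N) \<le> 3 * r + 4 * (fact (2 * p) / real N ^ (2 * p))" by simp
        then show ?thesis by (simp add: C_def r_def add_divide_distrib)
      qed
      finally show ?thesis .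
    qed
    then show ?thesis using Epos by (simp add: N_def)
  qed
  show ?thesis using C main by (intro exI[of _ C] exI[of _ N0]) auto
qed

definition vertex :: "nat \<Rightarrow> real \<Rightarrow> nat set \<Rightarrow> nat \<Rightarrow> real" where
  "vertex N \<gamma> S j = (if j \<in> {1..N} then if j \<in> S then \<gamma> else - \<gamma> else 0)"

lemma vertex_square_le: "(vertex N \<gamma> S j)\<^sup>2 \<le> \<gamma>\<^sup>2"
  by (simp add: vertex_def)

lemma vertex_in_ellipsoid:
  assumes N: "1 \<le> N" and \<eta>: "\<eta>\<^sup>2 * 4 ^ p < R"
  shows "vertex N (\<eta> * mesh p N) S \<in> sobolev_ellipsoid p R"
proof -
  let ?\<theta> = "vertex N (\<eta> * mesh p N) S"
  have zero: "?\<theta> j = 0" if "j \<notin> {1..N}" for j using that by (auto simp: vertex_def)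
  have "(\<Sum>j. real (freq j) ^ (2 * p) * (?\<theta> j)\<^sup>2) = (\<Sum>j\<in>{1..N}. real (freq j) ^ (2 * p) * (?\<theta> j)\<^sup>2)"
    by (intro suminf_finite) (auto simp: zero)
  also have "\<dots> \<le> (\<Sum>j\<in>{1..N}. \<eta>\<^sup>2 * 4 ^ p / real N)"
  proof (rule sum_mono)
    fix j assume j: "j \<in> {1..N}"
    have f: "real (freq j) \<le> 2 * real N" using freq_bounds(2)[of j] j by auto
    have "real (freq j) ^ (2 * p) * (?\<theta> j)\<^sup>2 \<le> real (freq j) ^ (2 * p) * (\<eta> * mesh p N)\<^sup>2"
      by (intro mult_left_mono vertex_square_le) auto
    also have "\<dots> = \<eta>\<^sup>2 * (real (freq j) / real N) ^ (2 * p) / real N"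
      using N by (simp add: power_mult_distrib mesh_square power_divide)
    also have "\<dots> \<le> \<eta>\<^sup>2 * 2 ^ (2 * p) / real N"
      using f N by (intro divide_right_mono mult_left_mono power_mono) (auto simp: divide_le_eq)
    finally show "real (freq j) ^ (2 * p) * (?\<theta> j)\<^sup>2 \<le> \<eta>\<^sup>2 * 4 ^ p / real N" by (simp add: power_mult)
  qed
  also have "\<dots> = \<eta>\<^sup>2 * 4 ^ p" using N by simp
  finally have "(\<Sum>j. real (freq j) ^ (2 * p) * (?\<theta> j)\<^sup>2) < R" using \<eta> by simp
  moreover have "summable (\<lambda>j. (?\<theta> j)\<^sup>2)" "summable (\<lambda>j. real (freq j) ^ (2 * p) * (?\<theta> j)\<^sup>2)"
    by (intro summable_finite[of "{1..N}"]; simp add: zero)+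
  ultimately show ?thesis by (simp add: sobolev_ellipsoid_def)
qed

lemma log_dens_vertex: "log_dens (vertex N \<gamma> S) x = (\<Sum>j\<in>{1..N}. vertex N \<gamma> S j * trig j x)"
proof -
  have "log_dens (vertex N \<gamma> S) x = (\<Sum>j<N. vertex N \<gamma> S (Suc j) * trig (Suc j) x)"
    unfolding log_dens_def by (intro suminf_finite) (auto simp: vertex_def)
  also have "\<dots> = (\<Sum>j\<in>{1..N}. vertex N \<gamma> S j * trig j x)"
    by (rule sum.reindex_bij_witness[of _ "\<lambda>j. j - 1" Suc]) auto
  finally show ?thesis .
qed

lemma dens_vertex_linearisation:
  assumes \<gamma>: "0 \<le> \<gamma>" and small: "real N * \<gamma> * sqrt 2 \<le> 1"
  shows "(\<integral>x. (sqrt (dens (vertex N \<gamma> S) x) - 1 - log_dens (vertex N \<gamma> S) x / 2)\<^sup>2 \<partial>unif)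
    \<le> 20 * real N ^ 3 * \<gamma> ^ 4"
proof -
  let ?u = "log_dens (vertex N \<gamma> S)"
  have ub: "\<bar>?u x\<bar> \<le> real N * \<gamma> * sqrt 2" for x
  proof -
    have "\<bar>?u x\<bar> \<le> (\<Sum>j\<in>{1..N}. \<bar>vertex N \<gamma> S j * trig j x\<bar>)" unfolding log_dens_vertex by (rule sum_abs)
    also have "\<dots> \<le> (\<Sum>j\<in>{1..N}. \<gamma> * sqrt 2)"
      using \<gamma> by (intro sum_mono abs_mult_le abs_trig_le) (auto simp: vertex_def)
    finally show ?thesis by simp
  qed
  have um: "?u \<in> borel_measurable unif" by (intro borel_measurable_unif) measurable
  have ti: "integrable unif (trig j)" for j
    by (intro unif.integrable_bounded[where c = "sqrt 2"] abs_trig_le borel_measurable_unif) measurable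
  have mean: "(\<integral>x. ?u x \<partial>unif) = 0"
    unfolding log_dens_vertex using ti by (simp add: trig_mean_zero)
  have "(\<integral>x. (?u x)\<^sup>2 \<partial>unif) = (\<Sum>j\<in>{1..N}. (vertex N \<gamma> S j)\<^sup>2)"
    unfolding log_dens_vertex by (intro integral_square_trig_sum) auto
  also have "\<dots> \<le> (\<Sum>j\<in>{1..N}. \<gamma>\<^sup>2)" by (intro sum_mono vertex_square_le)
  finally have sq: "(\<integral>x. (?u x)\<^sup>2 \<partial>unif) \<le> real N * \<gamma>\<^sup>2" by simp
  have "(\<integral>x. (sqrt (dens (vertex N \<gamma> S) x) - 1 - ?u x / 2)\<^sup>2 \<partial>unif) \<le> 10 * (real N * \<gamma> * sqrt 2)\<^sup>2 * (\<integral>x. (?u x)\<^sup>2 \<partial>unif)"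
    unfolding dens_eq_gibbs by (rule unif.sqrt_gibbs_linearisation[OF um ub small mean])
  also have "\<dots> \<le> 10 * (real N * \<gamma> * sqrt 2)\<^sup>2 * (real N * \<gamma>\<^sup>2)" by (intro mult_left_mono sq) auto
  also have "\<dots> = 20 * real N ^ 3 * \<gamma> ^ 4"
    by (simp add: power_mult_distrib power2_eq_square power3_eq_cube power4_eq_xxxx)
  finally show ?thesis .
qed

lemma vertex_neighbour_dist:
  assumes "j \<in> {1..N}" "j \<notin> S"
  shows "(\<Sum>i. (vertex N \<gamma> S (Suc i) - vertex N \<gamma> (insert j S) (Suc i))\<^sup>2) = 4 * \<gamma>\<^sup>2"
proof -
  have "(\<Sum>i. (vertex N \<gamma> S (Suc i) - vertex N \<gamma> (insert j S) (Suc i))\<^sup>2) =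
      (\<Sum>i\<in>{j - 1}. (vertex N \<gamma> S (Suc i) - vertex N \<gamma> (insert j S) (Suc i))\<^sup>2)"
    by (intro suminf_finite) (use assms in \<open>auto simp: vertex_def\<close>)
  also have "\<dots> = 4 * \<gamma>\<^sup>2" using assms by (simp add: vertex_def power2_eq_square)
  finally show ?thesis .
qed

text \<open>The vertices \<open>\<plusminus> \<gamma>\<close> on the first \<open>N\<close> coordinates, with \<open>\<gamma>\<close> of the order \<open>1 / sqrt n\<close>, lie in
  the ellipsoid. Neighbouring vertices cannot be told apart from \<open>n\<close> observations, so on
  average over the vertices an estimator misses a fixed fraction of the \<open>N\<close> signs, which costs a multiple of
  \<open>N * \<gamma>\<^sup>2\<close>.\<close>

lemma risk_lower_bound:
  assumes p: "p \<ge> 1" and s: "s > 0" and Q': "0 < Q'" "Q' < Q"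
  shows "\<exists>c>0. \<forall>n\<ge>1. 0 < measure (unrestricted_prior p Q \<alpha> s n) (sobolev_ellipsoid p Q) \<longrightarrow>
    (\<exists>\<theta>0\<in>sobolev_ellipsoid p Q'. c / real (cutoff p Q n) ^ (2 * p) \<le> bayes_risk p Q \<alpha> s n \<theta>0)"
proof -
  have Q: "0 < Q" using Q' by simp
  obtain c2 where c2: "0 < c2" and cutoff: "\<And>n. 1 \<le> n \<Longrightarrow> 1 \<le> cutoff p Q n"
      "\<And>n. 1 \<le> n \<Longrightarrow> real n \<le> c2 * real (cutoff p Q n) ^ (2 * p + 1)"
    using sample_size_cutoff[OF p Q] by blast
  define b where "b = log_bound p Q"
  define lo where "lo = exp (- 2 * b)"
  have lo: "0 < lo" by (simp add: lo_def)
  \<comment> \<open>The three bounds on \<open>\<eta>\<^sup>2\<close> keep the vertices in the ellipsoid, the linearisation error below half of the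
    main term, and neighbouring vertices indistinguishable.\<close>
  define h where "h = min (Q' / (2 * 4 ^ p)) (min (1 / 640) (lo / (8 * exp (8 * b) * c2)))"
  define \<eta> where "\<eta> = sqrt h"
  have h: "0 < h" "h \<le> Q' / (2 * 4 ^ p)" "h \<le> 1 / 640" "h \<le> lo / (8 * exp (8 * b) * c2)"
    using Q' lo c2 by (auto simp: h_def)
  have \<eta>2: "\<eta>\<^sup>2 = h" "0 < \<eta>" using h(1) by (auto simp: \<eta>_def)
  have main: "\<exists>\<theta>0\<in>sobolev_ellipsoid p Q'. h / 32 / real (cutoff p Q n) ^ (2 * p) \<le> bayes_risk p Q \<alpha> s n \<theta>0"
    if n: "1 \<le> n" and Epos: "0 < measure (unrestricted_prior p Q \<alpha> s n) (sobolev_ellipsoid p Q)" for n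
  proof -
    define N where "N = cutoff p Q n"
    have N: "1 \<le> N" and nN: "real n \<le> c2 * real N ^ (2 * p + 1)" using cutoff n by (auto simp: N_def)
    then have Nreal: "0 < real N" by simp
    let ?\<nu> = "prior p Q \<alpha> s n"
    interpret density_family unif "exp (- 2 * b)" "exp (2 * b)" ?\<nu> "restricted_dens p Q"
      unfolding b_def by (rule prior_density_family[OF p Q s Epos])
    define \<gamma> where "\<gamma> = \<eta> * mesh p N"
    have \<gamma>0: "0 \<le> \<gamma>" using \<eta>2 mesh_pos[OF N, of p] by (simp add: \<gamma>_def)
    have \<gamma>2: "\<gamma>\<^sup>2 = h / (real N ^ (2 * p) * real N)"
      using N \<eta>2 by (simp add: \<gamma>_def power_mult_distrib mesh_square)
    have N\<gamma>: "(real N)\<^sup>2 * \<gamma>\<^sup>2 \<le> h"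
    proof -
      have "real N ^ 2 \<le> real N ^ (2 * p)" using N p by (intro power_increasing) auto
      also have "\<dots> \<le> real N ^ (2 * p) * real N" using N by simp
      finally have "(real N)\<^sup>2 / (real N ^ (2 * p) * real N) \<le> 1" using Nreal by simp
      then have "h * ((real N)\<^sup>2 / (real N ^ (2 * p) * real N)) \<le> h * 1" using h(1) by (intro mult_left_mono) auto
      then show ?thesis by (simp add: \<gamma>2 mult.commute)
    qed
    have small: "real N * \<gamma> * sqrt 2 \<le> 1"
    proof (rule power2_le_imp_le)
      show "(real N * \<gamma> * sqrt 2)\<^sup>2 \<le> 1\<^sup>2"
        using N\<gamma> h(3) by (simp add: power_mult_distrib)
    qed simp
    have inE': "vertex N \<gamma> S \<in> sobolev_ellipsoid p Q'" for S
      unfolding \<gamma>_def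
    proof (rule vertex_in_ellipsoid[OF N])
      have "h * 4 ^ p \<le> Q' / (2 * 4 ^ p) * 4 ^ p" using h(2) by (intro mult_right_mono) auto
      also have "\<dots> < Q'" using Q' by simp
      finally show "\<eta>\<^sup>2 * 4 ^ p < Q'" by (simp add: \<eta>2)
    qed
    have inE: "vertex N \<gamma> S \<in> sobolev_ellipsoid p Q" for S
      using inE'[of S] ellipsoid_mono[of Q' Q p] Q' by auto
    have fb: "bdens (dens (vertex N \<gamma> S))" for S
      using f_bdens[of "vertex N \<gamma> S"] by (simp add: restricted_dens_eq[OF inE])
    define y where "y = 2 * exp (8 * b) * \<gamma>\<^sup>2 / lo"
    have y0: "0 \<le> y" using lo by (simp add: y_def)
    have ny: "real n * y \<le> 1 / 4"
    proof -
      have "real n * y \<le> c2 * real N ^ (2 * p + 1) * y" using nN y0 by (intro mult_right_mono)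
      also have "\<dots> = 2 * exp (8 * b) * c2 / lo * h" unfolding y_def \<gamma>2 using Nreal by simp
      also have "\<dots> \<le> 2 * exp (8 * b) * c2 / lo * (lo / (8 * exp (8 * b) * c2))"
        using h(4) c2 lo by (intro mult_left_mono) auto
      also have "\<dots> = 1 / 4" using c2 lo by simp
      finally show ?thesis .
    qed
    have "1 * y \<le> real n * y" using n y0 by (intro mult_right_mono) auto
    then have y1: "y \<le> 1 / 4" using ny by simp
    have aff: "1 - y \<le> (\<integral>x. sqrt (dens (vertex N \<gamma> S) x) * sqrt (dens (vertex N \<gamma> (insert j S)) x) \<partial>unif)"
      if "j \<in> {1..N}" "j \<notin> S" for S j
    proof -
      have "hell2 (dens (vertex N \<gamma> S)) (dens (vertex N \<gamma> (insert j S))) \<le>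
          dist2 (dens (vertex N \<gamma> S)) (dens (vertex N \<gamma> (insert j S))) / (4 * exp (- 2 * b))"
        by (rule hell2_le_dist2[OF fb fb])
      also have "\<dots> \<le> 4 * exp (8 * b) * (4 * \<gamma>\<^sup>2) / (4 * exp (- 2 * b))"
        unfolding dist2_def b_def
        using dens_dist2_le[OF p inE[of S] inE[of "insert j S"]] vertex_neighbour_dist[OF that, of \<gamma>]
        by (intro divide_right_mono) auto
      also have "\<dots> = 2 * y" by (simp add: y_def lo_def)
      finally show ?thesis unfolding affinity_eq[OF fb fb] by simp
    qed
    have orth: "(\<integral>x. trig i x * trig j x \<partial>unif) = (if i = j then 1 else 0)" if "i \<in> {1..N}" "j \<in> {1..N}" for i j
      using that by (intro trig_orthonormal) auto
    have lin: "(\<integral>x. (sqrt (dens (vertex N \<gamma> S) x) - 1 - (\<Sum>j\<in>{1..N}. (if j \<in> S then \<gamma> / 2 else - (\<gamma> / 2)) * trig j x))\<^sup>2 \<partial>unif)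
        \<le> 20 * real N ^ 3 * \<gamma> ^ 4" for S
    proof -
      have "(\<Sum>j\<in>{1..N}. (if j \<in> S then \<gamma> / 2 else - (\<gamma> / 2)) * trig j x) = log_dens (vertex N \<gamma> S) x / 2" for x
        unfolding log_dens_vertex sum_divide_distrib by (intro sum.cong) (auto simp: vertex_def)
      then show ?thesis using dens_vertex_linearisation[OF \<gamma>0 small, of S] by (simp only:)
    qed
    have trig_m: "trig j \<in> borel_measurable unif" for j by (intro borel_measurable_unif) measurable
    have "\<exists>S\<subseteq>{1..N}. card {1..N} * \<gamma>\<^sup>2 * (1 - y) ^ (2 * card {1..n}) / 8 - 20 * real N ^ 3 * \<gamma> ^ 4 \<le>
      (\<integral>X. (\<Prod>i\<in>{1..n}. dens (vertex N \<gamma> S) (X i)) * hell2 (dens (vertex N \<gamma> S)) (post_mean {1..n} X) \<partial>PiM {1..n} (\<lambda>_. unif))"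
      using y1
      by (intro hypercube_lower_bound[where \<phi> = trig and d = "sqrt 2" and c = "exp (2 * b)"] trig_m abs_trig_le orth fb lin aff
          post_mean_meas conjI post_mean_bounds) auto
    then obtain S where S: "card {1..N} * \<gamma>\<^sup>2 * (1 - y) ^ (2 * card {1..n}) / 8 - 20 * real N ^ 3 * \<gamma> ^ 4 \<le>
        bayes_risk p Q \<alpha> s n (vertex N \<gamma> S)"
      unfolding risk_eq[OF p Q s Epos inE] by blast
    have "1 / 2 \<le> 1 + real (2 * n) * (- y)" using ny by simp
    also have "\<dots> \<le> (1 + (- y)) ^ (2 * n)" using y1 by (intro Bernoulli_inequality) simp
    finally have half: "1 / 2 \<le> (1 - y) ^ (2 * n)" by simp
    have "h / 32 / real N ^ (2 * p) = real N * \<gamma>\<^sup>2 * (1 / 16 - 1 / 32)"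
      unfolding \<gamma>2 using Nreal by simp
    also have "\<dots> \<le> real N * \<gamma>\<^sup>2 * ((1 - y) ^ (2 * n) / 8 - 20 * ((real N)\<^sup>2 * \<gamma>\<^sup>2))"
      using half N\<gamma> h(3) by (intro mult_left_mono diff_mono) auto
    also have "\<dots> = card {1..N} * \<gamma>\<^sup>2 * (1 - y) ^ (2 * card {1..n}) / 8 - 20 * real N ^ 3 * \<gamma> ^ 4"
      by (simp add: power2_eq_square power3_eq_cube power4_eq_xxxx algebra_simps)
    also note S
    finally show ?thesis using inE' by (auto simp: N_def)
  qed
  show ?thesis using h(1) main by (intro exI[of _ "h / 32"]) auto
qed

theorem corollary1:
  fixes p :: nat and Q Q' \<alpha> s :: real
  assumes "p \<ge> 1" and "Q > 0" and "\<alpha> > 1 / 2" and "s > 0"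
    and "0 < Q'" and "Q' < Q"
  shows "\<exists>c C. 0 < c \<and> c \<le> C \<and>
    (\<forall>\<^sub>F n in sequentially.
      c * real n powr (- (2 * real p / (2 * real p + 1)))
        \<le> (SUP \<theta>\<^sub>0\<in>sobolev_ellipsoid p Q'.
            \<integral>X. (hellinger (dens \<theta>\<^sub>0) (bayes_estimator (prior p Q \<alpha> s n) n X))\<^sup>2 \<partial>sample \<theta>\<^sub>0 n) \<and>
      (SUP \<theta>\<^sub>0\<in>sobolev_ellipsoid p Q'.
            \<integral>X. (hellinger (dens \<theta>\<^sub>0) (bayes_estimator (prior p Q \<alpha> s n) n X))\<^sup>2 \<partial>sample \<theta>\<^sub>0 n)
        \<le> C * real n powr (- (2 * real p / (2 * real p + 1))))"
proof -
  have Q: "0 < Q" using assms by simp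
  obtain \<kappa> where \<kappa>: "0 < \<kappa>" "\<And>n. 1 \<le> n \<Longrightarrow> \<kappa> * scale p n \<le> real (cutoff p Q n)"
      "\<And>n. 1 \<le> n \<Longrightarrow> real (cutoff p Q n) \<le> (\<kappa> + 1) * scale p n"
    using cutoff_scale[OF assms(1) Q] by blast
  obtain C N0 where C: "0 \<le> C" and upper: "\<And>n. 1 \<le> n \<Longrightarrow> N0 \<le> cutoff p Q n \<Longrightarrow>
    0 < measure (unrestricted_prior p Q \<alpha> s n) (sobolev_ellipsoid p Q) \<and>
    (\<forall>\<theta>0\<in>sobolev_ellipsoid p Q'. bayes_risk p Q \<alpha> s n \<theta>0 \<le> C / real (cutoff p Q n) ^ (2 * p))"
    using risk_upper_bound[OF assms(1,3,4,5,6)] by blast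
  obtain c where c: "0 < c" and lower: "\<And>n. 1 \<le> n \<Longrightarrow>
    0 < measure (unrestricted_prior p Q \<alpha> s n) (sobolev_ellipsoid p Q) \<Longrightarrow>
    (\<exists>\<theta>0\<in>sobolev_ellipsoid p Q'. c / real (cutoff p Q n) ^ (2 * p) \<le> bayes_risk p Q \<alpha> s n \<theta>0)"
    using risk_lower_bound[OF assms(1,4,5,6), of \<alpha>] by blast
  define c' where "c' = c / (\<kappa> + 1) ^ (2 * p)"
  define C' where "C' = C / \<kappa> ^ (2 * p)"
  have c': "0 < c'" using c \<kappa>(1) by (simp add: c'_def)
  let ?R = "\<lambda>n. SUP \<theta>\<^sub>0\<in>sobolev_ellipsoid p Q'. bayes_risk p Q \<alpha> s n \<theta>\<^sub>0"
  have bounds: "c' * real n powr (- (2 * real p / (2 * real p + 1))) \<le> ?R n \<and>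
      ?R n \<le> max c' C' * real n powr (- (2 * real p / (2 * real p + 1)))"
    if n: "1 \<le> n" and N0: "N0 \<le> cutoff p Q n" for n
  proof -
    define x where "x = scale p n"
    define N where "N = real (cutoff p Q n)"
    have x: "1 \<le> x" using scale_ge_1[OF n] by (simp add: x_def)
    have Nx: "\<kappa> * x \<le> N" "N \<le> (\<kappa> + 1) * x" using \<kappa>(2,3)[OF n] by (auto simp: x_def N_def)
    have Npos: "0 < N" using Nx(1) x \<kappa>(1) by (meson less_le_trans mult_pos_pos zero_less_one)
    note up = upper[OF n N0]
    have bdd: "bdd_above (bayes_risk p Q \<alpha> s n ` sobolev_ellipsoid p Q')"
      using up by (intro bdd_aboveI2[of _ _ "C / N ^ (2 * p)"]) (auto simp: N_def)
    have ne: "sobolev_ellipsoid p Q' \<noteq> {}" using zero_in_ellipsoid[OF assms(5)] by blast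
    have "?R n \<le> C / N ^ (2 * p)"
      using up ne by (intro cSUP_least) (auto simp: N_def)
    also have "\<dots> \<le> C / (\<kappa> * x) ^ (2 * p)"
      using Nx(1) C x \<kappa>(1) Npos by (intro divide_left_mono power_mono mult_pos_pos zero_less_power) auto
    also have "\<dots> = C' * (1 / x ^ (2 * p))" by (simp add: C'_def power_mult_distrib)
    also have "\<dots> \<le> max c' C' * (1 / x ^ (2 * p))" using x by (intro mult_right_mono) auto
    finally have 1: "?R n \<le> max c' C' * (1 / x ^ (2 * p))" .
    obtain \<theta>0 where \<theta>0: "\<theta>0 \<in> sobolev_ellipsoid p Q'" "c / N ^ (2 * p) \<le> bayes_risk p Q \<alpha> s n \<theta>0"
      using lower[OF n] up by (auto simp: N_def)
    have "c' * (1 / x ^ (2 * p)) = c / ((\<kappa> + 1) * x) ^ (2 * p)" by (simp add: c'_def power_mult_distrib)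
    also have "\<dots> \<le> c / N ^ (2 * p)"
      using Nx(2) c x \<kappa>(1) Npos by (intro divide_left_mono power_mono mult_pos_pos zero_less_power) auto
    also have "\<dots> \<le> bayes_risk p Q \<alpha> s n \<theta>0" by (rule \<theta>0(2))
    also have "\<dots> \<le> ?R n" by (rule cSUP_upper[OF \<theta>0(1) bdd])
    finally show ?thesis using 1 unfolding rate_eq[OF n] x_def by blast
  qed
  have "\<forall>\<^sub>F n in sequentially. c' * real n powr (- (2 * real p / (2 * real p + 1))) \<le> ?R n \<and>
      ?R n \<le> max c' C' * real n powr (- (2 * real p / (2 * real p + 1)))"
    using eventually_cutoff_ge[OF assms(1) Q, of N0] eventually_ge_at_top[of 1]
    by eventually_elim (rule bounds)
  then show ?thesis using c' by (intro exI[of _ c'] exI[of _ "max c' C'"]) simp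
qed

end
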